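(* Let $n\in\mathbb{N}$, let $0<s<2\pi$, and let $P_n(\zeta)$ be an algebraic polynomial of degree $n$ with complex coefficients such that $|P_n(\zeta)|\le 1$ for all $\zeta$ in a measurable subset $E$ of the unit circle $\mathbb{T}$. If $|E|\ge 2\pi-s$, then $$\sup_{\zeta\in\mathbb{T}}|P_n(\zeta)|\le \mathfrak{T}_n\left(\sec\frac s4\right).$$ Moreover, equality holds if and only if $$P_n(e^{iz})=e^{i(nz/2+c_1)}\,\mathfrak{T}_n\left(\sec\frac s4\,\cos\frac{z-c_0}{2}\right)$$ for some $c_0,c_1\in\mathbb{R}$.
   Context: $\mathbb{T}=\{\zeta\in\mathbb{C}:|\zeta|=1\}$, and $|E|$ denotes the Lebesgue (arc length) measure of a measurable set $E\subset\mathbb{T}$, so $|\mathbb{T}|=2\pi$. $\mathfrak{T}_n$ denotes the Chebyshev polynomial (of the first kind) of degree $n$, i.e. $\mathfrak{T}_n(x)=\frac12\big((x+\sqrt{x^2-1})^n+(x-\sqrt{x^2-1})^n\big)$, equivalently the polynomial with $\mathfrak{T}_n(\cos t)=\cos nt$. *)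

theory Defs
  imports "HOL-Analysis.Analysis" "HOL-Computational_Algebra.Polynomial"
begin

section \<open>Chebyshev polynomials of the first kind\<close>

definition chebyshev :: "nat \<Rightarrow> real poly" where
  "chebyshev n = (THE p. \<forall>t. poly p (cos t) = cos (real n * t))"

lemma chebyshev_unique:
  fixes p q :: "real poly"
  assumes "\<And>t. poly p (cos t) = poly q (cos t)"
  shows "p = q"
proof (rule ccontr)
  assume "p \<noteq> q"
  then have fin: "finite {x. poly (p - q) x = 0}"
    by (intro poly_roots_finite) simp
  have "{-1..1} \<subseteq> {x. poly (p - q) x = 0}"
  proof
    fix x :: real
    assume "x \<in> {-1..1}"
    then show "x \<in> {x. poly (p - q) x = 0}"
      using assms[of "arccos x"] by simp
  qed
  then have "finite {-1..1::real}"
    using fin finite_subset by blast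
  then show False
    by (simp add: infinite_Icc)
qed

lemma cos_Suc_Suc:
  fixes t :: real
  shows "cos (real (Suc (Suc n)) * t) = 2 * cos t * cos (real (Suc n) * t) - cos (real n * t)"
proof -
  have "real (Suc (Suc n)) * t = real (Suc n) * t + t" "real n * t = real (Suc n) * t - t"
    by (simp_all add: algebra_simps)
  then show ?thesis
    by (simp only: cos_add cos_diff) (simp add: algebra_simps)
qed

lemma chebyshev_ex: "\<exists>p :: real poly. \<forall>t. poly p (cos t) = cos (real n * t)"
proof (induction n rule: induct_nat_012)
  case 0
  show ?case by (rule exI[of _ 1]) simp
next
  case 1
  show ?case by (rule exI[of _ "[:0, 1:]"]) simp
next
  case (ge2 n)
  then obtain p q :: "real poly"
    where p: "\<And>t. poly p (cos t) = cos (real n * t)"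
      and q: "\<And>t. poly q (cos t) = cos (real (Suc n) * t)"
    by blast
  show ?case
    by (rule exI[of _ "[:0, 2:] * q - p"]) (simp add: p q cos_Suc_Suc del: of_nat_Suc)
qed

lemma chebyshev_cos: "poly (chebyshev n) (cos t) = cos (real n * t)"
proof -
  have "\<exists>!p :: real poly. \<forall>t. poly p (cos t) = cos (real n * t)"
    using chebyshev_ex[of n] chebyshev_unique by metis
  from theI'[OF this] show ?thesis
    by (simp add: chebyshev_def)
qed

lemma chebyshev_0: "chebyshev 0 = 1"
  by (rule chebyshev_unique) (simp add: chebyshev_cos)

lemma chebyshev_1: "chebyshev (Suc 0) = [:0, 1:]"
  by (rule chebyshev_unique) (simp add: chebyshev_cos)

lemma chebyshev_Suc_Suc:
  "chebyshev (Suc (Suc n)) = [:0, 2:] * chebyshev (Suc n) - chebyshev n"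
  by (rule chebyshev_unique) (simp add: chebyshev_cos cos_Suc_Suc del: of_nat_Suc)

lemma degree_chebyshev: "degree (chebyshev n) = n"
proof (induction n rule: induct_nat_012)
  case (ge2 n)
  have "chebyshev (Suc n) \<noteq> 0"
    using ge2(2) by auto
  then have "degree ([:0, 2:] * chebyshev (Suc n)) = Suc (Suc n)"
    using ge2(2) by (subst degree_mult_eq) auto
  then show ?case
    using ge2(1) by (simp only: chebyshev_Suc_Suc diff_conv_add_uminus)
      (subst degree_add_eq_left, simp_all)
qed (simp_all add: chebyshev_0 chebyshev_1)

lemma chebyshev_formula:
  fixes x :: real
  defines "w \<equiv> csqrt (complex_of_real (x\<^sup>2 - 1))"
  shows "complex_of_real (poly (chebyshev n) x) =
           ((complex_of_real x + w) ^ n + (complex_of_real x - w) ^ n) / 2"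
proof (induction n rule: induct_nat_012)
  case (ge2 n)
  have w2: "w\<^sup>2 = (complex_of_real x)\<^sup>2 - 1"
    by (simp add: w_def)
  have step: "a ^ Suc (Suc n) = 2 * complex_of_real x * a ^ Suc n - a ^ n"
    if "a = complex_of_real x + w \<or> a = complex_of_real x - w" for a
  proof -
    have "a\<^sup>2 = 2 * complex_of_real x * a - 1"
      using that
      by (elim disjE; simp only: power2_sum power2_diff w2; simp add: power2_eq_square algebra_simps)
    then have "a ^ n * a\<^sup>2 = a ^ n * (2 * complex_of_real x * a - 1)"
      by simp
    then show ?thesis
      by (simp add: power2_eq_square algebra_simps)
  qed
  show ?case
    unfolding chebyshev_Suc_Suc step[OF disjI1[OF refl]] step[OF disjI2[OF refl]]
    by (simp add: ge2 algebra_simps diff_divide_distrib add_divide_distrib del: power_Suc)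
qed (simp_all add: chebyshev_0 chebyshev_1)


section \<open>Arc length measure on the unit circle\<close>

text \<open>The Lebesgue measure on the circle is the image of the Lebesgue measure on
  \<open>[0, 2\<pi>)\<close> under the parametrization \<open>t \<mapsto> exp (\<i> t)\<close>, which is a bijection onto
  the circle; the half-open interval avoids counting a point twice.\<close>

definition circle_angles :: "complex set \<Rightarrow> real set" where
  "circle_angles E = {t \<in> {0..<2 * pi}. cis t \<in> E}"

definition circle_measurable :: "complex set \<Rightarrow> bool" where
  "circle_measurable E \<longleftrightarrow> E \<subseteq> sphere 0 1 \<and> circle_angles E \<in> sets lebesgue"

definition arc_measure :: "complex set \<Rightarrow> real" where
  "arc_measure E = measure lebesgue (circle_angles E)"

lemma circle_measurable_sphere: "circle_measurable (sphere 0 1)"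
  by (simp add: circle_measurable_def circle_angles_def)

lemma arc_measure_sphere: "arc_measure (sphere 0 1) = 2 * pi"
proof -
  have "circle_angles (sphere 0 1) = {0..<2 * pi}"
    by (auto simp: circle_angles_def)
  then show ?thesis
    by (simp add: arc_measure_def)
qed

end

(*
  Rotate P so that its maximum on the circle is at 1 and suppose that this maximum is at least the
  Chebyshev value. Among the real functions t |-> exp(-int/2) Q(exp(it)) with deg Q <= n that are
  bounded by 1 on the set E where |P| <= 1, take q with maximal q(0): it alternates n + 1 times
  between 1 and -1 on E, so all solutions of q = y with |y| <= 1 are real, and q = cos theta for a
  holomorphic theta from the upper half plane into itself. Re theta' > 0, hence theta is injective,
  and therefore theta avoids the vertical slits at n pi Z whose height is given by the gap of E
  around 0. The harmonic measure of these slits is explicit, it vanishes on the real line, and the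
  mean value property of its composition with theta bounds the measure of {|q| > 1} from below by s
  (Loewner's lemma). In the equality case E is an arc, and on an arc the extremal function is
  identified by Lagrange interpolation.
*)

theory Submission
  imports Defs "HOL-Complex_Analysis.Complex_Analysis"
    "HOL-Computational_Algebra.Fundamental_Theorem_Algebra"
begin

section \<open>Trigonometric polynomials of half-integer degree\<close>


text \<open>Inequality and equality case rest on one implication: a maximum of at least the
  Chebyshev value forces the extremal form, whose maximum is exactly that value. \<open>P\<close> is
  traded for \<open>q\<close> because alternation makes all level points real. Summing z / (z - a)
  over zeros turns this into a sign for the logarithmic derivative of
  \<open>cos (k \<theta>)\<close>, and k to infinity isolates Re \<theta>'. The image of \<theta> is
  never determined: injectivity and the avoided slits suffice, so neither a Riemann map nor a
  Caratheodory extension is needed. Boundary values are taken only where \<open>q\<close> is neither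
  1 nor -1, that is off finitely many points of a period. The constants fit as follows: the slits
  reach at least to height n h, where cosh h = sec(s/4); \<open>K\<close> sends the points k n pi +
  i n h to -1, the real line (off its poles) into [1, infinity), and i infinity to cos(s/2), whose
  arccos is s/2. Hence the integral over a period is 2 pi times s/2, while the boundary values are
  at most pi and vanish where |q| < 1.\<close>

text \<open>The exponents k - n/2 are symmetric about 0, so the class is closed under conjugation
  and under real parts, and |f| = |Q| on the circle. For odd n its members change sign under t -> t
  + 2 pi.\<close>

definition semitrig :: "nat \<Rightarrow> (real \<Rightarrow> complex) \<Rightarrow> bool" where
  "semitrig n f \<longleftrightarrow>
     (\<exists>Q. degree Q \<le> n \<and> (\<forall>t. f t = cis (- (real n * t / 2)) * poly Q (cis t)))"

lemma semitrigI:
  "degree Q \<le> n \<Longrightarrow> (\<And>t. f t = cis (- (real n * t / 2)) * poly Q (cis t)) \<Longrightarrow> semitrig n f"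
  by (auto simp: semitrig_def)

lemma semitrigE:
  assumes "semitrig n f"
  obtains Q where "degree Q \<le> n" "\<And>t. f t = cis (- (real n * t / 2)) * poly Q (cis t)"
  using assms by (auto simp: semitrig_def)

lemma semitrig_add:
  assumes "semitrig n f" "semitrig n g"
  shows "semitrig n (\<lambda>t. f t + g t)"
proof -
  obtain P Q where "degree P \<le> n" "\<And>t. f t = cis (- (real n * t / 2)) * poly P (cis t)"
    "degree Q \<le> n" "\<And>t. g t = cis (- (real n * t / 2)) * poly Q (cis t)"
    using assms by (auto simp: semitrig_def)
  then show ?thesis
    by (intro semitrigI[of "P + Q"]) (auto intro: degree_add_le simp: algebra_simps)
qed

lemma semitrig_mult:
  assumes "semitrig m f" "semitrig n g"
  shows "semitrig (m + n) (\<lambda>t. f t * g t)"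
proof -
  obtain P Q where P: "degree P \<le> m" "\<And>t. f t = cis (- (real m * t / 2)) * poly P (cis t)"
    and Q: "degree Q \<le> n" "\<And>t. g t = cis (- (real n * t / 2)) * poly Q (cis t)"
    using assms by (auto simp: semitrig_def)
  have "f t * g t = cis (- (real (m + n) * t / 2)) * poly (P * Q) (cis t)" for t
  proof -
    have "cis (- (real (m + n) * t / 2)) = cis (- (real m * t / 2)) * cis (- (real n * t / 2))"
      by (simp add: cis_mult algebra_simps add_divide_distrib diff_divide_distrib)
    then show ?thesis
      by (simp add: P Q)
  qed
  moreover have "degree (P * Q) \<le> m + n"
    using P(1) Q(1) degree_mult_le[of P Q] by linarith
  ultimately show ?thesis
    by (rule semitrigI[rotated])
qed

lemma semitrig_const: "semitrig 0 (\<lambda>t. c)"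
  by (rule semitrigI[of "[:c:]"]) auto

lemma semitrig_cmult: "semitrig n f \<Longrightarrow> semitrig n (\<lambda>t. c * f t)"
  using semitrig_mult[OF semitrig_const, of n f c] by simp

lemma semitrig_diff:
  assumes "semitrig n f" "semitrig n g"
  shows "semitrig n (\<lambda>t. f t - g t)"
  using semitrig_add[OF assms(1) semitrig_cmult[OF assms(2), of "-1"]] by simp

lemma semitrig_zero: "semitrig n (\<lambda>t. 0)"
  by (rule semitrigI[of 0]) auto

lemma semitrig_sum:
  "(\<And>i. i \<in> I \<Longrightarrow> semitrig n (f i)) \<Longrightarrow> semitrig n (\<lambda>t. \<Sum>i\<in>I. f i t)"
  by (induction I rule: infinite_finite_induct) (auto intro: semitrig_zero semitrig_add)

lemma semitrig_prod:
  "finite I \<Longrightarrow> (\<And>i. i \<in> I \<Longrightarrow> semitrig 1 (f i)) \<Longrightarrow> semitrig (card I) (\<lambda>t. \<Prod>i\<in>I. f i t)"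
proof (induction I rule: finite_induct)
  case (insert x F)
  then have "semitrig (1 + card F) (\<lambda>t. f x t * (\<Prod>i\<in>F. f i t))"
    by (intro semitrig_mult) auto
  then show ?case
    using insert by simp
qed (simp add: semitrig_const)

lemma semitrig_power: "semitrig 1 f \<Longrightarrow> semitrig k (\<lambda>t. f t ^ k)"
  using semitrig_prod[of "{..<k}" "\<lambda>_. f"] by simp

lemma semitrig_prod_list:
  "(\<And>y. y \<in> set ys \<Longrightarrow> semitrig 1 (f y)) \<Longrightarrow>
    semitrig (length ys) (\<lambda>t. \<Prod>y\<leftarrow>ys. f y t)"
proof (induction ys)
  case (Cons y ys)
  then have "semitrig (1 + length ys) (\<lambda>t. f y t * (\<Prod>y\<leftarrow>ys. f y t))"
    by (intro semitrig_mult) auto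
  then show ?case by simp
qed (simp add: semitrig_const)

text \<open>The frequencies of degree n are congruent to n/2 modulo 1, so the degree is raised by
  two, not by one. This is what the three-term Chebyshev recursion needs.\<close>

lemma semitrig_raise:
  assumes "semitrig n f" shows "semitrig (Suc (Suc n)) f"
proof -
  obtain Q where Q: "degree Q \<le> n" "\<And>t. f t = cis (- (real n * t / 2)) * poly Q (cis t)"
    using assms by (rule semitrigE) blast
  show ?thesis
  proof (rule semitrigI[of "[:0, 1:] * Q"])
    show "degree ([:0, 1:] * Q) \<le> Suc (Suc n)"
      using degree_mult_le[of "[:0, 1:]" Q] Q(1) by simp
    fix t
    have "cis (- (real (Suc (Suc n)) * t / 2)) * cis t = cis (- (real n * t / 2))"
      by (simp add: cis_mult field_simps)
    then show "f t = cis (- (real (Suc (Suc n)) * t / 2)) * poly ([:0, 1:] * Q) (cis t)"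
      unfolding Q(2) by (simp flip: mult.assoc)
  qed
qed

text \<open>Conjugation reverses the coefficient list: the exponent k - n/2 becomes (n - k) -
  n/2.\<close>

lemma semitrig_cnj:
  assumes "semitrig n f" shows "semitrig n (\<lambda>t. cnj (f t))"
proof -
  obtain Q where Q: "degree Q \<le> n" "\<And>t. f t = cis (- (real n * t / 2)) * poly Q (cis t)"
    using assms by (rule semitrigE) blast
  define R where "R = (\<Sum>k\<le>n. monom (cnj (coeff Q k)) (n - k))"
  show ?thesis
  proof (rule semitrigI[of R])
    show "degree R \<le> n"
      unfolding R_def by (intro degree_sum_le) (auto intro: order_trans[OF degree_monom_le])
    fix t
    have poly: "poly Q x = (\<Sum>k\<le>n. coeff Q k * x ^ k)" for x
      unfolding poly_altdef using Q(1) by (intro sum.mono_neutral_left) (auto simp: coeff_eq_0)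
    have "cnj (f t) = cis (real n * t / 2) * (\<Sum>k\<le>n. cnj (coeff Q k) * cis (- t) ^ k)"
      unfolding Q(2) by (subst poly) (simp add: cis_cnj)
    also have "\<dots> = (\<Sum>k\<le>n. cis (- (real n * t / 2)) * (cnj (coeff Q k) * cis t ^ (n - k)))"
      unfolding sum_distrib_left
    proof (rule sum.cong)
      fix k assume "k \<in> {..n}"
      then have "cis (real n * t / 2) * cis (- t) ^ k = cis (- (real n * t / 2)) * cis t ^ (n - k)"
        by (simp add: Complex.DeMoivre cis_mult of_nat_diff field_simps)
      then show "cis (real n * t / 2) * (cnj (coeff Q k) * cis (- t) ^ k) =
          cis (- (real n * t / 2)) * (cnj (coeff Q k) * cis t ^ (n - k))"
        by (metis mult.left_commute)
    qed simp
    also have "\<dots> = cis (- (real n * t / 2)) * poly R (cis t)"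
      by (simp add: R_def poly_sum poly_monom sum_distrib_left)
    finally show "cnj (f t) = cis (- (real n * t / 2)) * poly R (cis t)" .
  qed
qed

lemma semitrig_Re:
  assumes "semitrig n f" shows "semitrig n (\<lambda>t. of_real (Re (f t)))"
proof -
  have "(\<lambda>t. complex_of_real (Re (f t))) = (\<lambda>t. (1/2) * (f t + cnj (f t)))"
    by (simp add: complex_add_cnj fun_eq_iff)
  then show ?thesis
    using semitrig_cmult[OF semitrig_add[OF assms semitrig_cnj[OF assms]], of "1/2"] by simp
qed

lemma semitrig_Im:
  assumes "semitrig n f" shows "semitrig n (\<lambda>t. of_real (Im (f t)))"
  using semitrig_Re[OF semitrig_cmult[OF assms, of "-\<i>"]] by simp

lemma semitrig_sin: "semitrig 1 (\<lambda>t. of_real (sin ((t - y) / 2)))"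
proof -
  have 1: "semitrig 1 (\<lambda>t. cis (- (t / 2)) * cis t)"
    by (rule semitrigI[of "[:0, 1:]"]) auto
  have "(\<lambda>t. complex_of_real (sin ((t - y) / 2))) =
      (\<lambda>t. of_real (Im (cis (- y / 2) * (cis (- (t / 2)) * cis t))))"
    by (simp only: cis_mult) (simp add: field_simps)
  then show ?thesis
    using semitrig_Im[OF semitrig_cmult[OF 1, of "cis (- y / 2)"]] by (simp only:)
qed

lemma semitrig_continuous: "semitrig n f \<Longrightarrow> continuous_on A f"
  by (erule semitrigE) (simp, intro continuous_intros, auto)

lemma cis_inj_on: "inj_on cis {0..<2 * pi}"
proof (rule inj_onI)
  fix x y assume *: "x \<in> {0..<2 * pi}" "y \<in> {0..<2 * pi}" "cis x = cis y"
  then have "exp (\<i> * of_real x) = exp (\<i> * of_real y)"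
    by (simp add: cis_conv_exp)
  then obtain k :: int where k: "\<i> * of_real x = \<i> * of_real y + (of_int (2 * k) * pi) * \<i>"
    unfolding exp_eq by auto
  then have "\<i> * complex_of_real x = \<i> * complex_of_real (y + of_int (2 * k) * pi)"
    by (simp add: algebra_simps)
  then have "complex_of_real x = complex_of_real (y + of_int (2 * k) * pi)"
    by (metis complex_i_not_zero mult_cancel_left)
  then have xy: "x = y + of_int (2 * k) * pi"
    using of_real_eq_iff by blast
  have "k < 1"
  proof (rule ccontr)
    assume "\<not> k < 1" then have "real_of_int (2 * k) \<ge> 2" by simp
    from mult_right_mono[OF this, of pi] have "2 * pi \<le> real_of_int (2 * k) * pi" by simp
    then show False using * xy unfolding atLeastLessThan_iff by linarith
  qed
  moreover have "k > -1"
  proof (rule ccontr)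
    assume "\<not> k > -1" then have "real_of_int (2 * k) \<le> -2" by simp
    from mult_right_mono[OF this, of pi] have "real_of_int (2 * k) * pi \<le> - 2 * pi" by simp
    then show False using * xy unfolding atLeastLessThan_iff by linarith
  qed
  ultimately show "x = y" using xy by simp
qed

text \<open>Distinct points of a half-open period give distinct zeros of \<open>Q\<close> on the
  circle, more than its degree allows.\<close>

lemma semitrig_eq_zero:
  assumes f: "semitrig n f" and T: "T \<subseteq> {0..<2 * pi}" "card T > n"
    and z: "\<And>t. t \<in> T \<Longrightarrow> f t = 0"
  shows "f t = 0"
proof -
  obtain Q where Q: "degree Q \<le> n" "\<And>t. f t = cis (- (real n * t / 2)) * poly Q (cis t)"
    using f by (rule semitrigE) blast
  have "Q = 0"
  proof (rule ccontr)
    assume "Q \<noteq> 0"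
    have "finite T" using T(2) by (metis card.infinite not_less_zero)
    have "cis ` T \<subseteq> {x. poly Q x = 0}"
      using z Q(2) by auto
    then have "card (cis ` T) \<le> card {x. poly Q x = 0}"
      using poly_roots_finite[OF \<open>Q \<noteq> 0\<close>] by (rule card_mono[rotated])
    also have "\<dots> \<le> n"
      using card_poly_roots_bound[OF \<open>Q \<noteq> 0\<close>] Q(1) by linarith
    finally show False
      using T card_image[OF inj_on_subset[OF cis_inj_on T(1)]] by simp
  qed
  then show ?thesis by (simp add: Q(2))
qed

lemma semitrig_eq:
  assumes "semitrig n f" "semitrig n g" and T: "T \<subseteq> {0..<2 * pi}" "card T > n"
    and "\<And>t. t \<in> T \<Longrightarrow> f t = g t"
  shows "f t = g t"
  using semitrig_eq_zero[OF semitrig_diff[OF assms(1,2)] T] assms(5) by simp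

lemma semitrig_chebyshev:
  "semitrig n (\<lambda>t. of_real (poly (chebyshev n) (a * cos ((t - c0) / 2))))"
proof -
  have base: "semitrig 1 (\<lambda>t. of_real (a * cos ((t - c0) / 2)))"
  proof -
    have "sin ((t - (c0 - pi)) / 2) = cos ((t - c0) / 2)" for t
      using sin_add[of "(t - c0) / 2" "pi / 2"] by (simp add: field_simps)
    then show ?thesis
      using semitrig_cmult[OF semitrig_sin[of "c0 - pi"], of "of_real a"] by simp
  qed
  show ?thesis
  proof (induction n rule: induct_nat_012)
    case 0 show ?case by (simp add: chebyshev_0 semitrig_const)
  next
    case 1 show ?case using base by (simp add: chebyshev_1)
  next
    case (ge2 n)
    show ?case
      using semitrig_diff[OF semitrig_cmult[OF semitrig_mult[OF base ge2(2)], of 2, unfolded One_nat_def plus_nat.simps]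
        semitrig_raise[OF ge2(1)]]
      by (simp add: chebyshev_Suc_Suc algebra_simps)
  qed
qed

section \<open>Lagrange interpolation with half-angle sines as linear factors\<close>

definition lagrange_sin :: "nat \<Rightarrow> (nat \<Rightarrow> real) \<Rightarrow> nat \<Rightarrow> real \<Rightarrow> real" where
  "lagrange_sin n \<tau> j t = (\<Prod>i\<in>{..n} - {j}. sin ((t - \<tau> i) / 2) / sin ((\<tau> j - \<tau> i) / 2))"

lemma semitrig_lagrange:
  assumes "j \<le> n" shows "semitrig n (\<lambda>t. of_real (lagrange_sin n \<tau> j t))"
proof -
  have "semitrig 1 (\<lambda>t. of_real (sin ((t - \<tau> i) / 2) / sin ((\<tau> j - \<tau> i) / 2)))" for i
    using semitrig_cmult[OF semitrig_sin[of "\<tau> i"], of "of_real (1 / sin ((\<tau> j - \<tau> i) / 2))"]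
    by simp
  from semitrig_prod[OF _ this, of "{..n} - {j}" "\<lambda>i. i"] assms
  show ?thesis by (simp add: lagrange_sin_def)
qed

lemma sin_half_pos: "x < t \<Longrightarrow> t - x < 2 * pi \<Longrightarrow> sin ((t - x) / 2) > 0"
  by (rule sin_gt_zero) auto

lemma sin_half_neg: "t < x \<Longrightarrow> x - t < 2 * pi \<Longrightarrow> sin ((t - x) / 2) < 0"
  using sin_half_pos[of t x] by (simp add: minus_divide_left[symmetric] flip: sin_minus) (metis minus_diff_eq minus_divide_left neg_0_less_iff_less sin_minus)

lemma lagrange_node:
  assumes "inj_on \<tau> {..n}" "\<And>i. i \<le> n \<Longrightarrow> \<tau> i \<in> {0..<2 * pi}" "j \<le> n" "k \<le> n"
  shows "lagrange_sin n \<tau> j (\<tau> k) = (if j = k then 1 else 0)"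
proof (cases "j = k")
  case True
  have "sin ((\<tau> j - \<tau> i) / 2) \<noteq> 0" if "i \<in> {..n} - {j}" for i
  proof -
    have "\<tau> i \<noteq> \<tau> j" using that assms by (auto simp: inj_on_def)
    then show ?thesis
      using sin_half_pos[of "\<tau> i" "\<tau> j"] sin_half_neg[of "\<tau> j" "\<tau> i"] assms(2)[of i] assms(2)[of j] that assms(3)
      by (cases "\<tau> i < \<tau> j") auto
  qed
  then show ?thesis using True by (simp add: lagrange_sin_def)
next
  case False
  then show ?thesis
    using assms(4) by (simp add: lagrange_sin_def, intro bexI[of _ k]) auto
qed

lemma semitrig_interpolation:
  assumes f: "semitrig n f"
    and \<tau>: "inj_on \<tau> {..n}" "\<And>i. i \<le> n \<Longrightarrow> \<tau> i \<in> {0..<2 * pi}"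
  shows "f t = (\<Sum>j\<le>n. f (\<tau> j) * of_real (lagrange_sin n \<tau> j t))"
proof (rule semitrig_eq[OF f, of _ "\<tau> ` {..n}"])
  show "semitrig n (\<lambda>t. \<Sum>j\<le>n. f (\<tau> j) * of_real (lagrange_sin n \<tau> j t))"
    by (intro semitrig_sum semitrig_cmult semitrig_lagrange) auto
  show "card (\<tau> ` {..n}) > n" using \<tau>(1) by (simp add: card_image)
  fix x assume "x \<in> \<tau> ` {..n}"
  then obtain k where k: "k \<le> n" "x = \<tau> k" by auto
  have "(\<Sum>j\<le>n. f (\<tau> j) * of_real (lagrange_sin n \<tau> j x)) = (\<Sum>j\<le>n. if j = k then f (\<tau> j) else 0)"
    by (rule sum.cong) (auto simp: k lagrange_node[OF \<tau>])
  then show "f x = (\<Sum>j\<le>n. f (\<tau> j) * of_real (lagrange_sin n \<tau> j x))"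
    using k by simp
qed (use \<tau> in auto)

text \<open>All nodes lie to the right of 0, so every numerator is negative; the denominators are
  positive for i < j and negative for i > j. Exactly j factors are negative.\<close>

lemma lagrange_sign_at_0:
  assumes \<tau>: "strict_mono_on {..n} \<tau>" "\<And>i. i \<le> n \<Longrightarrow> \<tau> i \<in> {0<..<2 * pi}" and "j \<le> n"
  shows "(-1) ^ j * lagrange_sin n \<tau> j 0 > 0"
proof -
  have split: "{..n} - {j} = {..<j} \<union> {j<..n}" using assms(3) by auto
  have lt: "\<tau> i < \<tau> k" if "i < k" "k \<le> n" for i k
    using strict_mono_onD[OF \<tau>(1), of i k] that by auto
  have s0: "sin ((0 - \<tau> i) / 2) < 0" if "i \<le> n" for i
    using \<tau>(2)[OF that] by (intro sin_half_neg) auto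
  define r where "r i = sin ((0 - \<tau> i) / 2) / sin ((\<tau> j - \<tau> i) / 2)" for i
  have neg: "r i < 0" if "i < j" for i
    unfolding r_def using s0[of i] that assms(3) \<tau>(2)[of i] \<tau>(2)[of j] lt[of i j]
    by (intro divide_neg_pos sin_half_pos) auto
  have pos: "r i > 0" if "i > j" "i \<le> n" for i
    unfolding r_def using s0[of i] that assms(3) \<tau>(2)[of i] \<tau>(2)[of j] lt[of j i]
    by (intro divide_neg_neg sin_half_neg) auto
  have "lagrange_sin n \<tau> j 0 = (\<Prod>i<j. r i) * (\<Prod>i\<in>{j<..n}. r i)"
    unfolding lagrange_sin_def split r_def by (intro prod.union_disjoint) auto
  moreover have "(-1) ^ j * (\<Prod>i<j. r i) = (\<Prod>i<j. - r i)"
    by (simp add: prod_uminus)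
  moreover have "(\<Prod>i<j. - r i) > 0" using neg by (intro prod_pos) auto
  moreover have "(\<Prod>i\<in>{j<..n}. r i) > 0" using pos by (intro prod_pos) auto
  ultimately show ?thesis
    by (metis mult.assoc mult_pos_pos)
qed

section \<open>Alternation of extremal polynomials\<close>


lemma prod_list_pos:
  "(\<And>x. x \<in> set xs \<Longrightarrow> x > 0) \<Longrightarrow> prod_list xs > (0::real)"
  by (induction xs) auto

text \<open>The induction swaps \<open>A\<close> and \<open>B\<close> at the leftmost point of \<open>A\<close>.\<close>

lemma alternation_or_separation:
  assumes "compact A" "compact B" "A \<inter> B = {}" "A \<subseteq> {l<..<2 * pi}" "B \<subseteq> {l<..<2 * pi}" "0 \<le> l"
  shows "(\<exists>\<tau>. (\<forall>i<k. \<tau> i < \<tau> (Suc i)) \<and> (\<forall>i\<le>k. \<tau> i \<in> (if even i then A else B))) \<or>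
    (\<exists>ys. length ys \<le> k \<and> set ys \<subseteq> {l<..<2 * pi} \<and>
      (\<forall>t\<in>A. (\<Prod>y\<leftarrow>ys. sin ((y - t) / 2)) < 0) \<and> (\<forall>t\<in>B. (\<Prod>y\<leftarrow>ys. sin ((y - t) / 2)) > 0))"
  using assms
proof (induction k arbitrary: A B l)
  case 0
  show ?case
  proof (cases "A = {}")
    case True
    then show ?thesis by (intro disjI2 exI[of _ "[]"]) auto
  next
    case False
    then obtain a where "a \<in> A" by auto
    then show ?thesis by (intro disjI1 exI[of _ "\<lambda>_. a"]) auto
  qed
next
  case (Suc k)
  show ?case
  proof (cases "A = {}")
    case True
    then show ?thesis by (intro disjI2 exI[of _ "[]"]) auto
  next
    case False
    obtain t0 where t0: "t0 \<in> A" "\<And>t. t \<in> A \<Longrightarrow> t0 \<le> t"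
      using compact_attains_inf[OF Suc.prems(1) False] by auto
    have "t0 \<notin> B" using Suc.prems(3) t0 by auto
    have "\<exists>b\<ge>l. b < t0 \<and> (\<forall>t\<in>B. t \<le> t0 \<longrightarrow> t \<le> b)"
    proof (cases "B \<inter> {..t0} = {}")
      case True
      then show ?thesis using t0 Suc.prems(4) by (intro exI[of _ l]) auto
    next
      case False
      have "compact (B \<inter> {..t0})" using Suc.prems(2) by (simp add: compact_Int_closed)
      then obtain b where b: "b \<in> B \<inter> {..t0}" "\<And>t. t \<in> B \<inter> {..t0} \<Longrightarrow> t \<le> b"
        using compact_attains_sup[OF _ False] by auto
      then have "b < t0" using \<open>t0 \<notin> B\<close> by (auto simp: less_le)
      moreover have "b \<ge> l" using b Suc.prems(5) by auto
      ultimately show ?thesis using b by (intro exI[of _ b]) auto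
    qed
    then obtain b where b: "l \<le> b" "b < t0" "\<And>t. t \<in> B \<Longrightarrow> t \<le> t0 \<Longrightarrow> t \<le> b" by auto
    \<comment> \<open>The cut \<open>y\<close> separates the leftmost point \<open>t0\<close> of
      \<open>A\<close> from the points of \<open>B\<close> before it. The rest lies to the right of
      \<open>y\<close>, and there the roles of \<open>A\<close> and \<open>B\<close> are
      exchanged.\<close>
    define y where "y = (b + t0) / 2"
    have y: "b < y" "y < t0" "l < y" using b by (auto simp: y_def)
    have y2: "y < 2 * pi" using y t0 Suc.prems(4) by fastforce
    have "compact (B \<inter> {t0..})" using Suc.prems(2) by (simp add: compact_Int_closed)
    moreover have "A \<subseteq> {y<..<2 * pi}" using t0(2) y Suc.prems(4) by (force simp: less_le_trans)
    moreover have "B \<inter> {t0..} \<subseteq> {y<..<2 * pi}" using y Suc.prems(5) by (force simp: less_le_trans)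
    moreover have "(B \<inter> {t0..}) \<inter> A = {}" using Suc.prems(3) by auto
    ultimately consider
      \<tau> where "\<forall>i<k. \<tau> i < \<tau> (Suc i)" "\<forall>i\<le>k. \<tau> i \<in> (if even i then B \<inter> {t0..} else A)"
    | ys where "length ys \<le> k" "set ys \<subseteq> {y<..<2 * pi}"
        "\<forall>t\<in>B \<inter> {t0..}. (\<Prod>y\<leftarrow>ys. sin ((y - t) / 2)) < 0" "\<forall>t\<in>A. (\<Prod>y\<leftarrow>ys. sin ((y - t) / 2)) > 0"
      using Suc.IH[of "B \<inter> {t0..}" A y] Suc.prems(1,6) y by force
    then show ?thesis
    proof cases
      case (1 \<tau>)
      define \<sigma> where "\<sigma> i = (case i of 0 \<Rightarrow> t0 | Suc j \<Rightarrow> \<tau> j)" for i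
      have "\<tau> 0 \<in> B \<inter> {t0..}" using 1(2) by force
      then have "t0 < \<tau> 0" using \<open>t0 \<notin> B\<close> by (auto simp: less_le)
      then have "\<forall>i<Suc k. \<sigma> i < \<sigma> (Suc i)"
        using 1(1) by (auto simp: \<sigma>_def split: nat.split)
      moreover have "\<forall>i\<le>Suc k. \<sigma> i \<in> (if even i then A else B)"
        using 1(2) t0(1) by (auto simp: \<sigma>_def split: nat.split)
      ultimately show ?thesis by blast
    next
      case (2 ys)
      \<comment> \<open>The new factor flips the sign of the old product on \<open>A\<close> and on
        the part of \<open>B\<close> after the cut; points of \<open>B\<close> before the cut see
        only positive factors.\<close>
      have "(\<Prod>y\<leftarrow>y # ys. sin ((y - t) / 2)) < 0" if "t \<in> A" for t
      proof -
        have "sin ((y - t) / 2) < 0"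
          using t0(2)[OF that] y Suc.prems(4,6) that by (intro sin_half_neg) force+
        then show ?thesis using 2(4) that by (simp add: mult_neg_pos)
      qed
      moreover have "(\<Prod>y\<leftarrow>y # ys. sin ((y - t) / 2)) > 0" if "t \<in> B" for t
      proof (cases "t \<ge> t0")
        case True
        then have "sin ((y - t) / 2) < 0"
          using y Suc.prems(5,6) that by (intro sin_half_neg) force+
        then show ?thesis using 2(3) that True by (auto simp: mult_neg_neg)
      next
        case False
        then have *: "t \<le> b" "l < t" using b(3) that Suc.prems(5) by auto
        have "sin ((z - t) / 2) > 0" if "z \<in> set (y # ys)" for z
          using that 2(2) * y y2 Suc.prems(6) by (intro sin_half_pos) force+
        then show ?thesis
          by (intro prod_list_pos) auto
      qed
      ultimately show ?thesis
        using 2(1,2) y y2 by (intro disjI2 exI[of _ "y # ys"]) auto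
    qed
  qed
qed

section \<open>Existence of the extremal function by compactness\<close>

lemma compact_Pi_UNIV:
  fixes S :: "'b::t2_space set"
  assumes "compact S" shows "compact {a :: 'a \<Rightarrow> 'b. \<forall>j. a j \<in> S}"
proof -
  have "compactin (product_topology (\<lambda>_::'a. euclidean :: 'b topology) UNIV) (PiE UNIV (\<lambda>_. S))"
    using assms by (simp add: compactin_PiE)
  then show ?thesis
    by (simp add: euclidean_product_topology PiE_UNIV_domain Pi_def)
qed

definition admissible :: "nat \<Rightarrow> real set \<Rightarrow> (real \<Rightarrow> real) \<Rightarrow> bool" where
  "admissible n E q \<longleftrightarrow> semitrig n (\<lambda>t. of_real (q t)) \<and> (\<forall>t\<in>E. \<bar>q t\<bar> \<le> 1)"

text \<open>A function of degree n is determined by its values at n + 1 nodes of \<open>E\<close>,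
  and for admissible functions these lie in [-1, 1]. So the admissible functions correspond to a
  compact set of coefficient vectors, on which the value at 0 is continuous.\<close>

lemma extremal_exists:
  assumes "infinite E" "E \<subseteq> {0..<2 * pi}"
  obtains q where "admissible n E q" "\<And>p. admissible n E p \<Longrightarrow> p 0 \<le> q 0"
proof -
  obtain T where T: "T \<subseteq> E" "finite T" "card T = Suc n"
    using infinite_arbitrarily_large[OF assms(1)] by metis
  obtain \<tau> where \<tau>: "bij_betw \<tau> {..n} T"
    using T ex_bij_betw_nat_finite[of T] by (auto simp: atLeast0LessThan lessThan_Suc_atMost)
  have inj: "inj_on \<tau> {..n}" and E: "\<And>i. i \<le> n \<Longrightarrow> \<tau> i \<in> E"
    using \<tau> T(1) by (auto simp: bij_betw_def)
  then have r: "\<And>i. i \<le> n \<Longrightarrow> \<tau> i \<in> {0..<2 * pi}" using assms(2) by blast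
  define L where "L a t = (\<Sum>j\<le>n. a j * lagrange_sin n \<tau> j t)" for a :: "nat \<Rightarrow> real" and t
  have Lsemi: "semitrig n (\<lambda>t. of_real (L a t))" for a
    unfolding L_def by (simp, intro semitrig_sum semitrig_cmult semitrig_lagrange) auto
  define C where "C = {a :: nat \<Rightarrow> real. \<forall>j. a j \<in> {-1..1}} \<inter> (\<Inter>t\<in>E. {a. \<bar>L a t\<bar> \<le> 1})"
  have contL: "continuous_on UNIV (\<lambda>a. L a t)" for t
    unfolding L_def by (intro continuous_intros continuous_on_product_coordinates)
  have "compact C"
    unfolding C_def
    by (intro compact_Int_closed compact_Pi_UNIV closed_INT ballI closed_Collect_le
      continuous_intros contL) auto
  moreover have "(\<lambda>_. 0) \<in> C" by (auto simp: C_def L_def)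
  ultimately obtain a where a: "a \<in> C" "\<And>b. b \<in> C \<Longrightarrow> L b 0 \<le> L a 0"
    using continuous_attains_sup[of C "\<lambda>a. L a 0"] continuous_on_subset[OF contL] by blast
  show ?thesis
  proof
    show "admissible n E (L a)"
      using a(1) Lsemi by (auto simp: admissible_def C_def)
    fix p assume p: "admissible n E p"
    \<comment> \<open>Vectors are indexed by all naturals so that compactness is Tychonoff's
      theorem; 0 is the filler beyond n.\<close>
    define b where "b j = (if j \<le> n then p (\<tau> j) else 0)" for j
    have "complex_of_real (p t) = of_real (L b t)" for t
      using semitrig_interpolation[OF _ inj r, of "\<lambda>t. of_real (p t)" t] p
      by (simp add: admissible_def L_def b_def)
    then have "p = L b" by (auto simp: fun_eq_iff)
    moreover have "b \<in> C"
      using p E \<open>p = L b\<close> by (auto simp: C_def admissible_def b_def abs_le_iff)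
    ultimately show "p 0 \<le> L a 0" using a(2) by simp
  qed
qed

text \<open>If there is no such chain, a product of at most n half-angle sines is opposite in sign
  to \<open>q\<close> wherever |q| = 1 on \<open>E\<close>. A small multiple of it can be added
  without leaving the bound on \<open>E\<close>, and raises the value at 0. The chain starts with
  the value 1 because 0 lies to the left of \<open>E\<close> and the product is positive
  there.\<close>

lemma extremal_alternates:
  assumes E: "compact E" "E \<noteq> {}" "E \<subseteq> {0<..<2 * pi}"
    and q: "admissible n E q" "\<And>p. admissible n E p \<Longrightarrow> p 0 \<le> q 0"
  shows "\<exists>\<tau>. (\<forall>i<n. \<tau> i < \<tau> (Suc i)) \<and> (\<forall>i\<le>n. \<tau> i \<in> E \<and> q (\<tau> i) = (-1) ^ i)"
proof -
  have contq: "continuous_on S q" for S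
    using semitrig_continuous[of n "\<lambda>t. of_real (q t)" S] q(1)
    by (auto simp: admissible_def continuous_on_of_real_o_iff[unfolded o_def])
  define A where "A = E \<inter> {t. q t = 1}"
  define B where "B = E \<inter> {t. q t = -1}"
  have "compact A" "compact B"
    unfolding A_def B_def
    by (auto intro!: compact_Int_closed E closed_Collect_eq contq)
  moreover have "A \<inter> B = {}" "A \<subseteq> {0<..<2 * pi}" "B \<subseteq> {0<..<2 * pi}"
    using E(3) by (auto simp: A_def B_def)
  ultimately consider
      \<tau> where "\<forall>i<n. \<tau> i < \<tau> (Suc i)" "\<forall>i\<le>n. \<tau> i \<in> (if even i then A else B)"
    | ys where "length ys \<le> n" "set ys \<subseteq> {0<..<2 * pi}"
        "\<forall>t\<in>A. (\<Prod>y\<leftarrow>ys. sin ((y - t) / 2)) < 0" "\<forall>t\<in>B. (\<Prod>y\<leftarrow>ys. sin ((y - t) / 2)) > 0"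
    using alternation_or_separation[of A B 0 n] by force
  then show ?thesis
  proof cases
    case (1 \<tau>)
    then show ?thesis
      by (intro exI[of _ \<tau>]) (auto simp: A_def B_def split: if_splits)
  next
    case (2 ys)
    obtain m where m: "m \<in> E" "\<And>t. t \<in> E \<Longrightarrow> t \<le> m"
      using compact_attains_sup[OF E(1,2)] by auto
    \<comment> \<open>The power of the extra sine pads the degree to n. Its zero
      \<open>-\<eta>\<close> is, modulo a period, the midpoint of max \<open>E\<close> and 2 pi, so
      it changes no sign on \<open>E\<close> or at 0.\<close>
    define \<eta> where "\<eta> = (2 * pi - m) / 2"
    have m2: "0 < m" "m < 2 * pi" using m(1) E(3) by auto
    have \<eta>: "\<eta> > 0" "\<eta> < 2 * pi" "\<And>t. t \<in> E \<Longrightarrow> t + \<eta> < 2 * pi"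
    proof -
      show "\<eta> > 0" "\<eta> < 2 * pi" using m2 by (auto simp: \<eta>_def)
      show "t + \<eta> < 2 * pi" if "t \<in> E" for t
        using m(2)[OF that] m2 by (simp add: \<eta>_def field_simps)
    qed
    define D where "D t = (\<Prod>y\<leftarrow>ys. sin ((y - t) / 2)) * sin ((t - (- \<eta>)) / 2) ^ (n - length ys)" for t
    have Dsemi: "semitrig n (\<lambda>t. of_real (D t))"
    proof -
      have s: "semitrig 1 (\<lambda>t. of_real (sin ((y - t) / 2)))" for y
        using semitrig_cmult[OF semitrig_sin[of y], of "-1"]
        by (simp add: minus_divide_left flip: of_real_minus sin_minus)
      have "complex_of_real (prod_list xs) = prod_list (map of_real xs)" for xs
        by (induction xs) auto
      then show ?thesis
        using semitrig_mult[OF semitrig_prod_list[of ys, OF s] semitrig_power[OF semitrig_sin, of "n - length ys" "-\<eta>"]] 2(1)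
        by (simp add: D_def o_def)
    qed
    have contD: "continuous_on S D" for S
      using semitrig_continuous[OF Dsemi, of S]
      by (auto simp: continuous_on_of_real_o_iff[unfolded o_def])
    have pos: "sin ((t - (- \<eta>)) / 2) ^ (n - length ys) > 0" if "t \<in> insert 0 E" for t
      using that \<eta> E(3) by (intro zero_less_power sin_half_pos) force+
    have D0: "D 0 > 0"
    proof -
      have "(\<Prod>y\<leftarrow>ys. sin ((y - 0) / 2)) > 0"
        using 2(2) by (intro prod_list_pos) (auto intro!: sin_gt_zero)
      then show ?thesis using pos[of 0] by (simp add: D_def)
    qed
    have DA: "D t * q t < 0" if "t \<in> E" "\<bar>q t\<bar> = 1" for t
    proof -
      have "t \<in> A \<or> t \<in> B" using that by (auto simp: A_def B_def)
      then show ?thesis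
        using 2(3,4) pos[of t] that by (auto simp: A_def B_def D_def mult_neg_pos)
    qed
    obtain C0 where C0: "\<And>t. t \<in> E \<Longrightarrow> \<bar>D t\<bar> \<le> C0"
      using compact_imp_bounded[OF compact_continuous_image[OF contD E(1)]]
      by (auto simp: bounded_iff)
    define C where "C = max C0 1"
    have C: "\<And>t. t \<in> E \<Longrightarrow> \<bar>D t\<bar> \<le> C" "C > 0" using C0 by (auto simp: C_def le_max_iff_disj)
    define E1 where "E1 = E \<inter> {t. D t * q t \<ge> 0}"
    have "compact E1"
      unfolding E1_def by (intro compact_Int_closed E closed_Collect_le continuous_intros contq contD)
    have "\<exists>d>0. \<forall>t\<in>E1. \<bar>q t\<bar> \<le> 1 - d"
    proof (cases "E1 = {}")
      case True then show ?thesis by (intro exI[of _ 1]) auto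
    next
      case False
      obtain x where x: "x \<in> E1" "\<And>t. t \<in> E1 \<Longrightarrow> \<bar>q t\<bar> \<le> \<bar>q x\<bar>"
        using continuous_attains_sup[OF \<open>compact E1\<close> False, of "\<lambda>t. \<bar>q t\<bar>"] contq
        by (auto intro: continuous_on_rabs)
      have "\<bar>q x\<bar> \<le> 1" "\<bar>q x\<bar> \<noteq> 1"
        using x(1) q(1) DA[of x] by (auto simp: E1_def admissible_def)
      then show ?thesis using x(2) by (intro exI[of _ "1 - \<bar>q x\<bar>"]) auto
    qed
    then obtain d where d: "d > 0" "\<And>t. t \<in> E1 \<Longrightarrow> \<bar>q t\<bar> \<le> 1 - d" by auto
    \<comment> \<open>The first bound respects the margin \<open>d\<close> on \<open>E1\<close>; the
      second keeps the perturbation below 1, so that pushing \<open>q\<close> towards 0 elsewhere on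
      \<open>E\<close> cannot overshoot the opposite level.\<close>
    define \<epsilon> where "\<epsilon> = min (d / C) (1 / C)"
    have \<epsilon>: "\<epsilon> > 0" "\<epsilon> * C \<le> d" "\<epsilon> * C \<le> 1"
      using d C by (auto simp: \<epsilon>_def min_def field_simps)
    have small: "\<bar>\<epsilon> * D t\<bar> \<le> \<epsilon> * C" if "t \<in> E" for t
      using C(1)[OF that] \<epsilon>(1) by (simp add: abs_mult)
    have "admissible n E (\<lambda>t. q t + \<epsilon> * D t)"
      unfolding admissible_def
    proof
      show "semitrig n (\<lambda>t. of_real (q t + \<epsilon> * D t))"
        using semitrig_add[OF _ semitrig_cmult[OF Dsemi, of "of_real \<epsilon>"]] q(1)
        by (simp add: admissible_def)
      show "\<forall>t\<in>E. \<bar>q t + \<epsilon> * D t\<bar> \<le> 1"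
      proof
        fix t assume t: "t \<in> E"
        show "\<bar>q t + \<epsilon> * D t\<bar> \<le> 1"
        proof (cases "t \<in> E1")
          case True
          then show ?thesis using d(2)[OF True] small[OF t] \<epsilon> by linarith
        next
          case False
          then have "D t * q t < 0" using t by (auto simp: E1_def)
          moreover have "\<bar>q t\<bar> \<le> 1" using q(1) t by (auto simp: admissible_def)
          moreover have "\<bar>\<epsilon> * D t\<bar> \<le> 1" using small[OF t] \<epsilon> by linarith
          ultimately show ?thesis
            using \<epsilon>(1) by (auto simp: mult_less_0_iff zero_less_mult_iff abs_le_iff not_less)
              (smt (verit) mult_pos_pos mult_pos_neg)+
        qed
      qed
    qed
    from q(2)[OF this] D0 \<epsilon>(1) show ?thesis
      by (simp add: mult_le_0_iff)
  qed
qed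

section \<open>Polynomials all of whose level points are real\<close>


text \<open>The quotient is the sum of z / (z - a) over the zeros a with multiplicity, and each term
  has real part at most 1/2 because |z| < 1 <= |a|.\<close>

lemma log_deriv_bound:
  assumes "\<And>a. cmod a < 1 \<Longrightarrow> poly W a \<noteq> 0" "cmod z < 1"
  shows "Re (z * poly (pderiv W) z / poly W z) \<le> real (degree W) / 2"
  using assms(1)
proof (induction "degree W" arbitrary: W)
  case 0
  then show ?case by (auto simp: pderiv_eq_0_iff[THEN iffD2])
next
  case (Suc d)
  have "\<not> constant (poly W)"
    using Suc.hyps(2) by (simp add: constant_degree)
  then obtain a where a: "poly W a = 0"
    using fundamental_theorem_of_algebra by blast
  then obtain V where V: "W = [:-a, 1:] * V"
    by (auto simp: poly_eq_0_iff_dvd dvd_def)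
  have nz: "poly V b \<noteq> 0" if "cmod b < 1" for b
    using Suc.prems[OF that] V by auto
  have "V \<noteq> 0" using nz[of 0] by auto
  then have deg: "degree W = Suc (degree V)"
    unfolding V by (subst degree_mult_eq) auto
  have a1: "cmod a \<ge> 1"
    using Suc.prems[of a] a by force
  then have za: "z \<noteq> a" using assms(2) by auto
  have "poly (pderiv W) z = (z - a) * poly (pderiv V) z + poly V z"
    unfolding V by (subst pderiv_mult) (simp add: pderiv_pCons left_diff_distrib)
  then have "z * poly (pderiv W) z / poly W z = z / (z - a) + z * poly (pderiv V) z / poly V z"
  proof -
    have "poly W z = (z - a) * poly V z" by (simp add: V left_diff_distrib)
    moreover have "u * ((u - b) * c + d) / ((u - b) * d) = u / (u - b) + u * c / d"
      if "u \<noteq> b" "d \<noteq> 0" for u b c d :: complex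
      using that by (simp add: field_simps)
    ultimately show ?thesis
      using \<open>poly (pderiv W) z = _\<close> za nz[OF assms(2)] by simp
  qed
  moreover have "Re (z / (z - a)) \<le> 1 / 2"
  proof -
    have "(cmod z)\<^sup>2 \<le> (cmod a)\<^sup>2"
      using a1 assms(2) by (intro power_mono) auto
    moreover have "(Re z - Re a)\<^sup>2 + (Im z - Im a)\<^sup>2 > 0"
      using za by (metis complex_eq_iff eq_iff_diff_eq_0 sum_power2_gt_zero_iff)
    ultimately show ?thesis
      by (simp add: Re_divide cmod_power2 divide_simps) (simp add: power2_eq_square algebra_simps)
  qed
  moreover have "Re (z * poly (pderiv V) z / poly V z) \<le> real (degree V) / 2"
    using Suc deg nz by simp
  ultimately show ?case by (simp add: deg field_simps)
qed

abbreviation upper_half :: "complex set" where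
  "upper_half \<equiv> {z. Im z > 0}"

lemma open_upper_half: "open upper_half"
  by (rule open_halfspace_Im_gt)

lemma convex_upper_half: "convex upper_half"
  by (rule convex_halfspace_Im_gt)

lemma Im_cos_sinh: "Im (cos z) = - sin (Re z) * sinh (Im z)"
  by (simp add: Im_cos sinh_field_def exp_minus field_simps)

lemma Re_cos_cosh: "Re (cos z) = cos (Re z) * cosh (Im z)"
  by (simp add: Re_cos cosh_field_def exp_minus field_simps)

lemma Re_sin_cosh: "Re (sin z) = sin (Re z) * cosh (Im z)"
  by (simp add: Re_sin cosh_field_def exp_minus field_simps)

lemma Im_sin_sinh: "Im (sin z) = cos (Re z) * sinh (Im z)"
  by (simp add: Im_sin sinh_field_def exp_minus field_simps)

locale alternating =
  fixes n :: nat and Q :: "complex poly" and q :: "real \<Rightarrow> real" and \<tau> :: "nat \<Rightarrow> real"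
  assumes n_pos: "n \<ge> 1" and degree_Q: "degree Q \<le> n"
    and q_eq: "\<And>t. complex_of_real (q t) = cis (- (real n * t / 2)) * poly Q (cis t)"
    and \<tau>_less: "\<And>i. i < n \<Longrightarrow> \<tau> i < \<tau> (Suc i)"
    and \<tau>_in: "\<And>i. i \<le> n \<Longrightarrow> \<tau> i \<in> {0<..<2 * pi}"
    and q_\<tau>: "\<And>i. i \<le> n \<Longrightarrow> q (\<tau> i) = (-1) ^ i"
begin

lemma q_continuous: "continuous_on S q"
proof -
  have "continuous_on S (\<lambda>t. complex_of_real (q t))"
    unfolding q_eq by (intro continuous_intros) auto
  then show ?thesis by (simp add: continuous_on_of_real_o_iff[unfolded o_def])
qed

text \<open>One solution between any two consecutive alternation points. The degree allows no more
  than n, so none is left over for the interior of the disc.\<close>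

lemma level_set:
  assumes "\<bar>y\<bar> < 1"
  obtains T where "T \<subseteq> {0<..<2 * pi}" "card T = n" "\<And>t. t \<in> T \<Longrightarrow> q t = y"
proof -
  have "\<exists>t. \<tau> i < t \<and> t < \<tau> (Suc i) \<and> q t = y" if "i < n" for i
  proof -
    have lt: "\<tau> i < \<tau> (Suc i)" using \<tau>_less that by auto
    have "q (\<tau> i) < y \<and> y < q (\<tau> (Suc i)) \<or> q (\<tau> (Suc i)) < y \<and> y < q (\<tau> i)"
      using assms q_\<tau>[of i] q_\<tau>[of "Suc i"] that by (cases "even i") auto
    then have "\<exists>t\<ge>\<tau> i. t \<le> \<tau> (Suc i) \<and> q t = y"
      using IVT'[of q "\<tau> i" y "\<tau> (Suc i)"] IVT2'[of q "\<tau> (Suc i)" y "\<tau> i"] lt q_continuous by force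
    moreover have "q (\<tau> i) \<noteq> y" "q (\<tau> (Suc i)) \<noteq> y"
      using assms q_\<tau>[of i] q_\<tau>[of "Suc i"] that by (auto simp: minus_one_power_iff)
    ultimately show ?thesis by (metis less_le)
  qed
  then obtain a where a: "\<And>i. i < n \<Longrightarrow> \<tau> i < a i \<and> a i < \<tau> (Suc i) \<and> q (a i) = y" by metis
  have mono: "\<tau> i \<le> \<tau> j" if "i \<le> j" "j \<le> n" for i j
    using that
  proof (induction j rule: dec_induct)
    case (step k)
    then show ?case using \<tau>_less[of k] by simp
  qed simp
  have lt: "a i < a j" if "i < j" "j < n" for i j
    using a[of i] a[of j] mono[of "Suc i" j] that by force
  have "inj_on a {..<n}"
    by (rule linorder_inj_onI) (use lt in force)+
  then show ?thesis
  proof (intro that[of "a ` {..<n}"])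
    show "a ` {..<n} \<subseteq> {0<..<2 * pi}"
    proof
      fix x assume "x \<in> a ` {..<n}"
      then obtain i where i: "i < n" "x = a i" by auto
      then show "x \<in> {0<..<2 * pi}"
        using a[of i] \<tau>_in[of i] \<tau>_in[of "Suc i"] by auto
    qed
    show "card (a ` {..<n}) = n" using \<open>inj_on a _\<close> by (simp add: card_image)
  qed (use a in auto)
qed

lemma Q_cis: "poly Q (cis t) = cis (real n * t / 2) * of_real (q t)"
  by (simp add: q_eq cis_mult flip: mult.assoc)

lemma Q_nz: "Q \<noteq> 0"
  using q_eq[of "\<tau> 0"] q_\<tau>[of 0] by auto

lemma Q_disc: assumes "cmod a < 1" shows "poly Q a \<noteq> 0"
proof
  assume *: "poly Q a = 0"
  obtain T where T: "T \<subseteq> {0<..<2 * pi}" "card T = n" "\<And>t. t \<in> T \<Longrightarrow> q t = 0"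
    using level_set[of 0] by auto
  have fin: "finite T" using T(2) n_pos card_ge_0_finite[of T] by simp
  have "insert a (cis ` T) \<subseteq> {x. poly Q x = 0}"
    using * T(3) by (auto simp: Q_cis)
  then have "card (insert a (cis ` T)) \<le> card {x. poly Q x = 0}"
    using poly_roots_finite[OF Q_nz] by (rule card_mono[rotated])
  also have "\<dots> \<le> n"
    using card_poly_roots_bound[OF Q_nz] degree_Q by linarith
  finally have "card (insert a (cis ` T)) \<le> n" .
  moreover have "a \<notin> cis ` T" using assms by auto
  moreover have "card (cis ` T) = n"
    using T(1,2) by (subst card_image) (auto intro!: inj_on_subset[OF cis_inj_on])
  ultimately show False using fin by simp
qed

text \<open>Squaring removes the factor exp(i n z / 2), which is not a function of exp(i z) for odd
  n. The available degree 2 n is used up on the circle by the level points of y and of -y. For y = 0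
  these coincide, and \<open>Q_disc\<close> is used instead.\<close>

lemma Q_square:
  assumes a: "cmod a < 1" and y: "\<bar>y\<bar> < 1"
  shows "poly Q a ^ 2 \<noteq> of_real (y\<^sup>2) * a ^ n"
proof
  assume *: "poly Q a ^ 2 = of_real (y\<^sup>2) * a ^ n"
  have "y \<noteq> 0" using * Q_disc[OF a] by auto
  obtain T where T: "T \<subseteq> {0<..<2 * pi}" "card T = n" "\<And>t. t \<in> T \<Longrightarrow> q t = y"
    using level_set[of y] y by auto
  obtain T' where T': "T' \<subseteq> {0<..<2 * pi}" "card T' = n" "\<And>t. t \<in> T' \<Longrightarrow> q t = - y"
    using level_set[of "-y"] y by auto
  have fin: "finite T" "finite T'"
    using T(2) T'(2) n_pos card_ge_0_finite[of T] card_ge_0_finite[of T'] by simp_all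
  have "T \<inter> T' = {}" using T(3) T'(3) \<open>y \<noteq> 0\<close> by force
  then have card: "card (T \<union> T') = 2 * n"
    using T T' fin by (simp add: card_Un_disjoint)
  define W where "W = Q * Q - monom (of_real (y\<^sup>2)) n"
  have Wcis: "poly W (cis t) = cis (real n * t) * of_real (q t ^ 2 - y\<^sup>2)" for t
  proof -
    have "poly Q (cis t) ^ 2 = cis (real n * t) * complex_of_real (q t) ^ 2"
      by (simp add: Q_cis power_mult_distrib Complex.DeMoivre)
    then show ?thesis
      by (simp add: W_def poly_monom Complex.DeMoivre right_diff_distrib flip: power2_eq_square)
  qed
  have "W \<noteq> 0"
  proof
    assume "W = 0"
    then have "of_real (q (\<tau> 0) ^ 2 - y\<^sup>2) = (0::complex)" using Wcis[of "\<tau> 0"] by simp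
    then have "q (\<tau> 0) ^ 2 - y\<^sup>2 = 0" by (simp only: of_real_eq_0_iff)
    then have "y\<^sup>2 = 1" using q_\<tau>[of 0] by simp
    then show False using y by (auto simp: power2_eq_1_iff)
  qed
  have degW: "degree W \<le> 2 * n"
    unfolding W_def using degree_Q degree_mult_le[of Q Q] degree_monom_le[of "complex_of_real (y\<^sup>2)" n]
    by (intro degree_diff_le) linarith+
  have "insert a (cis ` (T \<union> T')) \<subseteq> {x. poly W x = 0}"
  proof -
    have "poly W a = 0" using * by (simp add: W_def poly_monom power2_eq_square)
    moreover have "poly W (cis t) = 0" if "t \<in> T \<union> T'" for t
      using that T(3) T'(3) by (auto simp: Wcis)
    ultimately show ?thesis by auto
  qed
  then have "card (insert a (cis ` (T \<union> T'))) \<le> card {x. poly W x = 0}"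
    using poly_roots_finite[OF \<open>W \<noteq> 0\<close>] by (rule card_mono[rotated])
  also have "\<dots> \<le> 2 * n"
    using card_poly_roots_bound[OF \<open>W \<noteq> 0\<close>] degW by linarith
  finally have "card (insert a (cis ` (T \<union> T'))) \<le> 2 * n" .
  moreover have "a \<notin> cis ` (T \<union> T')" using a by auto
  moreover have "card (cis ` (T \<union> T')) = 2 * n"
    using card T(1) T'(1) by (subst card_image) (auto intro!: inj_on_subset[OF cis_inj_on])
  ultimately show False using fin by simp
qed

text \<open>The entire extension of \<open>q\<close>. The map z -> exp(i z) takes the upper half
  plane to the punctured unit disc, where the zero counts above apply.\<close>

definition f :: "complex \<Rightarrow> complex" where
  "f z = exp (- (\<i> * of_nat n * z / 2)) * poly Q (exp (\<i> * z))"

lemma Q_exp: "poly Q (exp (\<i> * z)) = exp (\<i> * of_nat n * z / 2) * f z"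
  by (simp add: f_def flip: mult.assoc exp_add)

lemma f_of_real: "f (of_real t) = of_real (q t)"
  by (simp add: f_def q_eq cis_conv_exp mult_ac)

lemma f_holomorphic: "f holomorphic_on S"
  unfolding f_def by (intro holomorphic_intros) auto

lemma f_continuous: "continuous_on S f"
  by (rule holomorphic_on_imp_continuous_on[OF f_holomorphic])

lemma f_not_constant: "\<not> f constant_on UNIV"
proof
  assume "f constant_on UNIV"
  then have "f (of_real (\<tau> 0)) = f (of_real (\<tau> 1))" by (auto simp: constant_on_def)
  then show False using q_\<tau>[of 0] q_\<tau>[of 1] n_pos by (simp add: f_of_real)
qed

lemma f_avoids_open:
  assumes "Im z > 0" "\<bar>y\<bar> < 1" shows "f z \<noteq> of_real y"
proof
  assume "f z = of_real y"
  then have "f z ^ 2 = of_real (y\<^sup>2)" by simp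
  moreover have "poly Q (exp (\<i> * z)) ^ 2 = f z ^ 2 * exp (\<i> * z) ^ n"
  proof -
    have "exp (\<i> * of_nat n * z / 2) ^ 2 = exp (\<i> * z) ^ n"
      by (simp add: mult_ac flip: exp_of_nat_mult)
    then show ?thesis by (simp add: Q_exp power_mult_distrib)
  qed
  moreover have "cmod (exp (\<i> * z)) < 1" using assms by simp
  ultimately show False using Q_square[OF _ assms(2)] by auto
qed

text \<open>The end points 1 and -1 follow from openness of the image: attaining one of them would
  mean attaining nearby values in (-1, 1).\<close>

lemma f_avoids:
  assumes "Im z > 0" "\<bar>y\<bar> \<le> 1" shows "f z \<noteq> of_real y"
proof
  assume fz: "f z = of_real y"
  then have "y \<in> {-1, 1}" using f_avoids_open[OF assms(1), of y] assms(2) by force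
  have "open (f ` upper_half)"
    by (rule open_mapping_thm[OF f_holomorphic open_UNIV connected_UNIV open_upper_half])
      (auto simp: f_not_constant)
  moreover have "of_real y \<in> f ` upper_half" using fz assms(1) by (force simp: image_iff)
  ultimately obtain e where e: "e > 0" "ball (of_real y) e \<subseteq> f ` upper_half"
    by (meson openE)
  define y' where "y' = y * (1 - min e 1 / 2)"
  have "dist (of_real y) (complex_of_real y') < e"
    using \<open>y \<in> {-1, 1}\<close> e(1)
    by (simp only: dist_of_real) (auto simp: y'_def dist_real_def min_def)
  moreover have "\<bar>y'\<bar> < 1"
    using \<open>y \<in> {-1, 1}\<close> e(1) by (auto simp: y'_def min_def)
  moreover have "of_real y' \<notin> f ` upper_half" 
  proof
    assume "of_real y' \<in> f ` upper_half"
    then obtain x where "Im x > 0" "f x = of_real y'" by auto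
    then show False using f_avoids_open[OF _ \<open>\<bar>y'\<bar> < 1\<close>] by blast
  qed
  ultimately show False using e(2) by (meson mem_ball subsetD)
qed

text \<open>\<open>f\<close> omits 1 and -1 on a contractible domain, so it has a holomorphic
  arccosine. As \<open>f\<close> omits all of [-1, 1], the imaginary part of that branch never
  vanishes, hence has one sign by connectedness; negating the branch makes it positive.\<close>

lemma ex_theta:
  obtains \<theta> where "\<theta> holomorphic_on upper_half" "\<And>z. Im z > 0 \<Longrightarrow> f z = cos (\<theta> z)"
    "\<And>z. Im z > 0 \<Longrightarrow> Im (\<theta> z) > 0"
proof -
  have "contractible upper_half" by (rule convex_imp_contractible[OF convex_upper_half])
  then obtain g where g: "g holomorphic_on upper_half" "\<And>z. z \<in> upper_half \<Longrightarrow> f z = cos (g z)"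
    using contractible_imp_holomorphic_arccos[OF f_holomorphic, of upper_half] f_avoids[of _ 1] f_avoids[of _ "-1"]
    by (metis abs_1 abs_minus_cancel dual_order.refl mem_Collect_eq of_real_1 of_real_minus)
  have nz: "Im (g z) \<noteq> 0" if "Im z > 0" for z
  proof
    assume "Im (g z) = 0"
    then have "g z = of_real (Re (g z))" by (simp add: complex_eq_iff)
    then have "f z = of_real (cos (Re (g z)))" using g(2)[of z] that by (metis cos_of_real mem_Collect_eq)
    then show False using f_avoids[OF that, of "cos (Re (g z))"] by auto
  qed
  have "connected ((\<lambda>z. Im (g z)) ` upper_half)"
    by (intro connected_continuous_image continuous_intros holomorphic_on_imp_continuous_on g
      convex_connected convex_upper_half)
  then have *: "(\<forall>z\<in>upper_half. Im (g z) > 0) \<or> (\<forall>z\<in>upper_half. Im (g z) < 0)"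
  proof -
    have "False" if "z \<in> upper_half" "w \<in> upper_half" "Im (g z) < 0" "Im (g w) > 0" for z w
      using connectedD_interval[OF \<open>connected _\<close>, of "Im (g z)" "Im (g w)" 0] that nz by force
    then show ?thesis using nz by (metis linorder_cases mem_Collect_eq)
  qed
  then show ?thesis
  proof
    assume "\<forall>z\<in>upper_half. Im (g z) > 0"
    then show ?thesis using g that by auto
  next
    assume "\<forall>z\<in>upper_half. Im (g z) < 0"
    then show ?thesis using g by (intro that[of "\<lambda>z. - g z"]) (auto intro: holomorphic_intros)
  qed
qed

lemma f_shift: "f (z + 2 * complex_of_real pi) = (-1) ^ n * f z"
proof -
  have "exp (\<i> * (z + 2 * complex_of_real pi)) = exp (\<i> * z)"
    by (simp add: exp_eq distrib_left)
  moreover have "exp (- (\<i> * of_nat n * (z + 2 * complex_of_real pi) / 2)) =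
      exp (- (\<i> * of_nat n * z / 2)) * exp (- (\<i> * pi)) ^ n"
    by (simp add: algebra_simps add_divide_distrib flip: exp_of_nat_mult exp_add)
  moreover have "exp (- (\<i> * complex_of_real pi)) = -1" by (simp add: exp_minus)
  ultimately show ?thesis by (simp add: f_def)
qed

text \<open>Homogenized Chebyshev polynomials: if \<open>f z = cos w\<close> then \<open>cheb_lift k\<close> represents \<open>cos (k w)\<close>.\<close>

fun cheb_lift :: "nat \<Rightarrow> complex poly" where
  "cheb_lift 0 = 1"
| "cheb_lift (Suc 0) = Q"
| "cheb_lift (Suc (Suc k)) = 2 * Q * cheb_lift (Suc k) - monom 1 n * cheb_lift k"

lemma degree_cheb_lift: "degree (cheb_lift k) \<le> n * k"
proof (induction k rule: cheb_lift.induct)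
  case (3 k)
  have "degree (2 * Q * cheb_lift (Suc k)) \<le> n * Suc (Suc k)"
    using 3(1) degree_Q degree_mult_le[of Q "cheb_lift (Suc k)"]
      degree_smult_le[of 2 "Q * cheb_lift (Suc k)"]
    by (simp add: numeral_mult_conv_smult)
  moreover have "degree (monom 1 n * cheb_lift k) \<le> n * Suc (Suc k)"
    using 3(2) degree_monom_le[of "1::complex" n] degree_mult_le[of "monom 1 n" "cheb_lift k"]
    by simp
  ultimately show ?case by (simp add: degree_diff_le)
qed (use degree_Q in auto)

text \<open>The centre of the disc is not of the form exp(i z), so it is out of reach of
  \<open>cheb_lift_cos\<close> and is computed from the recursion, whose monomial vanishes at
  0.\<close>

lemma cheb_lift_0: "poly (cheb_lift (Suc k)) 0 \<noteq> 0"
proof -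
  have "poly (cheb_lift (Suc k)) 0 = 2 ^ k * poly Q 0 ^ Suc k"
    using n_pos by (induction k) (simp_all add: poly_monom)
  then show ?thesis using Q_disc[of 0] by simp
qed

lemma cheb_lift_cos:
  assumes "f z = cos w"
  shows "poly (cheb_lift k) (exp (\<i> * z)) = exp (\<i> * of_nat n * of_nat k * z / 2) * cos (of_nat k * w)"
proof (induction k rule: cheb_lift.induct)
  case 2
  have "poly Q (exp (\<i> * z)) = exp (\<i> * of_nat n * z / 2) * f z"
    by (simp add: f_def flip: mult.assoc exp_add)
  then show ?case using assms by simp
next
  case (3 k)
  have Q: "poly Q (exp (\<i> * z)) = exp (\<i> * of_nat n * z / 2) * cos w"
    unfolding assms[symmetric] by (simp add: f_def flip: mult.assoc exp_add)
  have c: "cos (of_nat (Suc (Suc k)) * w) = 2 * cos w * cos (of_nat (Suc k) * w) - cos (of_nat k * w)"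
  proof -
    have "of_nat (Suc (Suc k)) * w = of_nat (Suc k) * w + w" "of_nat k * w = of_nat (Suc k) * w - w"
      by (simp_all add: algebra_simps)
    then show ?thesis by (simp only: cos_add cos_diff) (simp add: algebra_simps)
  qed
  define A where "A = exp (\<i> * of_nat n * of_nat k * z / 2)"
  define B where "B = exp (\<i> * of_nat n * z / 2)"
  have e: "exp (\<i> * of_nat n * of_nat (Suc k) * z / 2) = A * B"
    "exp (\<i> * of_nat n * of_nat (Suc (Suc k)) * z / 2) = A * B * B" "exp (\<i> * z) ^ n = B * B"
    by (simp_all add: A_def B_def algebra_simps add_divide_distrib flip: exp_add exp_of_nat_mult)
  show ?case
    unfolding cheb_lift.simps c e poly_diff poly_mult 3 Q poly_monom
    by (simp add: e flip: A_def B_def) (simp add: algebra_simps)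
qed auto

end

section \<open>The conformal map\<close>


lemma cos_nonzero_Im_pos: assumes "Im w > 0" shows "cos w \<noteq> 0"
proof
  assume "cos w = 0"
  then have "Re (cos w) = 0" "Im (cos w) = 0" by simp_all
  then have "cos (Re w) = 0" "sin (Re w) = 0" using assms by (auto simp: Re_cos_cosh Im_cos_sinh)
  then show False using sin_cos_squared_add[of "Re w"] by simp
qed

lemma sin_nonzero_Im_pos: assumes "Im w > 0" shows "sin w \<noteq> 0"
proof
  assume "sin w = 0"
  then have "Re (sin w) = 0" "Im (sin w) = 0" by simp_all
  then have "cos (Re w) = 0" "sin (Re w) = 0" using assms by (auto simp: Re_sin_cosh Im_sin_sinh)
  then show False using sin_cos_squared_add[of "Re w"] by simp
qed

lemma cmod_cos_squared: "(cmod (cos w))\<^sup>2 = (cos (Re w))\<^sup>2 + (sinh (Im w))\<^sup>2"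
proof -
  have "(cmod (cos w))\<^sup>2 = (cos (Re w))\<^sup>2 * (cosh (Im w))\<^sup>2 + (sin (Re w))\<^sup>2 * (sinh (Im w))\<^sup>2"
    by (simp add: cmod_power2 Re_cos_cosh Im_cos_sinh power_mult_distrib)
  then show ?thesis
    by (simp add: cosh_square_eq sin_squared_eq algebra_simps)
qed

lemma cmod_cos_le: assumes "Im w > 0" shows "cmod (cos w) \<le> exp (Im w)"
proof -
  have "(cmod (cos w))\<^sup>2 \<le> (cosh (Im w))\<^sup>2"
    unfolding cmod_cos_squared cosh_square_eq using abs_square_le_1[of "cos (Re w)"] by simp
  then have "cmod (cos w) \<le> cosh (Im w)"
    by (rule power2_le_imp_le) (simp add: less_imp_le)
  also have "\<dots> \<le> exp (Im w)"
    using assms by (simp add: cosh_field_def)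
  finally show ?thesis .
qed

text \<open>From sin w - i cos w = -i exp(i w). The crude rate 2 / Im w is enough for both limits
  below, along multiples of \<theta> and at i infinity.\<close>

lemma tan_near_i:
  assumes "Im w > 0" shows "cmod (tan w - \<i>) \<le> 2 / Im w"
proof -
  define b where "b = Im w"
  have b: "b > 0" using assms by (simp add: b_def)
  have "sin w - \<i> * cos w = - \<i> * exp (\<i> * w)"
    by (simp add: exp_Euler algebra_simps)
  moreover have "tan w - \<i> = (sin w - \<i> * cos w) / cos w"
    using cos_nonzero_Im_pos[OF assms] by (simp add: tan_def diff_divide_distrib)
  ultimately have "tan w - \<i> = - \<i> * exp (\<i> * w) / cos w"
    by simp
  then have eq: "cmod (tan w - \<i>) = exp (- b) / cmod (cos w)"
    by (simp add: norm_divide norm_mult b_def)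
  have "b / 2 \<le> sinh b"
  proof -
    have "exp b \<ge> 1 + b" by (rule exp_ge_add_one_self)
    moreover have "exp (- b) \<le> 1" using b by simp
    ultimately have "b \<le> exp b - exp (- b)" by linarith
    then show ?thesis by (simp add: sinh_field_def)
  qed
  also have "sinh b \<le> cmod (cos w)"
    by (rule power2_le_imp_le) (simp_all add: cmod_cos_squared b_def)
  finally have "b / 2 \<le> cmod (cos w)" .
  moreover have "exp (- b) \<le> 1" using b by simp
  ultimately have "exp (- b) / cmod (cos w) \<le> 1 / (b / 2)"
    using b by (intro frac_le) auto
  then show ?thesis by (simp add: eq b_def)
qed

locale comb = alternating +
  fixes \<theta> :: "complex \<Rightarrow> complex"
  assumes \<theta>_holomorphic: "\<theta> holomorphic_on upper_half"
    and f_cos: "\<And>z. Im z > 0 \<Longrightarrow> f z = cos (\<theta> z)"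
    and Im_\<theta>: "\<And>z. Im z > 0 \<Longrightarrow> Im (\<theta> z) > 0"
begin

lemma \<theta>_deriv: "Im z > 0 \<Longrightarrow> (\<theta> has_field_derivative deriv \<theta> z) (at z within S)"
  using holomorphic_derivI[OF \<theta>_holomorphic open_upper_half, of z S] by simp

text \<open>Away from 0, a zero would be a zero of cos at (k + 1) \<theta>(z), whose imaginary part
  is positive.\<close>

lemma cheb_lift_disc:
  assumes "cmod a < 1" shows "poly (cheb_lift (Suc k)) a \<noteq> 0"
proof (cases "a = 0")
  case True
  then show ?thesis using cheb_lift_0 by simp
next
  case False
  define z where "z = - \<i> * Ln a"
  have "Im z > 0" using False assms by (simp add: z_def)
  moreover have "exp (\<i> * z) = a" using False by (simp add: z_def)
  moreover have "cos (of_nat (Suc k) * \<theta> z) \<noteq> 0"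
    by (rule cos_nonzero_Im_pos) (simp add: Im_\<theta>[OF \<open>Im z > 0\<close>] del: of_nat_Suc)
  ultimately show ?thesis
    using cheb_lift_cos[OF f_cos, of z "Suc k"] by (simp del: of_nat_Suc)
qed

text \<open>Minus the logarithmic derivative of cos((k + 1) \<theta>), computed once by the chain
  rule and once from the factorization in \<open>cheb_lift_cos\<close>.\<close>

lemma log_deriv_cos:
  assumes "Im z > 0"
  shows "of_nat (Suc k) * (deriv \<theta> z * tan (of_nat (Suc k) * \<theta> z)) =
    - \<i> * (exp (\<i> * z) * poly (pderiv (cheb_lift (Suc k))) (exp (\<i> * z)) / poly (cheb_lift (Suc k)) (exp (\<i> * z))
      - of_nat n * of_nat (Suc k) / 2)"
proof -
  define N :: complex where "N = of_nat (Suc k)"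
  define W where "W = cheb_lift (Suc k)"
  define E where "E z = exp (- (\<i> * of_nat n * N * z / 2))" for z
  have eq: "cos (N * \<theta> w) = E w * poly W (exp (\<i> * w))" if "Im w > 0" for w
    using cheb_lift_cos[OF f_cos[OF that], of "Suc k"]
    by (simp add: E_def W_def N_def exp_minus del: of_nat_Suc)
  have d1: "((\<lambda>w. cos (N * \<theta> w)) has_field_derivative - sin (N * \<theta> z) * (N * deriv \<theta> z)) (at z)"
    by (auto intro!: derivative_eq_intros \<theta>_deriv assms)
  have "((\<lambda>w. E w * poly W (exp (\<i> * w))) has_field_derivative
      E z * (- (\<i> * of_nat n * N / 2)) * poly W (exp (\<i> * z))
        + E z * (poly (pderiv W) (exp (\<i> * z)) * (exp (\<i> * z) * \<i>))) (at z)"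
    unfolding E_def
    by (auto intro!: derivative_eq_intros DERIV_chain2[OF poly_DERIV] simp: field_simps)
  then have "((\<lambda>w. cos (N * \<theta> w)) has_field_derivative
      E z * (- (\<i> * of_nat n * N / 2)) * poly W (exp (\<i> * z))
        + E z * (poly (pderiv W) (exp (\<i> * z)) * (exp (\<i> * z) * \<i>))) (at z)"
    by (rule has_field_derivative_transform_within_open[OF _ open_upper_half])
      (use assms eq in auto)
  note D = DERIV_unique[OF d1 this]
  have "N * deriv \<theta> z * sin (N * \<theta> z) = - (- sin (N * \<theta> z) * (N * deriv \<theta> z))"
    by simp
  also have "\<dots> =
      - \<i> * (E z * (exp (\<i> * z) * poly (pderiv W) (exp (\<i> * z)) - of_nat n * N / 2 * poly W (exp (\<i> * z))))"
    unfolding D by (simp add: algebra_simps)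
  finally have Nd: "N * deriv \<theta> z * sin (N * \<theta> z) =
      - \<i> * (E z * (exp (\<i> * z) * poly (pderiv W) (exp (\<i> * z)) - of_nat n * N / 2 * poly W (exp (\<i> * z))))" .
  have W: "poly W (exp (\<i> * z)) \<noteq> 0"
    unfolding W_def by (rule cheb_lift_disc) (use assms in simp)
  have E: "E z \<noteq> 0" by (simp add: E_def)
  have cancel: "- \<i> * (E z * (b - c * d)) / (E z * d) = - \<i> * (b / d - c)" if "d \<noteq> 0" for b c d
    using that E by (simp add: field_simps)
  have "N * deriv \<theta> z * sin (N * \<theta> z) / cos (N * \<theta> z) =
      - \<i> * (exp (\<i> * z) * poly (pderiv W) (exp (\<i> * z)) / poly W (exp (\<i> * z)) - of_nat n * N / 2)"
    unfolding eq[OF assms] Nd by (rule cancel[OF W])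
  then show ?thesis
    by (simp add: N_def W_def tan_def mult.assoc del: of_nat_Suc cheb_lift.simps)
qed

text \<open>All zeros of \<open>cos (k \<theta>)\<close> being real, its logarithmic derivative \<open>- k \<theta>' tan (k \<theta>)\<close> has
  nonpositive imaginary part; now let \<open>k\<close> tend to infinity, where \<open>tan (k \<theta>)\<close> tends to \<open>\<i>\<close>.\<close>

lemma Re_deriv_\<theta>_nonneg:
  assumes "Im z > 0" shows "Re (deriv \<theta> z) \<ge> 0"
proof -
  have pos: "Im (deriv \<theta> z * tan (of_nat (Suc k) * \<theta> z)) \<ge> 0" for k
  proof -
    have "Re (exp (\<i> * z) * poly (pderiv (cheb_lift (Suc k))) (exp (\<i> * z)) / poly (cheb_lift (Suc k)) (exp (\<i> * z)))
        \<le> real (degree (cheb_lift (Suc k))) / 2"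
      by (rule log_deriv_bound[OF cheb_lift_disc]) (use assms in auto)
    also have "\<dots> \<le> real n * real (Suc k) / 2"
      using degree_cheb_lift[of "Suc k"] by (simp flip: of_nat_mult del: of_nat_Suc)
    finally have "Im (of_nat (Suc k) * (deriv \<theta> z * tan (of_nat (Suc k) * \<theta> z))) \<ge> 0"
      unfolding log_deriv_cos[OF assms] by (simp del: of_nat_Suc cheb_lift.simps)
    moreover have "Im (of_nat (Suc k) * w) = real (Suc k) * Im w" for w
      by (simp del: of_nat_Suc)
    ultimately have "0 \<le> real (Suc k) * Im (deriv \<theta> z * tan (of_nat (Suc k) * \<theta> z))"
      by (simp only:)
    then show ?thesis by (simp add: zero_le_mult_iff del: of_nat_Suc)
  qed
  have lim0: "(\<lambda>k. 2 / Im (\<theta> z) * inverse (real (Suc k))) \<longlonglongrightarrow> 2 / Im (\<theta> z) * 0"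
    by (intro tendsto_mult tendsto_const LIMSEQ_inverse_real_of_nat)
  have "(\<lambda>k. tan (of_nat (Suc k) * \<theta> z) - \<i>) \<longlonglongrightarrow> 0"
  proof (rule Lim_null_comparison[OF always_eventually[OF allI]])
    show "cmod (tan (of_nat (Suc k) * \<theta> z) - \<i>) \<le> 2 / Im (\<theta> z) * inverse (real (Suc k))" for k
    proof -
      have "Im (of_nat (Suc k) * \<theta> z) = real (Suc k) * Im (\<theta> z)" by (simp del: of_nat_Suc)
      then show ?thesis
        using tan_near_i[of "of_nat (Suc k) * \<theta> z"] Im_\<theta>[OF assms]
        by (simp add: field_simps del: of_nat_Suc)
    qed
    show "(\<lambda>k. 2 / Im (\<theta> z) * inverse (real (Suc k))) \<longlonglongrightarrow> 0" using lim0 by simp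
  qed
  then have "(\<lambda>k. tan (of_nat (Suc k) * \<theta> z)) \<longlonglongrightarrow> \<i>"
    by (simp add: LIM_zero_iff del: of_nat_Suc)
  then have "(\<lambda>k. Im (deriv \<theta> z * tan (of_nat (Suc k) * \<theta> z))) \<longlonglongrightarrow> Im (deriv \<theta> z * \<i>)"
    by (intro tendsto_intros)
  then have "Im (deriv \<theta> z * \<i>) \<ge> 0"
    by (rule LIMSEQ_le_const) (use pos in blast)
  then show ?thesis by simp
qed

section \<open>Behaviour of \<theta> at i infinity, and injectivity\<close>

abbreviation to_i_infinity :: "complex filter" where
  "to_i_infinity \<equiv> filtercomap Im at_top"

lemma Im_at_top: "filterlim Im at_top to_i_infinity"
  by (rule filterlim_filtercomap)

lemma eventually_Im_gt: "eventually (\<lambda>z. Im z > y) to_i_infinity"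
  using Im_at_top by (rule filterlim_at_top_dense[THEN iffD1, rule_format])

lemma exp_to_0: "((\<lambda>z. exp (\<i> * z)) \<longlongrightarrow> 0) to_i_infinity"
proof (rule tendsto_norm_zero_cancel)
  have "((\<lambda>z. exp (- Im z)) \<longlongrightarrow> 0) to_i_infinity"
    by (intro filterlim_compose[OF exp_at_bot] filterlim_compose[OF filterlim_uminus_at_bot_at_top] Im_at_top)
  then show "((\<lambda>z. cmod (exp (\<i> * z))) \<longlongrightarrow> 0) to_i_infinity" by simp
qed

lemma poly_exp_tendsto: "((\<lambda>z. poly p (exp (\<i> * z))) \<longlongrightarrow> poly p 0) to_i_infinity"
  by (rule tendsto_compose[OF _ exp_to_0]) (simp add: isCont_def[symmetric])

text \<open>|f| grows like exp(n Im z / 2) because Q(0) is nonzero, while |cos w| is at most exp(Im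
  w).\<close>

lemma Im_\<theta>_at_top: "filterlim (\<lambda>z. Im (\<theta> z)) at_top to_i_infinity"
proof (rule filterlim_at_top_mono)
  show "filterlim (\<lambda>z. ln (cmod (poly Q (exp (\<i> * z)))) + real n / 2 * Im z) at_top to_i_infinity"
  proof (rule filterlim_tendsto_add_at_top)
    show "((\<lambda>z. ln (cmod (poly Q (exp (\<i> * z))))) \<longlongrightarrow> ln (cmod (poly Q 0))) to_i_infinity"
      using Q_disc[of 0] by (intro tendsto_ln tendsto_norm poly_exp_tendsto) auto
    show "filterlim (\<lambda>z. real n / 2 * Im z) at_top to_i_infinity"
      using n_pos by (intro filterlim_tendsto_pos_mult_at_top[OF tendsto_const] Im_at_top) auto
  qed
  show "eventually (\<lambda>z. ln (cmod (poly Q (exp (\<i> * z)))) + real n / 2 * Im z \<le> Im (\<theta> z)) to_i_infinity"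
    using eventually_Im_gt[of 0]
  proof eventually_elim
    case (elim z)
    have nz: "cmod (poly Q (exp (\<i> * z))) > 0" using Q_disc[of "exp (\<i> * z)"] elim by simp
    have "cmod (f z) = exp (real n / 2 * Im z) * cmod (poly Q (exp (\<i> * z)))"
      by (simp add: f_def norm_mult)
    then have "ln (cmod (f z)) = ln (cmod (poly Q (exp (\<i> * z)))) + real n / 2 * Im z"
      using nz by (simp add: ln_mult)
    moreover have "cmod (f z) \<le> exp (Im (\<theta> z))" "cmod (f z) > 0"
      using cmod_cos_le[OF Im_\<theta>[OF elim]] f_cos[OF elim] cos_nonzero_Im_pos[OF Im_\<theta>[OF elim]] by auto
    then have "ln (cmod (f z)) \<le> Im (\<theta> z)"
      by (metis ln_exp ln_le_cancel_iff exp_gt_zero)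
    ultimately show ?case by simp
  qed
qed

text \<open>The case k = 0 of \<open>log_deriv_cos\<close>, divided by tan \<theta>, which tends to
  i.\<close>

lemma deriv_\<theta>_tendsto: "(deriv \<theta> \<longlongrightarrow> of_nat n / 2) to_i_infinity"
proof -
  have "((\<lambda>z. tan (\<theta> z) - \<i>) \<longlongrightarrow> 0) to_i_infinity"
  proof (rule Lim_null_comparison)
    show "eventually (\<lambda>z. cmod (tan (\<theta> z) - \<i>) \<le> 2 / Im (\<theta> z)) to_i_infinity"
      using eventually_Im_gt[of 0] by eventually_elim (auto intro: tan_near_i Im_\<theta>)
    show "((\<lambda>z. 2 / Im (\<theta> z)) \<longlongrightarrow> 0) to_i_infinity"
      by (rule real_tendsto_divide_at_top[OF tendsto_const Im_\<theta>_at_top])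
  qed
  then have tan: "((\<lambda>z. tan (\<theta> z)) \<longlongrightarrow> \<i>) to_i_infinity"
    by (simp add: LIM_zero_iff)
  have "((\<lambda>z. - \<i> * (exp (\<i> * z) * poly (pderiv Q) (exp (\<i> * z)) / poly Q (exp (\<i> * z)) - of_nat n / 2) / tan (\<theta> z))
      \<longlongrightarrow> - \<i> * (0 * poly (pderiv Q) 0 / poly Q 0 - of_nat n / 2) / \<i>) to_i_infinity"
    by (intro tendsto_intros tan exp_to_0 poly_exp_tendsto) (use Q_disc[of 0] in auto)
  then have "((\<lambda>z. - \<i> * (exp (\<i> * z) * poly (pderiv Q) (exp (\<i> * z)) / poly Q (exp (\<i> * z)) - of_nat n / 2) / tan (\<theta> z))
      \<longlongrightarrow> of_nat n / 2) to_i_infinity"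
    by simp
  then show ?thesis
  proof (rule Lim_transform_eventually)
    show "eventually (\<lambda>z. - \<i> * (exp (\<i> * z) * poly (pderiv Q) (exp (\<i> * z)) / poly Q (exp (\<i> * z)) - of_nat n / 2)
        / tan (\<theta> z) = deriv \<theta> z) to_i_infinity"
      using eventually_Im_gt[of 0]
    proof eventually_elim
      case (elim z)
      have "tan (\<theta> z) \<noteq> 0"
        using sin_nonzero_Im_pos[OF Im_\<theta>[OF elim]] cos_nonzero_Im_pos[OF Im_\<theta>[OF elim]]
        by (simp add: tan_def)
      then show ?case using log_deriv_cos[OF elim, of 0] by (simp add: field_simps)
    qed
  qed
qed

text \<open>The sign rule for \<open>f\<close> fixes the increment up to a multiple of 2 pi; the
  reflected solution of the cosine equation is excluded by Im \<theta> > 0. High up, \<theta>' is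
  within 1/2 of n/2, so the increment is within pi of n pi and no choice remains. Analytic
  continuation carries this down.\<close>

lemma \<theta>_shift:
  assumes "Im z > 0" shows "\<theta> (z + 2 * complex_of_real pi) = \<theta> z + of_nat n * of_real pi"
proof -
  define D where "D w = \<theta> (w + 2 * complex_of_real pi) - \<theta> w - of_nat n * of_real pi" for w
  have dich: "\<exists>k\<in>\<int>. D w = of_real (2 * k * pi)" if w: "Im w > 0" for w
  proof -
    have "cos (\<theta> (w + 2 * complex_of_real pi)) = (-1) ^ n * cos (\<theta> w)"
      using f_cos[of "w + 2 * complex_of_real pi"] f_cos[of w] f_shift[of w] w by simp
    also have "\<dots> = cos (\<theta> w + of_nat n * of_real pi)"
    proof -
      have "sin (of_nat n * complex_of_real pi) = 0" "cos (of_nat n * complex_of_real pi) = (-1) ^ n"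
        using sin_npi[of n] cos_npi[of n]
        by (metis sin_of_real of_real_mult of_real_of_nat_eq of_real_0,
            metis cos_of_real of_real_mult of_real_of_nat_eq of_real_power of_real_1 of_real_minus)
      then show ?thesis by (simp add: cos_add)
    qed
    finally obtain k where k: "k \<in> \<int>"
      "\<theta> (w + 2 * complex_of_real pi) = \<theta> w + of_nat n * of_real pi + of_real (2 * k * pi) \<or>
       \<theta> (w + 2 * complex_of_real pi) = - (\<theta> w + of_nat n * of_real pi) + of_real (2 * k * pi)"
      unfolding complex_cos_eq by blast
    have "Im (\<theta> (w + 2 * complex_of_real pi)) > 0" "Im (\<theta> w) > 0"
      using w by (auto intro: Im_\<theta>)
    then have "\<theta> (w + 2 * complex_of_real pi) \<noteq> - (\<theta> w + of_nat n * of_real pi) + of_real (2 * k * pi)"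
      by (auto simp: complex_eq_iff)
    then show ?thesis using k by (auto simp: D_def intro!: bexI[of _ k])
  qed
  have "eventually (\<lambda>w. dist (deriv \<theta> w) (of_nat n / 2) < 1/2) to_i_infinity"
    using deriv_\<theta>_tendsto by (rule tendstoD) simp
  then obtain Y0 where Y0: "\<And>w. Im w \<ge> Y0 \<Longrightarrow> dist (deriv \<theta> w) (of_nat n / 2) < 1/2"
    by (auto simp: eventually_filtercomap eventually_at_top_linorder)
  define Y where "Y = max Y0 0"
  define S where "S = {w. Im w > Y}"
  have S: "S \<subseteq> upper_half" "convex S" "open S"
    unfolding S_def
    using convex_halfspace_Im_gt[of Y] open_halfspace_Im_gt[of Y] by (auto simp: Y_def)
  have D0: "D w = 0" if "w \<in> S" for w
  proof -
    have wp: "Im w > 0" "w + 2 * complex_of_real pi \<in> S" using that S(1) by (auto simp: S_def)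
    have "norm ((\<theta> (w + 2 * complex_of_real pi) - of_nat n / 2 * (w + 2 * complex_of_real pi)) - (\<theta> w - of_nat n / 2 * w))
        \<le> 1/2 * norm (w + 2 * complex_of_real pi - w)"
    proof (rule field_differentiable_bound[OF S(2), of "\<lambda>w. \<theta> w - of_nat n / 2 * w" "\<lambda>w. deriv \<theta> w - of_nat n / 2"])
      show "((\<lambda>w. \<theta> w - of_nat n / 2 * w) has_field_derivative deriv \<theta> u - of_nat n / 2) (at u within S)"
        if "u \<in> S" for u
        using that S(1) by (auto intro!: derivative_eq_intros \<theta>_deriv)
      show "norm (deriv \<theta> u - of_nat n / 2) \<le> 1/2" if "u \<in> S" for u
        using Y0[of u] that by (auto simp: dist_norm S_def Y_def)
    qed (use that wp in auto)
    also have "(\<theta> (w + 2 * complex_of_real pi) - of_nat n / 2 * (w + 2 * complex_of_real pi)) - (\<theta> w - of_nat n / 2 * w) = D w"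
      by (simp add: D_def algebra_simps)
    also have "1/2 * norm (w + 2 * complex_of_real pi - w) = pi" by (simp add: norm_mult)
    finally have "norm (D w) \<le> pi" .
    moreover obtain k where k: "k \<in> \<int>" "D w = of_real (2 * k * pi)" using dich[OF wp(1)] by auto
    ultimately have "\<bar>2 * k * pi\<bar> \<le> pi" by (simp only: norm_of_real)
    then have "2 * \<bar>k\<bar> * pi \<le> 1 * pi" by (simp add: abs_mult)
    then have "2 * \<bar>k\<bar> \<le> 1" by (rule mult_right_le_imp_le) simp
    then have "k = 0" using k(1) by (auto simp: Ints_def)
    then show ?thesis using k by simp
  qed
  have "(\<lambda>w. D w) holomorphic_on upper_half"
    unfolding D_def
    by (intro holomorphic_intros holomorphic_on_compose_gen[OF _ \<theta>_holomorphic, unfolded o_def] \<theta>_holomorphic) auto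
  moreover have "\<i> * of_real (Y + 1) \<in> S" by (simp add: S_def)
  ultimately have "D z = 0"
    using analytic_continuation_open[of S upper_half D "\<lambda>_. 0" z] S open_upper_half D0 assms
    by (auto simp: convex_connected convex_upper_half)
  then show ?thesis by (simp add: D_def diff_eq_eq add.commute)
qed

text \<open>By the open mapping theorem a zero of Re \<theta>' would produce negative values of it,
  unless \<theta>' is constant; then the constant is n/2, by the limit at i infinity.\<close>

lemma Re_deriv_\<theta>_pos:
  assumes "Im z > 0" shows "Re (deriv \<theta> z) > 0"
proof (rule ccontr)
  assume "\<not> Re (deriv \<theta> z) > 0"
  then have z0: "Re (deriv \<theta> z) = 0" using Re_deriv_\<theta>_nonneg[OF assms] by simp
  have hol: "deriv \<theta> holomorphic_on upper_half"
    by (intro holomorphic_deriv \<theta>_holomorphic open_upper_half)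
  show False
  proof (cases "deriv \<theta> constant_on upper_half")
    case True
    then obtain c where c: "\<And>w. Im w > 0 \<Longrightarrow> deriv \<theta> w = c" by (auto simp: constant_on_def)
    have "(deriv \<theta> \<longlongrightarrow> c) to_i_infinity"
      by (rule tendsto_eventually, rule eventually_mono[OF eventually_Im_gt[of 0]]) (use c in auto)
    moreover have "to_i_infinity \<noteq> bot"
      by (rule filtercomap_neq_bot_surj) (auto simp: surj_def intro!: exI[of _ "\<i> * of_real _"])
    ultimately have "c = of_nat n / 2"
      using tendsto_unique deriv_\<theta>_tendsto by blast
    then have "c = of_real (real n / 2)" by simp
    then have "Re c = real n / 2" by (simp only: Re_complex_of_real)
    then show False using c[OF assms] z0 n_pos by simp
  next
    case False
    have "open (deriv \<theta> ` upper_half)"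
      using open_mapping_thm[OF hol open_upper_half _ open_upper_half _ False]
      by (simp add: convex_connected convex_upper_half)
    moreover have "deriv \<theta> z \<in> deriv \<theta> ` upper_half" using assms by auto
    ultimately obtain e where e: "e > 0" "ball (deriv \<theta> z) e \<subseteq> deriv \<theta> ` upper_half"
      by (meson openE)
    then have "deriv \<theta> z - of_real (e / 2) \<in> deriv \<theta> ` upper_half"
      by (intro subsetD[OF e(2)]) (simp add: dist_norm)
    then obtain w where "Im w > 0" "deriv \<theta> w = deriv \<theta> z - of_real (e / 2)" by auto
    then show False using Re_deriv_\<theta>_nonneg[of w] z0 e(1) by simp
  qed
qed

text \<open>The Noshiro-Warschawski argument. Dividing \<theta> by the constant z - w before
  applying the mean value theorem makes the increment along the segment equal to Re \<theta>' at an
  intermediate point.\<close>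

lemma \<theta>_inj:
  assumes "Im z > 0" "Im w > 0" "\<theta> z = \<theta> w" shows "z = w"
proof (rule ccontr)
  assume "z \<noteq> w"
  have "closed_segment w z \<subseteq> upper_half"
    using assms by (intro closed_segment_subset convex_upper_half) auto
  have "\<exists>u. u \<in> closed_segment w z \<and>
      Re (\<theta> z / (z - w)) - Re (\<theta> w / (z - w)) = Re (deriv \<theta> u / (z - w) * (z - w))"
    using \<open>closed_segment w z \<subseteq> _\<close>
    by (intro complex_mvt_line DERIV_cdivide \<theta>_deriv) auto
  then obtain u where "u \<in> closed_segment w z" "Re (deriv \<theta> u) = 0"
    using assms(3) \<open>z \<noteq> w\<close> by auto
  moreover from this have "Im u > 0" using \<open>closed_segment w z \<subseteq> _\<close> by auto
  ultimately show False using Re_deriv_\<theta>_pos[of u] by simp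
qed

end

section \<open>Boundary values\<close>


context comb
begin

lemma deriv_f:
  assumes "Im z > 0" shows "deriv f z = - sin (\<theta> z) * deriv \<theta> z"
proof -
  have "((\<lambda>w. cos (\<theta> w)) has_field_derivative - sin (\<theta> z) * deriv \<theta> z) (at z)"
    by (auto intro!: derivative_eq_intros \<theta>_deriv assms)
  then have "(f has_field_derivative - sin (\<theta> z) * deriv \<theta> z) (at z)"
    by (rule has_field_derivative_transform_within_open[OF _ open_upper_half])
      (use assms f_cos in auto)
  then show ?thesis by (rule DERIV_imp_deriv)
qed

text \<open>Near such a point 1 - f^2 = sin^2 \<theta> stays away from 0, so \<theta>' = - f' / sin
  \<theta> is bounded on a half disc, which is convex.\<close>

lemma \<theta>_locally_lipschitz:
  assumes "q x \<noteq> 1" "q x \<noteq> -1"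
  obtains r C where "r > 0"
    "\<And>z w. z \<in> ball (of_real x) r \<inter> upper_half \<Longrightarrow> w \<in> ball (of_real x) r \<inter> upper_half \<Longrightarrow>
      cmod (\<theta> z - \<theta> w) \<le> C * cmod (z - w)"
proof -
  define e where "e = cmod (1 - f (of_real x) ^ 2)"
  have "f (of_real x) \<noteq> 1" "f (of_real x) \<noteq> - 1"
    using assms by (simp_all add: f_of_real complex_eq_iff)
  then have e: "e > 0" by (simp add: e_def power2_eq_1_iff)
  have "continuous_on UNIV (\<lambda>z. cmod (1 - f z ^ 2))"
    by (intro continuous_intros f_continuous)
  then obtain \<delta> where \<delta>: "\<delta> > 0" "\<And>z. dist z (of_real x) < \<delta> \<Longrightarrow> dist (cmod (1 - f z ^ 2)) e < e / 2"
    unfolding e_def continuous_on_iff using e[unfolded e_def] by (meson UNIV_I half_gt_zero)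
  define r where "r = \<delta> / 2"
  have low: "cmod (1 - f z ^ 2) \<ge> e / 2" if "z \<in> ball (of_real x) r" for z
  proof -
    have "dist z (of_real x) < \<delta>" using that \<delta>(1) by (simp add: r_def dist_commute)
    then have "\<bar>cmod (1 - f z ^ 2) - e\<bar> < e / 2" using \<delta>(2) unfolding dist_real_def by blast
    then show ?thesis by linarith
  qed
  have "continuous_on (cball (of_real x) r) (deriv f)"
    by (intro holomorphic_on_imp_continuous_on holomorphic_on_subset[OF holomorphic_deriv[OF f_holomorphic open_UNIV]]) auto
  then have "bounded (deriv f ` cball (of_real x) r)"
    by (intro compact_imp_bounded compact_continuous_image) auto
  then obtain B where B: "\<And>z. z \<in> cball (of_real x) r \<Longrightarrow> cmod (deriv f z) \<le> B"
    by (metis bounded_iff imageI)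
  show ?thesis
  proof (rule that[of r "B / sqrt (e / 2)"])
    show "r > 0" using \<delta>(1) by (simp add: r_def)
    fix z w assume zw: "z \<in> ball (of_real x) r \<inter> upper_half" "w \<in> ball (of_real x) r \<inter> upper_half"
    have bd: "cmod (deriv \<theta> u) \<le> B / sqrt (e / 2)" if u: "u \<in> ball (of_real x) r \<inter> upper_half" for u
    proof -
      have "1 - f u ^ 2 = sin (\<theta> u) ^ 2" using u by (simp add: f_cos sin_squared_eq)
      then have "e / 2 \<le> cmod (sin (\<theta> u)) ^ 2" using low[of u] u by (simp add: norm_power)
      then have s: "sqrt (e / 2) \<le> cmod (sin (\<theta> u))" by (intro real_le_lsqrt) auto
      have "cmod (sin (\<theta> u)) * cmod (deriv \<theta> u) \<le> B"
        using B[of u] deriv_f[of u] u by (simp add: norm_mult)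
      then have "sqrt (e / 2) * cmod (deriv \<theta> u) \<le> B"
        using mult_right_mono[OF s, of "cmod (deriv \<theta> u)"] by simp
      then show ?thesis using e by (simp add: field_simps)
    qed
    show "cmod (\<theta> z - \<theta> w) \<le> B / sqrt (e / 2) * cmod (z - w)"
    proof (rule field_differentiable_bound[of "ball (of_real x) r \<inter> upper_half" \<theta> "deriv \<theta>"])
      show "convex (ball (complex_of_real x) r \<inter> upper_half)"
        by (intro convex_Int convex_ball convex_upper_half)
    qed (use bd zw in \<open>auto intro: \<theta>_deriv\<close>)
  qed
qed

text \<open>Boundary value of \<theta> along the vertical; its existence is established where
  \<open>q\<close> is neither 1 nor -1.\<close>

definition L :: "real \<Rightarrow> complex" where
  "L x = Lim (at_right 0) (\<lambda>y. \<theta> (Complex x y))"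

lemma vertical_limit: "((\<lambda>y. Complex x y) \<longlongrightarrow> of_real x) (at_right 0)"
  unfolding complex_of_real_def by (intro tendsto_Complex tendsto_const) (rule tendsto_ident_at)

lemma vertical_pos: "eventually (\<lambda>y. y > (0::real)) (at_right 0)"
  by (rule eventually_at_right_less)

lemma L_tendsto:
  assumes "q x \<noteq> 1" "q x \<noteq> -1"
  shows "((\<lambda>y. \<theta> (Complex x y)) \<longlongrightarrow> L x) (at_right 0)"
proof -
  obtain r C where r: "r > 0"
    "\<And>z w. z \<in> ball (of_real x) r \<inter> upper_half \<Longrightarrow> w \<in> ball (of_real x) r \<inter> upper_half \<Longrightarrow>
      cmod (\<theta> z - \<theta> w) \<le> C * cmod (z - w)"
    using \<theta>_locally_lipschitz[OF assms] by blast
  define X where "X = ball (of_real x) r \<inter> upper_half"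
  have "(max C 0)-lipschitz_on X \<theta>"
  proof (rule lipschitz_onI)
    fix z w assume "z \<in> X" "w \<in> X"
    then have "cmod (\<theta> z - \<theta> w) \<le> C * cmod (z - w)" using r(2) by (simp add: X_def)
    also have "\<dots> \<le> max C 0 * cmod (z - w)" by (intro mult_right_mono) auto
    finally show "dist (\<theta> z) (\<theta> w) \<le> max C 0 * dist z w" by (simp add: dist_norm)
  qed auto
  then have uc: "uniformly_continuous_on X \<theta>" by (rule lipschitz_on_uniformly_continuous)
  have ev: "eventually (\<lambda>y. Complex x y \<in> X) (at_right 0)"
  proof -
    have "eventually (\<lambda>y. Complex x y \<in> ball (of_real x) r) (at_right 0)"
      using vertical_limit by (rule topological_tendstoD) (use r(1) in auto)
    then show ?thesis using vertical_pos by eventually_elim (auto simp: X_def)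
  qed
  have "of_real x \<in> closure X"
    by (rule Lim_in_closed_set[OF closed_closure _ trivial_limit_at_right_real vertical_limit])
      (use ev in eventually_elim, use closure_subset in blast)
  then obtain l where l: "(\<theta> \<longlongrightarrow> l) (at (of_real x) within X)"
    using uniformly_continuous_on_extension_at_closure[OF uc] by blast
  have "filterlim (\<lambda>y. Complex x y) (at (of_real x) within X) (at_right 0)"
    unfolding filterlim_at
    using vertical_limit eventually_conj[OF ev vertical_pos]
    by (auto elim!: eventually_mono simp: complex_eq_iff)
  then have "((\<lambda>y. \<theta> (Complex x y)) \<longlongrightarrow> l) (at_right 0)"
    by (rule filterlim_compose[OF l])
  then show ?thesis
    unfolding L_def using tendsto_Lim[OF trivial_limit_at_right_real] by metis
qed

lemma cos_L:
  assumes "q x \<noteq> 1" "q x \<noteq> -1" shows "cos (L x) = of_real (q x)"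
proof (rule tendsto_unique[OF trivial_limit_at_right_real])
  show "((\<lambda>y. cos (\<theta> (Complex x y))) \<longlongrightarrow> cos (L x)) (at_right 0)"
    by (intro tendsto_intros L_tendsto assms)
  have "isCont f (of_real x)"
    using f_continuous[of UNIV] by (simp add: continuous_on_eq_continuous_at)
  then have "((\<lambda>y. f (Complex x y)) \<longlongrightarrow> f (of_real x)) (at_right 0)"
    by (rule isCont_tendsto_compose[OF _ vertical_limit])
  then have "((\<lambda>y. f (Complex x y)) \<longlongrightarrow> of_real (q x)) (at_right 0)"
    by (simp add: f_of_real)
  then show "((\<lambda>y. cos (\<theta> (Complex x y))) \<longlongrightarrow> of_real (q x)) (at_right 0)"
    by (rule Lim_transform_eventually)
      (use vertical_pos in eventually_elim, simp add: f_cos)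
qed

lemma Im_L:
  assumes "q x \<noteq> 1" "q x \<noteq> -1" shows "Im (L x) \<ge> 0"
  by (rule tendsto_lowerbound[OF tendsto_Im[OF L_tendsto[OF assms]] _ trivial_limit_at_right_real])
    (use vertical_pos in eventually_elim, simp add: Im_\<theta> less_imp_le)

lemma Re_\<theta>_mono:
  assumes "x \<le> x'" "y > 0" shows "Re (\<theta> (Complex x y)) \<le> Re (\<theta> (Complex x' y))"
proof -
  have sub: "closed_segment (Complex x y) (Complex x' y) \<subseteq> upper_half"
    using assms by (intro closed_segment_subset convex_upper_half) auto
  have "\<exists>u. u \<in> closed_segment (Complex x y) (Complex x' y) \<and>
      Re (\<theta> (Complex x' y)) - Re (\<theta> (Complex x y)) = Re (deriv \<theta> u * (Complex x' y - Complex x y))"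
    using sub by (intro complex_mvt_line \<theta>_deriv) auto
  then obtain u where u: "u \<in> upper_half"
    "Re (\<theta> (Complex x' y)) - Re (\<theta> (Complex x y)) = Re (deriv \<theta> u * (Complex x' y - Complex x y))"
    using sub by blast
  moreover have "Re (deriv \<theta> u * (Complex x' y - Complex x y)) = Re (deriv \<theta> u) * (x' - x)" by simp
  moreover have "\<dots> \<ge> 0" using Re_deriv_\<theta>_nonneg[of u] u(1) assms by simp
  ultimately show ?thesis by linarith
qed

lemma Re_L_mono:
  assumes "x \<le> x'" "q x \<noteq> 1" "q x \<noteq> -1" "q x' \<noteq> 1" "q x' \<noteq> -1"
  shows "Re (L x) \<le> Re (L x')"
  by (rule tendsto_le[OF trivial_limit_at_right_real
      tendsto_Re[OF L_tendsto[OF assms(4,5)]] tendsto_Re[OF L_tendsto[OF assms(2,3)]]])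
    (use vertical_pos in eventually_elim, simp add: Re_\<theta>_mono assms)

lemma q_shift: "q (x + 2 * pi) = (-1) ^ n * q x"
proof -
  have "complex_of_real (q (x + 2 * pi)) = of_real ((-1) ^ n * q x)"
    using f_shift[of "of_real x"] by (simp flip: f_of_real)
  then show ?thesis by (simp only: of_real_eq_iff)
qed

lemma L_shift:
  assumes "q x \<noteq> 1" "q x \<noteq> -1" shows "L (x + 2 * pi) = L x + of_nat n * of_real pi"
proof -
  have "((\<lambda>y. \<theta> (Complex x y) + of_nat n * of_real pi) \<longlongrightarrow> L x + of_nat n * of_real pi) (at_right 0)"
    by (intro tendsto_intros L_tendsto assms)
  then have "((\<lambda>y. \<theta> (Complex (x + 2 * pi) y)) \<longlongrightarrow> L x + of_nat n * of_real pi) (at_right 0)"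
  proof (rule Lim_transform_eventually)
    show "eventually (\<lambda>y. \<theta> (Complex x y) + of_nat n * of_real pi = \<theta> (Complex (x + 2 * pi) y)) (at_right 0)"
      using vertical_pos
    proof eventually_elim
      case (elim y)
      have "Complex (x + 2 * pi) y = Complex x y + 2 * complex_of_real pi" by (simp add: complex_eq_iff)
      then show ?case using \<theta>_shift[of "Complex x y"] elim by simp
    qed
  qed
  then show ?thesis unfolding L_def[of "x + 2 * pi"] by (rule tendsto_Lim[OF trivial_limit_at_right_real])
qed

lemma isCont_L:
  assumes "q x \<noteq> 1" "q x \<noteq> -1" shows "isCont L x"
proof -
  obtain r C where r: "r > 0"
    "\<And>z w. z \<in> ball (of_real x) r \<inter> upper_half \<Longrightarrow> w \<in> ball (of_real x) r \<inter> upper_half \<Longrightarrow>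
      cmod (\<theta> z - \<theta> w) \<le> C * cmod (z - w)"
    using \<theta>_locally_lipschitz[OF assms] by blast
  have "open {x. q x \<noteq> 1}" "open {x. q x \<noteq> -1}"
    by (intro open_Collect_neq q_continuous continuous_on_const)+
  then have "open ({x. q x \<noteq> 1} \<inter> {x. q x \<noteq> -1})" by (rule open_Int)
  moreover have "x \<in> {x. q x \<noteq> 1} \<inter> {x. q x \<noteq> -1}" using assms by auto
  ultimately obtain d where d: "d > 0" "ball x d \<subseteq> {x. q x \<noteq> 1} \<inter> {x. q x \<noteq> -1}"
    by (meson openE)
  have bd: "cmod (L x' - L x) \<le> C * \<bar>x' - x\<bar>" if x': "\<bar>x' - x\<bar> < min r d" for x'
  proof -
    have "x' \<in> ball x d" using x' by (simp add: dist_real_def abs_minus_commute)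
    then have q': "q x' \<noteq> 1" "q x' \<noteq> -1" using d(2) by auto
    have in_ball: "eventually (\<lambda>y. Complex u y \<in> ball (of_real x) r) (at_right 0)" if "\<bar>u - x\<bar> < r" for u
      using vertical_limit by (rule topological_tendstoD)
        (use that in \<open>simp_all add: dist_real_def abs_minus_commute\<close>)
    show ?thesis
    proof (rule tendsto_upperbound[OF tendsto_norm[OF tendsto_diff[OF L_tendsto[OF q'] L_tendsto[OF assms]]] _
        trivial_limit_at_right_real])
      have "\<bar>x' - x\<bar> < r" "\<bar>x - x\<bar> < r" using x' r(1) by auto
      from in_ball[OF this(1)] in_ball[OF this(2)] vertical_pos
      show "eventually (\<lambda>y. cmod (\<theta> (Complex x' y) - \<theta> (Complex x y)) \<le> C * \<bar>x' - x\<bar>) (at_right 0)"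
      proof eventually_elim
        case (elim y)
        have "cmod (Complex x' y - Complex x y) = \<bar>x' - x\<bar>" by (simp add: cmod_def)
        then show ?case using r(2)[of "Complex x' y" "Complex x y"] elim by auto
      qed
    qed
  qed
  have "((\<lambda>x'. L x' - L x) \<longlongrightarrow> 0) (at x)"
  proof (rule Lim_null_comparison)
    show "eventually (\<lambda>x'. cmod (L x' - L x) \<le> C * \<bar>x' - x\<bar>) (at x)"
      unfolding eventually_at using bd r(1) d(1)
      by (intro exI[of _ "min r d"]) (auto simp: dist_real_def)
    have "((\<lambda>x'. C * \<bar>x' - x\<bar>) \<longlongrightarrow> C * \<bar>x - x\<bar>) (at x)" by (intro tendsto_intros)
    then show "((\<lambda>x'. C * \<bar>x' - x\<bar>) \<longlongrightarrow> 0) (at x)" by simp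
  qed
  then show ?thesis by (simp add: isCont_def LIM_zero_iff)
qed

end

section \<open>Avoided slits\<close>


lemma chebyshev_cosh: "poly (chebyshev n) (cosh y) = cosh (real n * y)"
proof (induction n rule: induct_nat_012)
  case (ge2 n)
  have "real (Suc (Suc n)) * y = real (Suc n) * y + y" "real n * y = real (Suc n) * y - y"
    by (simp_all add: algebra_simps)
  then have "cosh (real (Suc (Suc n)) * y) = 2 * cosh y * cosh (real (Suc n) * y) - cosh (real n * y)"
    by (simp only: cosh_add cosh_diff) (simp add: algebra_simps)
  then show ?case using ge2 by (simp add: chebyshev_Suc_Suc del: of_nat_Suc)
qed (simp_all add: chebyshev_0 chebyshev_1)

lemma cosh_real_gt_1: "x > 0 \<Longrightarrow> cosh x > (1::real)"
  using cosh_real_strict_mono[of 0 x] by simp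

context comb
begin

lemma L_of_q_gt_1:
  assumes "q x > 1" shows "cos (Re (L x)) = 1" "cosh (Im (L x)) = q x"
proof -
  have "cos (L x) = of_real (q x)" using assms by (intro cos_L) auto
  then have *: "cos (Re (L x)) * cosh (Im (L x)) = q x" "sin (Re (L x)) * sinh (Im (L x)) = 0"
    using Re_cos_cosh[of "L x"] Im_cos_sinh[of "L x"] by auto
  have "sinh (Im (L x)) \<noteq> 0"
  proof
    assume "sinh (Im (L x)) = 0"
    then have "cos (Re (L x)) = q x" using *(1) by simp
    then show False using assms cos_le_one[of "Re (L x)"] by linarith
  qed
  then have "sin (Re (L x)) = 0" using * by auto
  then have "cos (Re (L x)) = 1 \<or> cos (Re (L x)) = -1"
    using sin_cos_squared_add[of "Re (L x)"] by (simp add: power2_eq_1_iff)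
  moreover have "cos (Re (L x)) \<noteq> -1"
    
  proof
    assume "cos (Re (L x)) = -1"
    then have "q x = - cosh (Im (L x))" using *(1) by simp
    then show False using assms cosh_real_pos[of "Im (L x)"] by linarith
  qed
  ultimately show "cos (Re (L x)) = 1" by blast
  then show "cosh (Im (L x)) = q x" using * by simp
qed

end

text \<open>\<open>Re_L0\<close> fixes the branch of the arccosine, which is free up to multiples of
  2 pi, so that the gap at 0 has its boundary values on the imaginary axis.\<close>

locale gap_comb = comb +
  fixes s :: real
  assumes s_pos: "0 < s" and s_less: "s < 2 * pi"
    and q0_ge: "poly (chebyshev n) (1 / cos (s / 4)) \<le> q 0"
    and Re_L0: "Re (L 0) = 0"
begin

abbreviation c :: real where "c \<equiv> cos (s / 4)"

lemma c_pos: "c > 0" and c_less_1: "c < 1"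
proof -
  show "c > 0" using s_pos s_less by (intro cos_gt_zero_pi) auto
  show "c < 1" using cos_monotone_0_pi[of 0 "s / 4"] s_pos s_less by simp
qed

text \<open>h = arcosh(sec(s/4)), for which cosh(n h) is the Chebyshev value: the slits reach at
  least to height n h.\<close>

lemma cosh_height: obtains h where "h > 0" "cosh h = 1 / c" "cosh (real n * h) \<le> q 0"
proof -
  have "1 / c > 1" using c_pos c_less_1 by simp
  then have "cosh (arcosh (1 / c)) = 1 / c" "arcosh (1 / c) > 0"
    using arcosh_real_gt_1_iff[of "1 / c"] by (auto simp: cosh_arcosh_real)
  moreover from this have "cosh (real n * arcosh (1 / c)) \<le> q 0"
    using q0_ge chebyshev_cosh[of n "arcosh (1 / c)"] by simp
  ultimately show ?thesis using that by blast
qed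

lemma q0_gt_1: "q 0 > 1"
proof -
  obtain h where h: "h > 0" "cosh h = 1 / c" "cosh (real n * h) \<le> q 0" by (rule cosh_height)
  have "cosh (real n * h) > 1" using h(1) n_pos by (intro cosh_real_gt_1) simp
  then show ?thesis using h by linarith
qed

text \<open>Where q > 1, Re L is a multiple of 2 pi. Being continuous and starting at 0, it would
  have to pass pi before reaching another multiple.\<close>

lemma Re_L_on_gap:
  assumes "0 \<le> x1" "\<And>x. 0 \<le> x \<Longrightarrow> x \<le> x1 \<Longrightarrow> q x > 1"
  shows "Re (L x1) = 0"
proof (rule ccontr)
  assume "Re (L x1) \<noteq> 0"
  moreover have q1: "q 0 > 1" "q x1 > 1" using assms by auto
  then have "Re (L x1) \<ge> 0" using Re_L_mono[of 0 x1] assms(1) Re_L0 by auto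
  moreover have "cos (Re (L x1)) = 1" by (rule L_of_q_gt_1) (rule q1)
  ultimately have "Re (L x1) > pi"
    using cos_monotone_0_pi[of 0 "Re (L x1)"] by (cases "Re (L x1) \<le> pi") auto
  moreover have "continuous_on {0..x1} (\<lambda>x. Re (L x))"
  proof (intro continuous_at_imp_continuous_on ballI)
    fix x assume "x \<in> {0..x1}"
    then have "isCont L x" using assms(2)[of x] by (intro isCont_L) auto
    then show "isCont (\<lambda>x. Re (L x)) x" by (simp add: isCont_def tendsto_Re)
  qed
  ultimately obtain u where "0 \<le> u" "u \<le> x1" "Re (L u) = pi"
    using IVT'[of "\<lambda>x. Re (L x)" 0 pi x1] Re_L0 assms(1) by auto
  then show False using L_of_q_gt_1(1)[of u] assms(2)[of u] by simp
qed

lemma \<theta>_shift_int: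
  assumes "Im z > 0"
  shows "\<theta> (z + of_int k * (2 * of_real pi)) = \<theta> z + of_int k * (of_nat n * of_real pi)"
proof -
  have nat: "\<theta> (w + of_nat k * (2 * of_real pi)) = \<theta> w + of_nat k * (of_nat n * of_real pi)"
    if "Im w > 0" for w k
  proof (induction k)
    case (Suc k)
    then show ?case
      using \<theta>_shift[of "w + of_nat k * (2 * of_real pi)"] that by (simp add: algebra_simps)
  qed simp
  show ?thesis
  proof (cases k)
    case (nonneg m)
    then show ?thesis using nat[OF assms, of m] by simp
  next
    case (neg m)
    then have k: "complex_of_int k = - of_nat (Suc m)" by simp
    have "\<theta> ((z - of_nat (Suc m) * (2 * of_real pi)) + of_nat (Suc m) * (2 * of_real pi)) =
        \<theta> (z - of_nat (Suc m) * (2 * of_real pi)) + of_nat (Suc m) * (of_nat n * of_real pi)"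
      by (rule nat) (use assms in simp)
    then show ?thesis unfolding k by (simp add: algebra_simps del: of_nat_Suc)
  qed
qed

text \<open>The leftmost point of [0, \<open>\<tau> 0\<close>] at which \<open>q\<close> has come
  down to cosh b; it exists since \<open>q (\<tau> 0) = 1\<close>, and up to it q > 1, as
  \<open>Re_L_on_gap\<close> requires.\<close>

lemma gap_point:
  assumes "b > 0" "cosh b \<le> q 0"
  obtains x where "q x > 1" "L x = \<i> * of_real b"
proof -
  have b1: "cosh b > 1" using assms(1) by (rule cosh_real_gt_1)
  define C where "C = {0..\<tau> 0} \<inter> {x. q x \<le> cosh b}"
  have "compact C"
    unfolding C_def by (intro compact_Int_closed closed_Collect_le q_continuous continuous_on_const) auto
  moreover have "\<tau> 0 \<in> C" using \<tau>_in[of 0] q_\<tau>[of 0] b1 by (auto simp: C_def)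
  ultimately obtain x1 where x1: "x1 \<in> C" "\<And>x. x \<in> C \<Longrightarrow> x1 \<le> x"
    using compact_attains_inf[of C] by auto
  then have x1': "0 \<le> x1" "x1 \<le> \<tau> 0" "q x1 \<le> cosh b" by (auto simp: C_def)
  obtain u where u: "0 \<le> u" "u \<le> x1" "q u = cosh b"
    using IVT2'[of q x1 "cosh b" 0] x1' assms(2) q_continuous by auto
  then have "u \<in> C" using x1' by (auto simp: C_def)
  then have qx1: "q x1 = cosh b" using x1(2)[of u] u by simp
  have "q x > 1" if "0 \<le> x" "x \<le> x1" for x
  proof (cases "x = x1")
    case False
    then have "x \<notin> C" using x1(2)[of x] that by auto
    then show ?thesis using that x1' b1 by (auto simp: C_def)
  qed (use qx1 b1 in auto)
  then have "Re (L x1) = 0" using Re_L_on_gap[of x1] x1' by auto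
  moreover have "Im (L x1) = b"
  proof -
    have "cosh (Im (L x1)) = cosh b" using L_of_q_gt_1(2)[of x1] qx1 b1 by simp
    moreover have "q x1 \<noteq> 1" "q x1 \<noteq> -1" using qx1 b1 by linarith+
    then have "Im (L x1) \<ge> 0" by (rule Im_L)
    ultimately show ?thesis
      using assms(1) by (metis cosh_real_nonneg_le_iff less_imp_le order_antisym order_refl)
  qed
  ultimately show ?thesis using qx1 b1 by (intro that[of x1]) (auto simp: complex_eq_iff)
qed

text \<open>The boundary value at a point of the gap around \<open>0\<close> already takes the value \<open>\<i> b\<close>;
  by the open mapping theorem an interior point with the same value would contradict injectivity.\<close>

lemma slit_avoided:
  assumes "Im z > 0" "\<theta> z = Complex (of_int k * (real n * pi)) b"
  shows "cosh b > q 0"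
proof (rule ccontr)
  assume "\<not> cosh b > q 0"
  then have le: "cosh b \<le> q 0" by simp
  have b: "b > 0" using Im_\<theta>[OF assms(1)] unfolding assms(2) by simp
  obtain x where x: "q x > 1" "L x = \<i> * of_real b"
    by (rule gap_point[OF b le])
  \<comment> \<open>Translation to the slit over 0, the one whose boundary values are known from
    \<open>gap_point\<close>.\<close>
  define w where "w = z + of_int (- k) * (2 * of_real pi)"
  have w: "Im w > 0" using assms(1) by (simp add: w_def)
  have "\<theta> w = \<theta> z + of_int (- k) * (of_nat n * of_real pi)"
    unfolding w_def by (rule \<theta>_shift_int[OF assms(1)])
  also have "\<dots> = \<i> * of_real b"
    unfolding assms(2) by (rule complex_eqI) simp_all
  finally have \<theta>w: "\<theta> w = \<i> * of_real b" .
  define U where "U = ball w (Im w / 2)"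
  have U: "Im u > Im w / 2" if "u \<in> U" for u
  proof -
    have "\<bar>Im (w - u)\<bar> < Im w / 2"
      by (rule le_less_trans[OF abs_Im_le_cmod]) (use that in \<open>simp add: U_def dist_norm\<close>)
    then have "\<bar>Im w - Im u\<bar> < Im w / 2" by simp
    then show ?thesis by linarith
  qed
  have Usub: "U \<subseteq> upper_half"
  proof
    fix u assume "u \<in> U"
    then show "u \<in> upper_half" using U[of u] w by simp
  qed
  have "open (\<theta> ` U)"
  proof (rule open_mapping_thm[OF \<theta>_holomorphic open_upper_half _ _ Usub])
    show "\<not> \<theta> constant_on upper_half"
    proof
      assume "\<theta> constant_on upper_half"
      then obtain a where a: "\<And>u. u \<in> upper_half \<Longrightarrow> \<theta> u = a" unfolding constant_on_def by blast
      have "\<theta> \<i> = \<theta> (2 * \<i>)" using a[of \<i>] a[of "2 * \<i>"] by simp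
      then have "\<i> = 2 * \<i>" using \<theta>_inj[of \<i> "2 * \<i>"] by simp
      then show False by (simp add: complex_eq_iff)
    qed
    show "connected upper_half" by (intro convex_connected convex_upper_half)
    show "open U" by (simp add: U_def)
  qed
  moreover have "L x \<in> \<theta> ` U" 
  proof
    show "L x = \<theta> w" using \<theta>w x(2) by simp
    show "w \<in> U" using w by (simp add: U_def)
  qed
  ultimately have "eventually (\<lambda>y. \<theta> (Complex x y) \<in> \<theta> ` U) (at_right 0)"
    using x(1) by (intro topological_tendstoD[OF L_tendsto]) simp_all
  moreover have "eventually (\<lambda>y. y < Im w / 2) (at_right 0)"
    by (rule order_tendstoD(2)[OF tendsto_ident_at]) (use w in simp)
  ultimately have "eventually (\<lambda>y. False) (at_right (0::real))"
    using vertical_pos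
  proof eventually_elim
    case (elim y)
    then obtain u where u: "u \<in> U" "\<theta> (Complex x y) = \<theta> u" by blast
    then have "Im u > 0" using Usub by blast
    then have "Complex x y = u" using elim u(2) \<theta>_inj[of "Complex x y" u] by simp
    then have "Im u = y" by auto
    then show ?case using U[OF u(1)] elim by linarith
  qed
  then show False by simp
qed

text \<open>Modulo the translation by \<open>n \<pi>\<close>, \<open>K\<close> maps the slit half plane to the plane without the rays
  \<open>(-\<infinity>, -1]\<close> (coming from the slits) and \<open>[1, \<infinity>)\<close> (coming from the real line), so that
  \<open>Re (Arccos (K w))\<close> is \<open>\<pi>\<close> times the harmonic measure of the slits.\<close>

definition K :: "complex \<Rightarrow> complex" where
  "K w = of_real (cos (s / 2)) + of_real (1 - cos (s / 2)) / (sin (w / of_nat n))\<^sup>2"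

lemma cos_half_s: "cos (s / 2) = 2 * c\<^sup>2 - 1" "-1 < cos (s / 2)" "cos (s / 2) < 1"
proof -
  show *: "cos (s / 2) = 2 * c\<^sup>2 - 1"
    using cos_double_cos[of "s / 4"] by simp
  show "-1 < cos (s / 2)" using * c_pos by simp
  show "cos (s / 2) < 1" using * c_pos c_less_1 by (simp add: power_less_one_iff abs_square_less_1)
qed

text \<open>The imaginary part of sin^2 w is 2 sin(Re w) cos(Re w) times the positive factor cosh(Im
  w) sinh(Im w), so the sine or the cosine of Re w vanishes.\<close>

lemma sin_squared_real:
  assumes "Im ((sin w)\<^sup>2) = 0" "Im w > 0"
  shows "(\<exists>k::int. Re w = of_int k * pi) \<and> (sin w)\<^sup>2 = - of_real ((sinh (Im w))\<^sup>2) \<or>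
    (sin w)\<^sup>2 = of_real ((cosh (Im w))\<^sup>2)"
proof -
  have "Im ((sin w)\<^sup>2) = 2 * (Re (sin w) * Im (sin w))" by (simp add: power2_eq_square)
  also have "\<dots> = 2 * (sin (Re w) * cosh (Im w) * (cos (Re w) * sinh (Im w)))"
    by (simp only: Re_sin_cosh Im_sin_sinh)
  finally have "sin (Re w) = 0 \<or> cos (Re w) = 0"
    using assms by auto
  then show ?thesis
  proof
    assume *: "sin (Re w) = 0"
    then have "(cos (Re w))\<^sup>2 = 1" using sin_cos_squared_add[of "Re w"] by simp
    moreover have "(sin w)\<^sup>2 = - of_real ((cos (Re w) * sinh (Im w))\<^sup>2)"
      using * by (simp add: complex_eq_iff power2_eq_square Re_sin_cosh Im_sin_sinh del: sin_of_real cos_of_real)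
    moreover obtain k :: int where "Re w = of_int k * pi" using * by (auto simp: sin_zero_iff_int2)
    ultimately show ?thesis by (auto simp: power_mult_distrib)
  next
    assume *: "cos (Re w) = 0"
    then have "(sin (Re w))\<^sup>2 = 1" using sin_cos_squared_add[of "Re w"] by simp
    moreover have "(sin w)\<^sup>2 = of_real ((sin (Re w) * cosh (Im w))\<^sup>2)"
      using * by (simp add: complex_eq_iff power2_eq_square Re_sin_cosh Im_sin_sinh)
    ultimately show ?thesis by (auto simp: power_mult_distrib)
  qed
qed

lemma K_avoids:
  assumes "Im z > 0" "Im (K (\<theta> z)) = 0" shows "\<bar>Re (K (\<theta> z))\<bar> < 1"
proof -
  define w where "w = \<theta> z / of_nat n"
  define g where "g = cos (s / 2)"
  have g: "-1 < g" "g < 1" "g = 2 * c\<^sup>2 - 1" using cos_half_s by (simp_all add: g_def)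
  have w: "Im w > 0" using Im_\<theta>[OF assms(1)] n_pos by (simp add: w_def)
  have K: "K (\<theta> z) = of_real g + of_real (1 - g) / (sin w)\<^sup>2" by (simp add: K_def w_def g_def)
  have "Im ((sin w)\<^sup>2) = 0"
  proof -
    have "Im (of_real (1 - g) / (sin w)\<^sup>2) = 0" using assms(2) K by simp
    then show ?thesis using g(2) by (auto simp: Im_divide)
  qed
  from sin_squared_real[OF this w] show ?thesis
  proof (elim disjE conjE exE)
    \<comment> \<open>Here \<theta> z lies on a line that carries a slit; since it avoids the slit,
      it is strictly higher than n h.\<close>
    fix k :: int assume k: "Re w = of_int k * pi" and sq: "(sin w)\<^sup>2 = - of_real ((sinh (Im w))\<^sup>2)"
    obtain h where h: "h > 0" "cosh h = 1 / c" "cosh (real n * h) \<le> q 0" by (rule cosh_height)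
    have "\<theta> z = Complex (of_int k * (real n * pi)) (real n * Im w)"
      using k n_pos by (auto simp: w_def complex_eq_iff field_simps)
    then have "cosh (real n * Im w) > cosh (real n * h)"
      using slit_avoided[OF assms(1)] h(3) by fastforce
    then have "cosh (Im w) > 1 / c"
      using w h n_pos unfolding h(2)[symmetric]
      by (simp add: cosh_real_nonneg_less_iff)
    then have "(cosh (Im w))\<^sup>2 > (1 / c)\<^sup>2"
      using c_pos by (intro power_strict_mono) auto
    then have sh: "(sinh (Im w))\<^sup>2 > 1 / c\<^sup>2 - 1" by (simp add: sinh_square_eq power_divide)
    have pos: "1 / c\<^sup>2 - 1 > 0" using c_pos c_less_1 by (simp add: power_less_one_iff)
    have shp: "(sinh (Im w))\<^sup>2 > 0" using sh pos by linarith
    have "Re (K (\<theta> z)) = g - (1 - g) / (sinh (Im w))\<^sup>2"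
      unfolding K sq by (simp add: Re_divide_of_real flip: of_real_minus of_real_power)
    moreover have "(1 - g) / (sinh (Im w))\<^sup>2 < (1 - g) / (1 / c\<^sup>2 - 1)"
      using divide_strict_left_mono[OF sh _ mult_pos_pos[OF shp pos], of "1 - g"] g(2) by simp
    \<comment> \<open>At height n h the value is g - 2 c^2 = -1; this is what fixes the constant
      cos(s/2) in \<open>K\<close>.\<close>
    moreover have "(1 - g) / (1 / c\<^sup>2 - 1) = 2 * c\<^sup>2"
      using pos c_pos by (simp add: g(3) field_simps)
    moreover have "(1 - g) / (sinh (Im w))\<^sup>2 > 0" using shp g(2) by (intro divide_pos_pos) simp_all
    ultimately have "Re (K (\<theta> z)) < 1" "- 1 < Re (K (\<theta> z))" using g by linarith+
    then show ?thesis by simp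
  next
    assume sq: "(sin w)\<^sup>2 = of_real ((cosh (Im w))\<^sup>2)"
    have "(cosh (Im w))\<^sup>2 > 1" using w by (simp add: one_less_power cosh_real_gt_1)
    then have "(1 - g) / (cosh (Im w))\<^sup>2 < 1 - g" "(1 - g) / (cosh (Im w))\<^sup>2 > 0"
      using g by (auto simp: divide_less_eq)
    moreover have "Re (K (\<theta> z)) = g + (1 - g) / (cosh (Im w))\<^sup>2"
      unfolding K sq by (simp flip: of_real_power)
    ultimately have "Re (K (\<theta> z)) < 1" "- 1 < Re (K (\<theta> z))" using g by linarith+
    then show ?thesis by simp
  qed
qed

end

section \<open>The mean value identity\<close>


text \<open>\<open>Re \<circ> Arccos\<close>, written so that continuity across the branch cuts is evident.\<close>

definition ellip :: "complex \<Rightarrow> real" where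
  "ellip k = arccos ((cmod (k + 1) - cmod (k - 1)) / 2)"

lemma ellip_arg: "\<bar>(cmod (k + 1) - cmod (k - 1)) / 2\<bar> \<le> 1"
proof -
  have "\<bar>cmod (k + 1) - cmod (k - 1)\<bar> \<le> cmod ((k + 1) - (k - 1))" by (rule norm_triangle_ineq3)
  then show ?thesis by simp
qed

lemma ellip_arg': "- 2 \<le> cmod (k + 1) - cmod (k - 1)" "cmod (k + 1) - cmod (k - 1) \<le> 2"
  using ellip_arg[of k] by (auto simp: abs_le_iff)

lemma ellip_bounds: "0 \<le> ellip k" "ellip k \<le> pi"
  using ellip_arg[of k] by (auto simp: ellip_def abs_le_iff intro: arccos_lbound arccos_ubound)

lemma continuous_ellip: "continuous_on UNIV ellip"
  unfolding ellip_def
  by (intro continuous_intros) (use ellip_arg' in auto)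

lemma ellip_of_real:
  assumes "\<bar>x\<bar> \<le> 1" shows "ellip (of_real x) = arccos x"
proof -
  have "cmod (of_real x + 1) = x + 1" "cmod (of_real x - 1) = 1 - x"
    using assms norm_of_real[of "x + 1", where ?'a = complex] norm_of_real[of "x - 1", where ?'a = complex] by auto
  then show ?thesis by (simp add: ellip_def)
qed

lemma ellip_ge_1: assumes "x \<ge> 1" shows "ellip (of_real x) = 0"
proof -
  have "cmod (of_real x + 1) = x + 1" "cmod (of_real x - 1) = x - 1"
    using assms norm_of_real[of "x + 1", where ?'a = complex] norm_of_real[of "x - 1", where ?'a = complex] by auto
  then show ?thesis by (simp add: ellip_def)
qed

text \<open>The value pi means |k - 1| = |k + 1| + 2, the equality case of the triangle
  inequality.\<close>

lemma ellip_eq_pi: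
  assumes "ellip k = pi" shows "Im k = 0" "Re k \<le> -1"
proof -
  define a where "a = cmod (k + 1)"
  define b where "b = cmod (k - 1)"
  have "cos (ellip k) = (a - b) / 2"
    unfolding ellip_def a_def b_def using ellip_arg[of k] by (intro cos_arccos) (auto simp: abs_le_iff)
  then have ab: "b = a + 2" using assms by simp
  have "b\<^sup>2 = a\<^sup>2 - 4 * Re k"
    unfolding a_def b_def cmod_power2 by (simp add: power2_eq_square algebra_simps)
  then have a: "a = - (Re k + 1)" unfolding ab by (simp add: power2_eq_square algebra_simps)
  moreover have "a \<ge> 0" by (simp add: a_def)
  ultimately show "Re k \<le> -1" by simp
  have "a\<^sup>2 = (Re k + 1)\<^sup>2 + (Im k)\<^sup>2" by (simp add: a_def cmod_power2)
  then show "Im k = 0" using a by (simp add: power2_eq_square algebra_simps)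
qed

text \<open>The segment from 0 to k stays in the doubly slit plane, where Re Arccos takes neither
  the value 0 nor pi; it starts at pi / 2.\<close>

lemma Re_Arccos_range:
  assumes "Im k = 0 \<Longrightarrow> \<bar>Re k\<bar> < 1"
  shows "0 < Re (Arccos k)" "Re (Arccos k) < pi"
proof -
  have scaled: "Im (of_real t * k) = 0 \<Longrightarrow> \<bar>Re (of_real t * k)\<bar> < 1" if "t \<in> {0..1}" for t
  proof (cases "t = 0")
    case False
    assume "Im (of_real t * k) = 0"
    then have "\<bar>Re k\<bar> < 1" using assms False by simp
    then have "t * \<bar>Re k\<bar> \<le> 1 * \<bar>Re k\<bar>" using that by (intro mult_right_mono) auto
    then show ?thesis using \<open>\<bar>Re k\<bar> < 1\<close> that by (simp add: abs_mult)
  qed simp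
  define \<phi> where "\<phi> t = Re (Arccos (of_real t * k))" for t
  have cont: "continuous_on {0..1} \<phi>"
    unfolding \<phi>_def
    by (intro continuous_intros continuous_on_compose2[OF continuous_on_Arccos[of "{k. Im k = 0 \<longrightarrow> \<bar>Re k\<bar> < 1}"]])
      (use scaled in auto)
  have not: "\<phi> t \<noteq> 0 \<and> \<phi> t \<noteq> pi" if t: "t \<in> {0..1}" for t
  proof -
    define w where "w = Arccos (of_real t * k)"
    have "cos w = of_real t * k" by (simp add: w_def)
    then have R: "cos (Re w) * cosh (Im w) = Re (of_real t * k)" "- sin (Re w) * sinh (Im w) = Im (of_real t * k)"
      using Re_cos_cosh[of w] Im_cos_sinh[of w] by auto
    have "sin (Re w) \<noteq> 0 \<or> \<bar>cos (Re w)\<bar> \<noteq> 1"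
    proof (rule ccontr)
      assume "\<not> ?thesis"
      then have *: "sin (Re w) = 0" "\<bar>cos (Re w)\<bar> = 1" by auto
      then have "\<bar>Re (of_real t * k)\<bar> < 1" using scaled[OF t] R(2) by simp
      then have "\<bar>cos (Re w)\<bar> * cosh (Im w) < 1" unfolding R(1)[symmetric] by (simp add: abs_mult)
      then show False using * cosh_real_ge_1[of "Im w"] by simp
    qed
    then show ?thesis by (auto simp: \<phi>_def w_def)
  qed
  have start: "\<phi> 0 = pi / 2" by (simp add: \<phi>_def Arccos_0)
  have "\<phi> 1 > 0"
  proof (rule ccontr)
    assume "\<not> \<phi> 1 > 0"
    then obtain t where "0 \<le> t" "t \<le> 1" "\<phi> t = 0"
      using IVT2'[of \<phi> 1 0 0] start cont by auto
    then show False using not[of t] by auto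
  qed
  moreover have "\<phi> 1 < pi"
  proof (rule ccontr)
    assume "\<not> \<phi> 1 < pi"
    then obtain t where "0 \<le> t" "t \<le> 1" "\<phi> t = pi"
      using IVT'[of \<phi> 0 pi 1] start cont by auto
    then show False using not[of t] by auto
  qed
  ultimately show "0 < Re (Arccos k)" "Re (Arccos k) < pi" by (simp_all add: \<phi>_def)
qed

text \<open>Elliptic coordinates: \<open>\<bar>cos w \<plusminus> 1\<bar> = cosh (Im w) \<plusminus> cos (Re w)\<close>.\<close>

lemma Re_Arccos_eq_ellip:
  assumes "Im k = 0 \<Longrightarrow> \<bar>Re k\<bar> < 1"
  shows "Re (Arccos k) = ellip k"
proof -
  define w where "w = Arccos k"
  have k: "k = cos w" by (simp add: w_def)
  have sq: "(cmod (cos w + 1))\<^sup>2 = (cosh (Im w) + cos (Re w))\<^sup>2"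
    "(cmod (cos w - 1))\<^sup>2 = (cosh (Im w) - cos (Re w))\<^sup>2"
    unfolding cmod_power2
    by (simp_all add: Re_cos_cosh Im_cos_sinh power_mult_distrib sinh_square_eq sin_squared_eq power2_sum power2_diff algebra_simps)
  have "cmod (cos w + 1) = cosh (Im w) + cos (Re w)" "cmod (cos w - 1) = cosh (Im w) - cos (Re w)"
  proof -
    have "cosh (Im w) \<ge> 1" by (rule cosh_real_ge_1)
    then have "cosh (Im w) + cos (Re w) \<ge> 0" "cosh (Im w) - cos (Re w) \<ge> 0"
      using cos_le_one[of "Re w"] cos_ge_minus_one[of "Re w"] by linarith+
    then show "cmod (cos w + 1) = cosh (Im w) + cos (Re w)" "cmod (cos w - 1) = cosh (Im w) - cos (Re w)"
      using sq by (auto intro: power2_eq_imp_eq)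
  qed
  then have "ellip k = arccos (cos (Re w))" by (simp add: ellip_def k)
  then show ?thesis using Re_Arccos_range[OF assms] by (simp add: w_def arccos_cos)
qed

context gap_comb
begin

lemma sin_\<theta>_nz: "Im z > 0 \<Longrightarrow> sin (\<theta> z / of_nat n) \<noteq> 0"
  using Im_\<theta>[of z] n_pos by (intro sin_nonzero_Im_pos) simp

lemma K_shift: "K (w + of_nat n * of_real pi) = K w"
proof -
  have "sin ((w + of_nat n * of_real pi) / of_nat n) = - sin (w / of_nat n)"
    using n_pos by (simp add: add_divide_distrib sin_add del: sin_of_real)
  then show ?thesis by (simp add: K_def)
qed

lemma K_continuous: "sin (w / of_nat n) \<noteq> 0 \<Longrightarrow> isCont K w"
  unfolding K_def[abs_def] using n_pos by (intro continuous_intros) auto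

text \<open>The harmonic measure of the slits times pi, pulled back by \<theta>.
  \<open>ellip\<close> stands for Re Arccos because boundary values of \<open>K\<close> may lie on
  the cuts of Arccos.\<close>

definition V :: "complex \<Rightarrow> real" where "V z = ellip (K (\<theta> z))"

lemma V_continuous: "continuous_on upper_half V"
  unfolding V_def K_def
  by (intro continuous_on_compose2[OF continuous_ellip] continuous_intros
    holomorphic_on_imp_continuous_on[OF \<theta>_holomorphic]) (use n_pos sin_\<theta>_nz in auto)

text \<open>\<open>V\<close> is the real part of a holomorphic function of period 2 pi. A primitive
  of that function gains the same constant over every horizontal period.\<close>

lemma V_mean_const:
  obtains J where "\<And>y. y > 0 \<Longrightarrow> integral\<^sup>L lborel (\<lambda>x. indicator {0..2 * pi} x *\<^sub>R V (Complex x y)) = J"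
proof -
  define G where "G z = Arccos (K (\<theta> z))" for z
  have "(\<lambda>z. K (\<theta> z)) holomorphic_on upper_half"
    unfolding K_def by (intro holomorphic_intros \<theta>_holomorphic) (use n_pos sin_\<theta>_nz in auto)
  then have "Arccos \<circ> (\<lambda>z. K (\<theta> z)) holomorphic_on upper_half"
    by (rule holomorphic_on_compose) (use K_avoids in \<open>auto intro!: holomorphic_on_Arccos\<close>)
  then have "G holomorphic_on upper_half" by (simp add: o_def G_def[abs_def])
  then obtain \<Phi> where \<Phi>: "\<And>z. z \<in> upper_half \<Longrightarrow> (\<Phi> has_field_derivative G z) (at z within upper_half)"
    using holomorphic_convex_primitive'[OF convex_upper_half open_upper_half] by blast
  then have \<Phi>': "(\<Phi> has_field_derivative G z) (at z)" if "Im z > 0" for z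
    using that at_within_open[OF _ open_upper_half] by (metis mem_Collect_eq)
  have per: "G (z + 2 * of_real pi) = G z" if "Im z > 0" for z
    using that by (simp add: G_def \<theta>_shift K_shift)
  have "\<exists>d. \<forall>z\<in>upper_half. \<Phi> (z + 2 * of_real pi) - \<Phi> z = d"
  proof (rule has_field_derivative_zero_constant[OF convex_upper_half])
    fix z assume z: "z \<in> upper_half"
    have "((\<lambda>z. \<Phi> (z + 2 * of_real pi)) has_field_derivative G (z + 2 * of_real pi) * 1) (at z)"
      using z by (intro DERIV_chain2[OF \<Phi>']) (auto intro!: derivative_eq_intros)
    then have "((\<lambda>z. \<Phi> (z + 2 * of_real pi) - \<Phi> z) has_field_derivative G (z + 2 * of_real pi) * 1 - G z) (at z)"
      using z by (intro DERIV_diff \<Phi>') auto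
    then show "((\<lambda>z. \<Phi> (z + 2 * of_real pi) - \<Phi> z) has_field_derivative 0) (at z within upper_half)"
      using per z by (auto intro: DERIV_subset)
  qed
  then obtain d where d: "\<And>z. Im z > 0 \<Longrightarrow> \<Phi> (z + 2 * of_real pi) - \<Phi> z = d" by auto
  show ?thesis
  proof (rule that[of "Re d"])
    fix y :: real assume y: "y > 0"
    have V_eq: "V (Complex x y) = Re (G (Complex x y))" for x
      unfolding V_def G_def using y K_avoids[of "Complex x y"] by (intro Re_Arccos_eq_ellip[symmetric]) auto
    have "integral\<^sup>L lborel (\<lambda>x. indicator {0..2 * pi} x *\<^sub>R V (Complex x y)) =
        Re (\<Phi> (Complex (2 * pi) y)) - Re (\<Phi> (Complex 0 y))"
    proof (rule integral_FTC_atLeastAtMost)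
      fix x :: real
      have "((\<lambda>x. Complex x y) has_vector_derivative 1) (at x within {0..2 * pi})"
        unfolding has_vector_derivative_complex_iff by (auto intro!: derivative_eq_intros)
      then have "((\<Phi> \<circ> (\<lambda>x. Complex x y)) has_vector_derivative 1 * G (Complex x y)) (at x within {0..2 * pi})"
        using y by (intro field_vector_diff_chain_within has_field_derivative_at_within[OF \<Phi>']) auto
      then show "((\<lambda>x. Re (\<Phi> (Complex x y))) has_vector_derivative V (Complex x y)) (at x within {0..2 * pi})"
        by (simp add: V_eq o_def has_vector_derivative_complex_iff
            flip: has_real_derivative_iff_has_vector_derivative)
    next
      show "continuous_on {0..2 * pi} (\<lambda>x. V (Complex x y))"
        using y by (intro continuous_on_compose2[OF V_continuous]) (auto intro!: continuous_intros)
    qed simp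
    also have "\<dots> = Re d"
    proof -
      have "Complex 0 y + 2 * of_real pi = Complex (2 * pi) y" by (simp add: complex_eq_iff)
      then show ?thesis using d[of "Complex 0 y"] y by (metis complex.sel(2) minus_complex.sel(1))
    qed
    finally show "integral\<^sup>L lborel (\<lambda>x. indicator {0..2 * pi} x *\<^sub>R V (Complex x y)) = Re d" .
  qed
qed


lemma K_tendsto: "((\<lambda>z. K (\<theta> z)) \<longlongrightarrow> of_real (cos (s / 2))) to_i_infinity"
proof -
  have low: "sinh (Im w) \<le> cmod (sin w)" for w
  proof (rule power2_le_imp_le)
    have "(cmod (sin w))\<^sup>2 = (sin (Re w))\<^sup>2 * (cosh (Im w))\<^sup>2 + (cos (Re w))\<^sup>2 * (sinh (Im w))\<^sup>2"
      by (simp add: cmod_power2 Re_sin_cosh Im_sin_sinh power_mult_distrib)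
    also have "\<dots> = (sin (Re w))\<^sup>2 + (sinh (Im w))\<^sup>2"
      by (simp add: cosh_square_eq cos_squared_eq algebra_simps)
    finally show "(sinh (Im w))\<^sup>2 \<le> (cmod (sin w))\<^sup>2" by simp
  qed simp
  have "filterlim (\<lambda>z. 1 / real n * Im (\<theta> z)) at_top to_i_infinity"
    using n_pos by (intro filterlim_tendsto_pos_mult_at_top[OF tendsto_const] Im_\<theta>_at_top) auto
  then have "filterlim (\<lambda>z. sinh (1 / real n * Im (\<theta> z))) at_top to_i_infinity"
    by (rule filterlim_compose[OF sinh_real_at_top])
  then have "filterlim (\<lambda>z. cmod (sin (\<theta> z / of_nat n))) at_top to_i_infinity"
  proof (rule filterlim_at_top_mono)
    have "sinh (1 / real n * Im (\<theta> z)) \<le> cmod (sin (\<theta> z / of_nat n))" for z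
      using low[of "\<theta> z / of_nat n"] by simp
    then show "eventually (\<lambda>z. sinh (1 / real n * Im (\<theta> z)) \<le> cmod (sin (\<theta> z / of_nat n))) to_i_infinity"
      by (intro always_eventually allI)
  qed
  then have "filterlim (\<lambda>z. sin (\<theta> z / of_nat n)) at_infinity to_i_infinity"
    by (rule filterlim_norm_at_top_imp_at_infinity)
  then have inv: "((\<lambda>z. inverse (sin (\<theta> z / of_nat n))) \<longlongrightarrow> 0) to_i_infinity"
    by (rule filterlim_compose[OF tendsto_inverse_0])
  have "((\<lambda>z. of_real (cos (s / 2)) + of_real (1 - cos (s / 2)) * (inverse (sin (\<theta> z / of_nat n)))\<^sup>2)
      \<longlongrightarrow> of_real (cos (s / 2)) + of_real (1 - cos (s / 2)) * 0\<^sup>2) to_i_infinity"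
    by (intro tendsto_add tendsto_mult tendsto_power tendsto_const inv)
  moreover have "of_real (cos (s / 2)) + of_real (1 - cos (s / 2)) * (inverse (sin (\<theta> z / of_nat n)))\<^sup>2 = K (\<theta> z)" for z
    unfolding K_def by (simp only: divide_inverse power_inverse)
  ultimately show ?thesis by simp
qed

lemma V_measurable:
  assumes "y > 0"
  shows "(\<lambda>x. indicator {0..2 * pi} x *\<^sub>R V (Complex x y)) \<in> borel_measurable lborel"
  unfolding measurable_lborel2
  using assms
  by (intro borel_measurable_continuous_on_indicator continuous_on_compose2[OF V_continuous])
    (auto intro!: continuous_intros)

text \<open>Computed at infinite height, where \<open>V\<close> tends to arccos(cos(s/2)) = s/2; the
  period has length 2 pi.\<close>

lemma V_mean:
  assumes "y > 0" shows "integral\<^sup>L lborel (\<lambda>x. indicator {0..2 * pi} x *\<^sub>R V (Complex x y)) = pi * s"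
proof -
  obtain J where J: "\<And>y. y > 0 \<Longrightarrow> integral\<^sup>L lborel (\<lambda>x. indicator {0..2 * pi} x *\<^sub>R V (Complex x y)) = J"
    using V_mean_const by blast
  have "isCont ellip (of_real (cos (s / 2)))"
    using continuous_ellip by (simp add: continuous_on_eq_continuous_at)
  then have "(V \<longlongrightarrow> ellip (of_real (cos (s / 2)))) to_i_infinity"
    unfolding V_def[abs_def] by (rule isCont_tendsto_compose[OF _ K_tendsto])
  also have "ellip (of_real (cos (s / 2))) = s / 2"
    using s_pos s_less by (subst ellip_of_real) (auto simp: arccos_cos)
  finally have V: "(V \<longlongrightarrow> s / 2) to_i_infinity" .
  have lim: "(\<lambda>m. V (Complex x (real (Suc m)))) \<longlonglongrightarrow> s / 2" for x
  proof (rule filterlim_compose[OF V])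
    show "filterlim (\<lambda>m. Complex x (real (Suc m))) to_i_infinity sequentially"
      unfolding filterlim_filtercomap_iff o_def complex.sel
      by (rule filterlim_compose[OF filterlim_real_sequentially filterlim_Suc])
  qed
  have "(\<lambda>m. integral\<^sup>L lborel (\<lambda>x. indicator {0..2 * pi} x *\<^sub>R V (Complex x (real (Suc m)))))
      \<longlonglongrightarrow> integral\<^sup>L lborel (\<lambda>x. indicator {0..2 * pi} x *\<^sub>R (s / 2))"
  proof (rule integral_dominated_convergence)
    show "integrable lborel (\<lambda>x. indicator {0..2 * pi} x * pi)"
      by (intro integrable_mult_left integrable_real_indicator) auto
    show "(\<lambda>x. indicator {0..2 * pi} x *\<^sub>R V (Complex x (real (Suc m)))) \<in> borel_measurable lborel" for m
      by (rule V_measurable) simp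
    show "AE x in lborel. (\<lambda>m. indicator {0..2 * pi} x *\<^sub>R V (Complex x (real (Suc m))))
        \<longlonglongrightarrow> indicator {0..2 * pi} x *\<^sub>R (s / 2)"
      by (intro AE_I2 tendsto_intros lim)
    show "AE x in lborel. norm (indicator {0..2 * pi} x *\<^sub>R V (Complex x (real (Suc m)))) \<le> indicator {0..2 * pi} x * pi" for m
      by (intro AE_I2) (auto simp: V_def ellip_bounds split: split_indicator)
  qed auto
  moreover have "integral\<^sup>L lborel (\<lambda>x. indicator {0..2 * pi} x *\<^sub>R (s / 2)) = pi * s" by simp
  moreover have "(\<lambda>m. integral\<^sup>L lborel (\<lambda>x. indicator {0..2 * pi} x *\<^sub>R V (Complex x (real (Suc m))))) = (\<lambda>m. J)"
    using J by (simp add: fun_eq_iff)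
  ultimately have "J = pi * s" by (simp add: LIMSEQ_const_iff)
  then show ?thesis using J[OF assms] by simp
qed

text \<open>Boundary values of \<open>V\<close>, with filler 0 at the points where the existence of
  \<open>L\<close> is not established.\<close>

definition W :: "real \<Rightarrow> real" where
  "W x = (if q x = 1 \<or> q x = -1 then 0 else ellip (K (L x)))"

lemma W_bounds: "0 \<le> W x" "W x \<le> pi"
  by (auto simp: W_def ellip_bounds)

lemma sin_L_nz:
  assumes "q x \<noteq> 1" "q x \<noteq> -1" shows "sin (L x / of_nat n) \<noteq> 0"
proof
  assume "sin (L x / of_nat n) = 0"
  then obtain k :: int where "L x / of_nat n = of_real (of_int k * pi)"
    unfolding sin_eq_0 by auto
  then have L: "L x = of_real (of_int (k * int n) * pi)"
    using n_pos by (simp add: field_simps)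
  have "of_real (q x) = cos (complex_of_real (of_int (k * int n) * pi))"
    using cos_L[OF assms] L by simp
  then have "q x = cos (of_int (k * int n) * pi)"
    by (simp only: cos_of_real of_real_eq_iff)
  moreover have "sin (of_int (k * int n) * pi) = 0" unfolding sin_zero_iff_int2 by blast
  ultimately have "(q x)\<^sup>2 = 1" using sin_cos_squared_add[of "of_int (k * int n) * pi"] by simp
  then show False using assms by (simp add: power2_eq_1_iff)
qed

lemma V_tendsto_W:
  assumes "q x \<noteq> 1" "q x \<noteq> -1"
  shows "(\<lambda>m. V (Complex x (inverse (real (Suc m))))) \<longlonglongrightarrow> W x"
proof -
  have "isCont ellip (K (L x))"
    using continuous_ellip by (simp add: continuous_on_eq_continuous_at)
  moreover have "((\<lambda>y. K (\<theta> (Complex x y))) \<longlongrightarrow> K (L x)) (at_right 0)"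
    by (rule isCont_tendsto_compose[OF K_continuous[OF sin_L_nz[OF assms]] L_tendsto[OF assms]])
  ultimately have "((\<lambda>y. V (Complex x y)) \<longlongrightarrow> ellip (K (L x))) (at_right 0)"
    unfolding V_def by (rule isCont_tendsto_compose)
  moreover have "filterlim (\<lambda>m. inverse (real (Suc m))) (at_right 0) sequentially"
    unfolding filterlim_at using LIMSEQ_inverse_real_of_nat by auto
  ultimately have "(\<lambda>m. V (Complex x (inverse (real (Suc m))))) \<longlonglongrightarrow> ellip (K (L x))"
    by (rule filterlim_compose)
  then show ?thesis using assms by (simp add: W_def)
qed

lemma finite_unimodular: "finite {x\<in>{0..2 * pi}. q x = 1 \<or> q x = -1}"
proof -
  define R where "R = Q * Q - monom 1 n"
  have R: "poly R (cis t) = cis (real n * t) * of_real ((q t)\<^sup>2 - 1)" for t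
  proof -
    have "poly Q (cis t) ^ 2 = cis (real n * t) * complex_of_real (q t) ^ 2"
      by (simp add: Q_cis power_mult_distrib Complex.DeMoivre)
    then show ?thesis
      by (simp add: R_def poly_monom Complex.DeMoivre right_diff_distrib flip: power2_eq_square)
  qed
  obtain T where T: "card T = n" "\<And>t. t \<in> T \<Longrightarrow> q t = 0" using level_set[of 0] by auto
  then obtain t where "t \<in> T" using n_pos by (metis card.empty ex_in_conv not_one_le_zero)
  then have "R \<noteq> 0" using R[of t] T(2)[of t] by auto
  then have "finite {x. poly R x = 0}" by (rule poly_roots_finite)
  moreover have "cis ` {x\<in>{0..<2 * pi}. q x = 1 \<or> q x = -1} \<subseteq> {x. poly R x = 0}"
    using R by auto
  ultimately have "finite (cis ` {x\<in>{0..<2 * pi}. q x = 1 \<or> q x = -1})" by (rule finite_subset[rotated])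
  then have "finite {x\<in>{0..<2 * pi}. q x = 1 \<or> q x = -1}"
    by (rule finite_imageD) (auto intro: inj_on_subset[OF cis_inj_on])
  then have "finite (insert (2 * pi) {x\<in>{0..<2 * pi}. q x = 1 \<or> q x = -1})" by simp
  then show ?thesis by (rule finite_subset[rotated]) auto
qed

text \<open>Every horizontal mean is pi s, and dominated convergence with bound pi carries this to
  the boundary.\<close>

lemma W_mean:
  shows "integrable lborel (\<lambda>x. indicator {0..2 * pi} x *\<^sub>R W x)"
    and "integral\<^sup>L lborel (\<lambda>x. indicator {0..2 * pi} x *\<^sub>R W x) = pi * s"
proof -
  define B where "B = {x\<in>{0..2 * pi}. q x = 1 \<or> q x = -1}"
  define g where "g m x = indicator {0..2 * pi} x *\<^sub>R V (Complex x (inverse (real (Suc m))))" for m :: nat and x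
  define h where "h x = indicator {0..2 * pi} x *\<^sub>R W x" for x
  have fin: "finite B" unfolding B_def by (rule finite_unimodular)
  have g_meas: "g m \<in> borel_measurable lborel" for m
    unfolding g_def[abs_def] by (rule V_measurable) simp
  have lim: "(\<lambda>m. g m x) \<longlonglongrightarrow> h x" if "x \<notin> B" for x
  proof (cases "x \<in> {0..2 * pi}")
    case True
    then have "q x \<noteq> 1" "q x \<noteq> -1" using that by (auto simp: B_def)
    then show ?thesis unfolding g_def h_def by (intro tendsto_intros V_tendsto_W)
  qed (simp add: g_def h_def)
  have h_meas: "h \<in> borel_measurable lborel"
  proof (rule borel_measurable_LIMSEQ_real)
    \<comment> \<open>On \<open>B\<close> the cut-off functions are 0, which matches the filler
      value of \<open>W\<close>; convergence then holds everywhere and gives measurability.\<close>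
    show "(\<lambda>m. indicator (- B) x * g m x) \<longlonglongrightarrow> h x" for x
      using lim[of x] by (cases "x \<in> B") (auto simp: h_def W_def B_def)
    have "- B \<in> sets borel" using fin by (intro borel_comp borel_closed finite_imp_closed)
    then show "(\<lambda>x. indicator (- B) x * g m x) \<in> borel_measurable lborel" for m
      by (intro borel_measurable_times borel_measurable_indicator g_meas) simp
  qed
  have int: "integrable lborel (\<lambda>x. indicator {0..2 * pi} x * pi)"
    by (intro integrable_mult_left integrable_real_indicator) auto
  have "B \<in> null_sets lborel" using fin by (rule finite_imp_null_set_lborel)
  then have AE: "AE x in lborel. (\<lambda>m. g m x) \<longlonglongrightarrow> h x"
    by (rule AE_not_in[THEN eventually_mono]) (rule lim)
  have bd: "AE x in lborel. norm (g m x) \<le> indicator {0..2 * pi} x * pi" for m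
    by (intro AE_I2) (auto simp: g_def V_def ellip_bounds split: split_indicator)
  note dc = integrable_dominated_convergence[OF h_meas g_meas int AE bd]
    integral_dominated_convergence[OF h_meas g_meas int AE bd]
  have "integral\<^sup>L lborel (g m) = pi * s" for m
    unfolding g_def[abs_def] by (rule V_mean) simp
  then have "integral\<^sup>L lborel h = pi * s" using dc(2) by (simp add: LIMSEQ_const_iff)
  with dc(1) show "integrable lborel (\<lambda>x. indicator {0..2 * pi} x *\<^sub>R W x)"
    "integral\<^sup>L lborel (\<lambda>x. indicator {0..2 * pi} x *\<^sub>R W x) = pi * s"
    by (simp_all add: h_def[abs_def])
qed

end

section \<open>The measure of the gaps\<close>


context comb
begin

lemma cosh_Im_L:
  assumes "q x \<noteq> 1" "q x \<noteq> -1" "sin (Re (L x)) = 0" shows "\<bar>q x\<bar> \<ge> 1"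
proof -
  have "q x = cos (Re (L x)) * cosh (Im (L x))"
    using cos_L[OF assms(1,2)] Re_cos_cosh[of "L x"] by simp
  moreover have "\<bar>cos (Re (L x))\<bar> = 1"
    using assms(3) sin_cos_squared_add[of "Re (L x)"] by (auto simp: power2_eq_1_iff)
  ultimately show ?thesis using cosh_real_ge_1[of "Im (L x)"] by (simp add: abs_mult)
qed

lemma Im_L_zero:
  assumes "\<bar>q x\<bar> < 1" shows "Im (L x) = 0"
proof -
  have ne: "q x \<noteq> 1" "q x \<noteq> -1" using assms by auto
  then have c: "cos (L x) = of_real (q x)" by (intro cos_L)
  then have "sin (Re (L x)) * sinh (Im (L x)) = 0"
    using Im_cos_sinh[of "L x"] by simp
  moreover have "sin (Re (L x)) \<noteq> 0"
    using cosh_Im_L[OF ne] assms by linarith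
  ultimately show ?thesis by simp
qed

end

context gap_comb
begin

text \<open>The boundary value of \<theta> is real there, so sin^2 is at most 1 and K is at least 1,
  where \<open>ellip\<close> vanishes.\<close>

lemma W_zero: assumes "\<bar>q x\<bar> < 1" shows "W x = 0"
proof -
  define r where "r = Re (L x) / real n"
  have ne: "q x \<noteq> 1" "q x \<noteq> -1" using assms by auto
  have L: "L x / of_nat n = of_real r"
    using Im_L_zero[OF assms] by (simp add: r_def complex_eq_iff)
  have nz: "sin r \<noteq> 0"
    using sin_L_nz[OF ne] unfolding L by (simp add: sin_of_real)
  have "K (L x) = of_real (cos (s / 2) + (1 - cos (s / 2)) / (sin r)\<^sup>2)"
    unfolding K_def L by (simp add: sin_of_real)
  moreover have "(1 - cos (s / 2)) / (sin r)\<^sup>2 \<ge> 1 - cos (s / 2)"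
  proof -
    have "(sin r)\<^sup>2 \<le> 1" using abs_sin_le_one[of r] by (simp add: abs_square_le_1)
    then show ?thesis using nz cos_half_s(3) by (simp add: le_divide_eq)
  qed
  ultimately show ?thesis
    using ne ellip_ge_1[of "cos (s / 2) + (1 - cos (s / 2)) / (sin r)\<^sup>2"] by (simp add: W_def)
qed

text \<open>K <= -1 makes sin^2(L / n) negative, which happens only on the vertical lines that carry
  the slits.\<close>

lemma W_eq_pi:
  assumes "W x = pi" shows "q x \<noteq> 1" "q x \<noteq> -1" "\<exists>k::int. Re (L x) = of_int k * (real n * pi)"
proof -
  show ne: "q x \<noteq> 1" "q x \<noteq> -1" using assms by (auto simp: W_def)
  define w where "w = L x / of_nat n"
  define g where "g = cos (s / 2)"
  have g: "-1 < g" "g < 1" using cos_half_s by (simp_all add: g_def)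
  have "ellip (K (L x)) = pi" using assms ne by (simp add: W_def)
  then have K: "Im (K (L x)) = 0" "Re (K (L x)) \<le> -1" by (rule ellip_eq_pi)+
  define k where "k = Re (K (L x))"
  have "K (L x) = of_real k" using K by (simp add: k_def complex_eq_iff)
  then have eq: "of_real (1 - g) / (sin w)\<^sup>2 = complex_of_real (k - g)"
    by (simp add: K_def w_def g_def algebra_simps)
  have nz: "(sin w)\<^sup>2 \<noteq> 0" using sin_L_nz[OF ne] by (simp add: w_def)
  define t where "t = (1 - g) / (k - g)"
  have "t < 0" using K g by (simp add: t_def k_def divide_pos_neg)
  have "k - g \<noteq> 0" using K g by (simp add: k_def)
  then have "complex_of_real (k - g) \<noteq> 0" unfolding of_real_eq_0_iff .
  then have sq: "(sin w)\<^sup>2 = of_real t"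
    using eq nz by (simp add: t_def field_simps)
  have "Im w \<noteq> 0"
  proof
    assume "Im w = 0"
    then have "w = of_real (Re w)" by (simp add: complex_eq_iff)
    then have "of_real ((sin (Re w))\<^sup>2) = complex_of_real t"
      using sq by (metis of_real_power sin_of_real)
    then have "(sin (Re w))\<^sup>2 = t" by (simp only: of_real_eq_iff)
    then show False using \<open>t < 0\<close> zero_le_power2[of "sin (Re w)"] by linarith
  qed
  moreover have "Im w \<ge> 0" using Im_L[OF ne] by (simp add: w_def)
  ultimately have "Im w > 0" by simp
  have "(sin w)\<^sup>2 \<noteq> of_real ((cosh (Im w))\<^sup>2)"
  proof
    assume "(sin w)\<^sup>2 = of_real ((cosh (Im w))\<^sup>2)"
    then have "t = (cosh (Im w))\<^sup>2" unfolding sq by (simp only: of_real_eq_iff)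
    then show False using \<open>t < 0\<close> zero_le_power2[of "cosh (Im w)"] by linarith
  qed
  then obtain j :: int where "Re w = of_int j * pi"
    using sin_squared_real[OF _ \<open>Im w > 0\<close>] sq by auto
  then have "Re (L x) = of_int j * (real n * pi)"
    using n_pos by (simp add: w_def field_simps)
  then show "\<exists>k::int. Re (L x) = of_int k * (real n * pi)" by blast
qed

abbreviation outside :: "real set" where
  "outside \<equiv> {x \<in> {0..2 * pi}. \<bar>q x\<bar> > 1}"

lemma outside_sets: "outside \<in> sets lborel"
proof -
  have "open {x. \<bar>q x\<bar> > 1}"
    by (intro open_Collect_less continuous_intros q_continuous)
  moreover have "outside = {0..2 * pi} \<inter> {x. \<bar>q x\<bar> > 1}" by auto
  ultimately show ?thesis by simp
qed

lemma outside_finite: "emeasure lborel outside < \<infinity>"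
proof -
  have "emeasure lborel outside \<le> emeasure lborel {0..2 * pi}" by (intro emeasure_mono) auto
  also have "\<dots> < \<infinity>" by simp
  finally show ?thesis .
qed

text \<open>Loewner's lemma with its error term: \<open>W\<close> is at most pi on
  \<open>outside\<close> and vanishes on the rest of the period, so the excess of the measure over s
  is an integral of a nonnegative function.\<close>

lemma defect:
  defines "d \<equiv> \<lambda>x. indicator outside x * pi - indicator {0..2 * pi} x *\<^sub>R W x"
  shows "integrable lborel d" "0 \<le> d x" "integral\<^sup>L lborel d = pi * (measure lborel outside - s)"
proof -
  have i: "integrable lborel (\<lambda>x. indicator outside x * pi)"
    by (intro integrable_mult_left integrable_real_indicator outside_sets outside_finite)
  show "integrable lborel d"
    unfolding d_def by (intro Bochner_Integration.integrable_diff i W_mean)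
  show "0 \<le> d x"
  proof (cases "x \<in> {0..2 * pi}")
    case True
    then have ind: "indicator {0..2 * pi} x = (1::real)" by simp
    consider "\<bar>q x\<bar> > 1" | "\<bar>q x\<bar> < 1" | "q x = 1 \<or> q x = -1" by linarith
    then show ?thesis
    proof cases
      case 1
      then have "indicator outside x = (1::real)" using True by simp
      then show ?thesis unfolding d_def ind using W_bounds[of x] by simp
    next
      case 2
      then have "indicator outside x = (0::real)" by simp
      then show ?thesis unfolding d_def ind using W_zero[OF 2] by simp
    next
      case 3
      then have "indicator outside x = (0::real)" by auto
      moreover have "W x = 0" using 3 by (simp add: W_def)
      ultimately show ?thesis unfolding d_def by simp
    qed
  next
    case False
    then have "indicator {0..2 * pi} x = (0::real)" "indicator outside x = (0::real)" by auto
    then show ?thesis unfolding d_def by simp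
  qed
  have "integral\<^sup>L lborel d = integral\<^sup>L lborel (\<lambda>x. indicator outside x * pi) - pi * s"
    unfolding d_def by (subst Bochner_Integration.integral_diff[OF i W_mean(1)]) (simp only: W_mean(2))
  then show "integral\<^sup>L lborel d = pi * (measure lborel outside - s)"
    by (simp add: algebra_simps)
qed

lemma measure_outside: "measure lborel outside \<ge> s"
proof -
  have "0 \<le> pi * (measure lborel outside - s)"
    unfolding defect(3)[symmetric] by (intro Bochner_Integration.integral_nonneg defect(2))
  then have "0 \<le> measure lborel outside - s"
    using pi_gt_zero by (meson mult_pos_neg not_le)
  then show ?thesis by linarith
qed

lemma outside_saturated:
  assumes "measure lborel outside \<le> s"
  shows "AE x in lborel. x \<in> outside \<longrightarrow> W x = pi"
proof -
  have "measure lborel outside = s" using assms measure_outside by linarith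
  then have "integral\<^sup>L lborel (\<lambda>x. indicator outside x * pi - indicator {0..2 * pi} x *\<^sub>R W x) = 0"
    unfolding defect(3) by simp
  then have "AE x in lborel. indicator outside x * pi - indicator {0..2 * pi} x *\<^sub>R W x = 0"
    by (rule iffD1[OF integral_nonneg_eq_0_iff_AE[OF defect(1) AE_I2[OF defect(2)]]])
  then show ?thesis
  proof eventually_elim
    case (elim x)
    show ?case
    proof
      assume x: "x \<in> outside"
      then have "indicator outside x = (1::real)" "indicator {0..2 * pi} x = (1::real)" by simp_all
      then show "W x = pi" using elim by simp
    qed
  qed
qed

text \<open>Almost every outside point has W = pi and lies over a slit line; as Re L increases from
  0 to n pi over the period, only these two lines occur. By monotonicity a point with |q| < 1 before
  \<open>a\<close> or after \<open>b\<close> would have Re L equal to 0 or n pi, which is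
  impossible. Between \<open>a\<close> and \<open>b\<close> the outside set is open and null, hence
  empty.\<close>

lemma arc_of_equality:
  assumes meas: "measure lborel outside \<le> s"
  obtains a b where "0 \<le> a" "b \<le> 2 * pi" "b - a \<ge> 2 * pi - s" "\<And>t. t \<in> {a..b} \<Longrightarrow> \<bar>q t\<bar> \<le> 1"
proof -
  define A0 where "A0 = {x \<in> outside. W x = pi \<and> Re (L x) = 0}"
  define A1 where "A1 = {x \<in> outside. W x = pi \<and> Re (L x) = real n * pi}"
  \<comment> \<open>The inserted end points give supremum and infimum a meaning even if one of the
    sets is empty.\<close>
  define a where "a = Sup (insert 0 A0)"
  define b where "b = Inf (insert (2 * pi) A1)"
  have q0: "q 0 \<noteq> 1" "q 0 \<noteq> -1" using q0_gt_1 by auto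
  have "\<bar>q (2 * pi)\<bar> = \<bar>q 0\<bar>" using q_shift[of 0] by (simp add: abs_mult power_abs)
  then have q1: "q (2 * pi) \<noteq> 1" "q (2 * pi) \<noteq> -1" using q0_gt_1 by auto
  have L1: "Re (L (2 * pi)) = real n * pi" using L_shift[OF q0] Re_L0 by simp
  have "real n * pi > 0" using n_pos by simp
  have split: "x \<in> A0 \<or> x \<in> A1" if x: "x \<in> outside" "W x = pi" for x
  proof -
    obtain k :: int where k: "Re (L x) = of_int k * (real n * pi)" using W_eq_pi(3)[OF x(2)] by blast
    have "0 \<le> Re (L x)" using Re_L_mono[of 0 x] q0 W_eq_pi(1,2)[OF x(2)] Re_L0 x(1) by auto
    then have "k \<ge> 0" using \<open>real n * pi > 0\<close> unfolding k by (auto simp: zero_le_mult_iff)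
    moreover have "Re (L x) \<le> real n * pi"
      using Re_L_mono[of x "2 * pi"] q1 W_eq_pi(1,2)[OF x(2)] L1 x(1) by auto
    then have "of_int k * (real n * pi) \<le> 1 * (real n * pi)" unfolding k by simp
    then have "real_of_int k \<le> 1" by (rule mult_right_le_imp_le) (use n_pos in simp)
    ultimately have "k = 0 \<or> k = 1" by linarith
    then show ?thesis using x k by (auto simp: A0_def A1_def)
  qed
  have bnd: "A0 \<subseteq> {0..2 * pi}" "A1 \<subseteq> {0..2 * pi}" by (auto simp: A0_def A1_def)
  have bdd: "bdd_above (insert 0 A0)" "bdd_below (insert (2 * pi) A1)"
    using bdd_above_mono[OF bdd_above_Icc bnd(1)] bdd_below_mono[OF bdd_below_Icc bnd(2)] by auto
  have left: "\<bar>q u\<bar> \<ge> 1" if u: "0 \<le> u" "u < a" for u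
  proof (rule ccontr)
    assume *: "\<not> \<bar>q u\<bar> \<ge> 1"
    then have ne: "q u \<noteq> 1" "q u \<noteq> -1" by auto
    obtain x where x: "x \<in> insert 0 A0" "u < x"
      using less_cSupD[of "insert 0 A0" u] u(2) by (auto simp: a_def)
    then have "x \<in> A0" using u by auto
    then have x': "W x = pi" "Re (L x) = 0" by (auto simp: A0_def)
    have "Re (L u) = 0"
      using Re_L_mono[of 0 u] Re_L_mono[of u x] u x q0 ne W_eq_pi(1,2)[OF x'(1)] x'(2) Re_L0 by auto
    then show False using cosh_Im_L[OF ne] * by simp
  qed
  have right: "\<bar>q u\<bar> \<ge> 1" if u: "b < u" "u \<le> 2 * pi" for u
  proof (rule ccontr)
    assume *: "\<not> \<bar>q u\<bar> \<ge> 1"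
    then have ne: "q u \<noteq> 1" "q u \<noteq> -1" by auto
    obtain x where x: "x \<in> insert (2 * pi) A1" "x < u"
      using cInf_lessD[of "insert (2 * pi) A1" u] u(1) by (auto simp: b_def)
    then have "x \<in> A1" using u by auto
    then have x': "W x = pi" "Re (L x) = real n * pi" by (auto simp: A1_def)
    have "Re (L u) = real n * pi"
      using Re_L_mono[of x u] Re_L_mono[of u "2 * pi"] u x q1 ne W_eq_pi(1,2)[OF x'(1)] x'(2) L1 by auto
    then show False using cosh_Im_L[OF ne] * by (simp add: sin_npi)
  qed
  have a0: "0 \<le> a" unfolding a_def by (intro cSup_upper bdd) simp
  have b1: "b \<le> 2 * pi" unfolding b_def by (intro cInf_lower bdd) simp
  have "x \<le> y" if "x \<in> insert 0 A0" "y \<in> insert (2 * pi) A1" for x y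
  proof (rule ccontr)
    assume "\<not> x \<le> y"
    then have xy: "y < x" "x \<in> A0" "y \<in> A1" using that bnd by (auto dest: subsetD)
    then have "W x = pi" "W y = pi" "Re (L x) = 0" "Re (L y) = real n * pi" by (auto simp: A0_def A1_def)
    then have "real n * pi \<le> 0"
      using Re_L_mono[of y x] xy(1) W_eq_pi(1,2)[of x] W_eq_pi(1,2)[of y] by simp
    then show False using \<open>real n * pi > 0\<close> by linarith
  qed
  then have ab: "a \<le> b"
    unfolding a_def b_def by (intro cSup_least cInf_greatest) auto
  have size: "a + (2 * pi - b) \<le> s"
  proof -
    define B where "B = {x\<in>{0..2 * pi}. q x = 1 \<or> q x = -1}"
    have B: "finite B" unfolding B_def by (rule finite_unimodular)
    then have B0: "B \<in> null_sets lborel" by (rule finite_imp_null_set_lborel)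
    have sub: "{0..<a} \<union> {b<..2 * pi} \<subseteq> outside \<union> B"
    proof
      fix u assume u: "u \<in> {0..<a} \<union> {b<..2 * pi}"
      then have u': "u \<in> {0..2 * pi}" using a0 b1 ab by auto
      have "\<bar>q u\<bar> \<ge> 1" using u left[of u] right[of u] by auto
      then consider "\<bar>q u\<bar> > 1" | "q u = 1 \<or> q u = -1" by linarith
      then show "u \<in> outside \<union> B" by cases (use u' in \<open>auto simp: B_def\<close>)
    qed
    have m: "measure lborel (outside \<union> B) = measure lborel outside"
      using emeasure_Un_null_set[OF outside_sets B0] unfolding measure_def by (simp only:)
    have fin: "emeasure lborel (outside \<union> B) < \<infinity>"
      using outside_finite unfolding emeasure_Un_null_set[OF outside_sets B0] .
    have "outside \<union> B \<in> fmeasurable lborel"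
      by (rule fmeasurableI[OF sets.Un[OF outside_sets null_setsD2[OF B0]] fin])
    then have "measure lborel ({0..<a} \<union> {b<..2 * pi}) \<le> measure lborel (outside \<union> B)"
      by (intro measure_mono_fmeasurable sub) auto
    also note m
    also have "measure lborel ({0..<a} \<union> {b<..2 * pi}) = measure lborel {0..<a} + measure lborel {b<..2 * pi}"
      using ab a0 b1 by (intro measure_Union) auto
    finally show ?thesis using a0 b1 meas by simp
  qed
  then have lt: "a < b" using s_less by linarith
  have "{x. \<bar>q x\<bar> > 1} \<inter> {a<..<b} = {}"
  proof (rule ccontr)
    define U where "U = {x. \<bar>q x\<bar> > 1} \<inter> {a<..<b}"
    assume "\<not> ?thesis"
    then have "U \<noteq> {}" by (simp add: U_def)
    moreover have "open U"
      unfolding U_def by (intro open_Int open_Collect_less continuous_intros q_continuous open_greaterThanLessThan)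
    ultimately have "\<not> negligible U" using open_not_negligible by blast
    moreover have "AE x in lborel. x \<notin> U"
      using outside_saturated[OF meas]
    proof eventually_elim
      case (elim x)
      show ?case
      proof
        assume x: "x \<in> U"
        then have "x \<in> outside" using a0 b1 by (auto simp: U_def)
        then have "x \<in> A0 \<or> x \<in> A1" using split elim by blast
        then have "x \<le> a \<or> b \<le> x"
          unfolding a_def b_def using bdd by (auto intro: cSup_upper cInf_lower)
        then show False using x by (auto simp: U_def)
      qed
    qed
    then have "AE x in lebesgue. x \<notin> U" by (rule AE_completion)
    then have "negligible U"
      unfolding negligible_iff_null_sets using \<open>open U\<close> AE_iff_null_sets[of U lebesgue] by simp
    ultimately show False by blast
  qed
  then have open_bd: "{a<..<b} \<subseteq> {t. \<bar>q t\<bar> \<le> 1}"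
    unfolding disjoint_iff by (force simp: not_less)
  have "closed {t. \<bar>q t\<bar> \<le> 1}"
    by (intro closed_Collect_le continuous_intros q_continuous)
  then have "{a..b} \<subseteq> {t. \<bar>q t\<bar> \<le> 1}"
    using closure_minimal[OF open_bd] lt by simp
  then show ?thesis using a0 b1 size by (intro that[of a b]) auto
qed

end

context alternating
begin

text \<open>As q 0 > 1, the real part of the boundary value at 0 is a multiple of 2 pi; subtracting
  it from \<theta> leaves the cosine unchanged.\<close>

lemma ex_gap_comb:
  assumes "0 < s" "s < 2 * pi" and q0: "poly (chebyshev n) (1 / cos (s / 4)) \<le> q 0" "q 0 > 1"
  obtains \<theta> where "gap_comb n Q q \<tau> \<theta> s"
proof -
  obtain \<theta> where \<theta>: "\<theta> holomorphic_on upper_half" "\<And>z. Im z > 0 \<Longrightarrow> f z = cos (\<theta> z)"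
    "\<And>z. Im z > 0 \<Longrightarrow> Im (\<theta> z) > 0"
    using ex_theta by blast
  then interpret C: comb n Q q \<tau> \<theta> by unfold_locales auto
  define r where "r = Re (C.L 0)"
  have "cos r = 1" using C.L_of_q_gt_1(1)[OF q0(2)] by (simp add: r_def)
  then obtain k :: int where k: "r = of_int k * (2 * pi)" by (auto simp: cos_one_2pi_int)
  define \<theta>' where "\<theta>' z = \<theta> z - of_real r" for z
  have "cos (\<theta>' z) = cos (\<theta> z)" for z
    unfolding complex_cos_eq \<theta>'_def
    by (rule bexI[of _ "- of_int k"]) (auto simp: k algebra_simps)
  moreover have "\<theta>' holomorphic_on upper_half"
    unfolding \<theta>'_def[abs_def] by (intro holomorphic_intros \<theta>(1))
  moreover have "Im (\<theta>' z) = Im (\<theta> z)" for z by (simp add: \<theta>'_def)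
  ultimately interpret C': comb n Q q \<tau> \<theta>'
    by unfold_locales (use \<theta> in simp_all)
  have "((\<lambda>y. \<theta>' (Complex 0 y)) \<longlongrightarrow> C.L 0 - of_real r) (at_right 0)"
    unfolding \<theta>'_def using q0(2) by (intro tendsto_diff tendsto_const C.L_tendsto) auto
  moreover have "((\<lambda>y. \<theta>' (Complex 0 y)) \<longlongrightarrow> C'.L 0) (at_right 0)"
    using q0(2) by (intro C'.L_tendsto) auto
  ultimately have "C'.L 0 = C.L 0 - of_real r"
    using tendsto_unique trivial_limit_at_right_real by blast
  then have "Re (C'.L 0) = 0" by (simp add: r_def)
  then have "gap_comb n Q q \<tau> \<theta>' s"
    by unfold_locales (use assms in auto)
  then show ?thesis by (rule that)
qed

end

section \<open>The equality case\<close>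


lemma chebyshev_minus: "poly (chebyshev n) (- x) = (-1) ^ n * poly (chebyshev n) x"
  by (induction n rule: induct_nat_012)
    (simp_all add: chebyshev_0 chebyshev_1 chebyshev_Suc_Suc algebra_simps)

text \<open>The polynomial is a cosine on [-1, 1], an increasing cosh beyond 1, and even or
  odd.\<close>

lemma abs_chebyshev_le:
  assumes "\<bar>x\<bar> \<le> X" "1 \<le> X" shows "\<bar>poly (chebyshev n) x\<bar> \<le> poly (chebyshev n) X"
proof -
  have X: "poly (chebyshev n) X = cosh (real n * arcosh X)"
    using chebyshev_cosh[of n "arcosh X"] assms(2) by (simp add: cosh_arcosh_real)
  have "\<bar>poly (chebyshev n) (- x)\<bar> = \<bar>poly (chebyshev n) x\<bar>"
    by (simp add: chebyshev_minus abs_mult power_abs)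
  then have "\<bar>poly (chebyshev n) x\<bar> = \<bar>poly (chebyshev n) \<bar>x\<bar>\<bar>"
    by (cases "x \<ge> 0") (simp_all add: abs_of_neg)
  also have "\<dots> \<le> poly (chebyshev n) X"
  proof (cases "\<bar>x\<bar> \<le> 1")
    case True
    have "\<bar>poly (chebyshev n) \<bar>x\<bar>\<bar> = \<bar>cos (real n * arccos \<bar>x\<bar>)\<bar>"
      using chebyshev_cos[of n "arccos \<bar>x\<bar>"] True by simp
    also have "\<dots> \<le> 1" by (rule abs_cos_le_one)
    finally show ?thesis using X cosh_real_ge_1[of "real n * arcosh X"] by linarith
  next
    case False
    then have x1: "\<bar>x\<bar> \<ge> 1" by simp
    have "arcosh \<bar>x\<bar> \<le> arcosh X"
      using x1 assms by (cases "\<bar>x\<bar> = X") (auto intro!: less_imp_le[OF arcosh_real_strict_mono])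
    then have "real n * arcosh \<bar>x\<bar> \<le> real n * arcosh X" by (intro mult_left_mono) auto
    moreover have "0 \<le> real n * arcosh \<bar>x\<bar>" using x1 by simp
    ultimately have "cosh (real n * arcosh \<bar>x\<bar>) \<le> cosh (real n * arcosh X)"
      by (subst cosh_real_nonneg_le_iff) auto
    moreover have "poly (chebyshev n) \<bar>x\<bar> = cosh (real n * arcosh \<bar>x\<bar>)"
      using chebyshev_cosh[of n "arcosh \<bar>x\<bar>"] x1 by (simp add: cosh_arcosh_real)
    ultimately show ?thesis using X by simp
  qed
  finally show ?thesis .
qed

text \<open>Interpolation at 0 writes \<open>F 0 - p 0\<close> as a sum whose terms are nonnegative,
  because the Lagrange functions alternate in sign there. As \<open>F 0\<close> is at most the
  Chebyshev value, all terms vanish, so \<open>p\<close> and \<open>F\<close> agree at n + 1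
  nodes.\<close>

lemma extremal_unique:
  fixes p :: "real \<Rightarrow> real"
  assumes n: "n \<ge> 1" and p: "semitrig n (\<lambda>t. of_real (p t))"
    and bd: "\<And>t. t \<in> {m + s / 2..m + 2 * pi - s / 2} \<Longrightarrow> \<bar>p t\<bar> \<le> 1"
    and s: "0 < s" "s < 2 * pi" and m: "m + s / 2 > 0" "m - s / 2 < 0"
    and p0: "poly (chebyshev n) (1 / cos (s / 4)) \<le> p 0"
  shows "p t = poly (chebyshev n) (1 / cos (s / 4) * cos ((t - m) / 2))"
    and "\<exists>T. T \<subseteq> {m + s / 2..m + 2 * pi - s / 2} \<and> card T = Suc n \<and> (\<forall>t\<in>T. \<bar>p t\<bar> = 1)"
proof -
  define c where "c = cos (s / 4)"
  have c: "0 < c" "c < 1"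
    using s cos_gt_zero_pi[of "s / 4"] cos_monotone_0_pi[of 0 "s / 4"] by (auto simp: c_def)
  define F where "F t = poly (chebyshev n) (1 / c * cos ((t - m) / 2))" for t
  \<comment> \<open>\<open>y\<close> lists the extremal points of the Chebyshev polynomial, and
    \<open>\<sigma>\<close> their preimages under t -> cos((t - m) / 2) / c; the arc is where this
    map takes values in [-1, 1].\<close>
  define y where "y j = cos (real j * pi / real n)" for j
  define \<sigma> where "\<sigma> j = m + 2 * arccos (c * y j)" for j
  have F: "semitrig n (\<lambda>t. of_real (F t))" unfolding F_def by (rule semitrig_chebyshev)
  have y: "\<bar>y j\<bar> \<le> 1" for j unfolding y_def by (rule abs_cos_le_one)
  have cy: "\<bar>c * y j\<bar> \<le> c" for j
    using mult_left_mono[OF y[of j], of c] c by (simp add: abs_mult)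
  have cy1: "-1 \<le> c * y j" "c * y j \<le> 1" "-c \<le> c * y j" "c * y j \<le> c" for j
    using cy[of j] c unfolding abs_le_iff by linarith+
  have arc_c: "arccos c = s / 4" unfolding c_def using s by (intro arccos_cos) auto
  have \<sigma>_in: "\<sigma> j \<in> {m + s / 2..m + 2 * pi - s / 2}" for j
  proof -
    have "arccos c \<le> arccos (c * y j)" using cy1[of j] c by (intro arccos_le_arccos) linarith+
    moreover have "arccos (c * y j) \<le> arccos (- c)" using cy1[of j] c by (intro arccos_le_arccos) linarith+
    moreover have "arccos (- c) = pi - arccos c" using c by (intro arccos_minus) auto
    ultimately show ?thesis unfolding \<sigma>_def arc_c by auto
  qed
  have \<sigma>_in': "\<sigma> j \<in> {0<..<2 * pi}" for j
    using m \<sigma>_in[of j] unfolding atLeastAtMost_iff greaterThanLessThan_iff by (intro conjI) linarith+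
  have \<sigma>_mono: "strict_mono_on {..n} \<sigma>"
  proof (rule strict_mono_onI)
    fix i j assume ij: "i \<in> {..n}" "j \<in> {..n}" "i < j"
    have "y j < y i"
      unfolding y_def using ij n by (intro cos_monotone_0_pi) (auto simp: field_simps)
    then have "c * y j < c * y i" using c by simp
    then have "arccos (c * y i) < arccos (c * y j)"
      by (intro arccos_less_arccos cy1)
    then show "\<sigma> i < \<sigma> j" by (simp add: \<sigma>_def)
  qed
  then have inj: "inj_on \<sigma> {..n}" by (rule strict_mono_on_imp_inj_on)
  have F\<sigma>: "F (\<sigma> j) = (-1) ^ j" for j
  proof -
    have "F (\<sigma> j) = poly (chebyshev n) (1 / c * cos (arccos (c * y j)))" by (simp add: F_def \<sigma>_def)
    also have "\<dots> = poly (chebyshev n) (y j)" using c by (simp add: cos_arccos[OF cy1(1,2)])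
    also have "\<dots> = cos (real j * pi)" using n by (simp add: y_def chebyshev_cos)
    finally show ?thesis by (simp add: cos_npi)
  qed
  define lg where "lg j = lagrange_sin n \<sigma> j 0" for j
  have range: "\<And>i. i \<le> n \<Longrightarrow> \<sigma> i \<in> {0..<2 * pi}" using \<sigma>_in' by (simp add: less_imp_le)
  have interp: "f 0 = (\<Sum>j\<le>n. f (\<sigma> j) * lg j)" if "semitrig n (\<lambda>t. of_real (f t))" for f
  proof -
    have "complex_of_real (f 0) = of_real (\<Sum>j\<le>n. f (\<sigma> j) * lg j)"
      using semitrig_interpolation[OF that inj range, of 0] by (simp add: lg_def)
    then show ?thesis by (simp only: of_real_eq_iff)
  qed
  have summand: "0 \<le> ((-1) ^ j - p (\<sigma> j)) * lg j" and summand0: "((-1) ^ j - p (\<sigma> j)) * lg j = 0 \<Longrightarrow> p (\<sigma> j) = (-1) ^ j"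
    if "j \<le> n" for j
  proof -
    have pos: "(-1) ^ j * lg j > 0"
      unfolding lg_def by (rule lagrange_sign_at_0[OF \<sigma>_mono \<sigma>_in' that])
    have eq: "((-1) ^ j - p (\<sigma> j)) * lg j = (1 - (-1) ^ j * p (\<sigma> j)) * ((-1) ^ j * lg j)"
      by (cases "even j") (simp_all add: algebra_simps)
    have "(-1) ^ j * p (\<sigma> j) \<le> 1"
      using bd[OF \<sigma>_in[of j]] by (cases "even j") (auto simp: abs_le_iff)
    then show "0 \<le> ((-1) ^ j - p (\<sigma> j)) * lg j" unfolding eq using pos by simp
    show "p (\<sigma> j) = (-1) ^ j" if "((-1) ^ j - p (\<sigma> j)) * lg j = 0"
      using that pos by auto
  qed
  have "(\<Sum>j\<le>n. ((-1) ^ j - p (\<sigma> j)) * lg j) = F 0 - p 0"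
    unfolding interp[OF F] interp[OF p] F\<sigma> by (simp add: sum_subtractf left_diff_distrib)
  also have "\<dots> \<le> 0"
  proof -
    have "\<bar>1 / c * cos ((0 - m) / 2)\<bar> \<le> 1 / c"
      using c abs_cos_le_one[of "(0 - m) / 2"] by (simp add: abs_mult divide_right_mono)
    then have "\<bar>F 0\<bar> \<le> poly (chebyshev n) (1 / c)"
      unfolding F_def using c by (intro abs_chebyshev_le) auto
    then show ?thesis using p0 by (simp add: c_def)
  qed
  finally have "(\<Sum>j\<le>n. ((-1) ^ j - p (\<sigma> j)) * lg j) = 0"
    using summand by (intro antisym sum_nonneg) auto
  then have "\<forall>j\<in>{..n}. ((-1) ^ j - p (\<sigma> j)) * lg j = 0"
    using summand by (subst (asm) sum_nonneg_eq_0_iff) auto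
  then have p\<sigma>: "p (\<sigma> j) = (-1) ^ j" if "j \<le> n" for j using summand0[OF that] that by blast
  have card: "card (\<sigma> ` {..n}) = Suc n" using inj by (simp add: card_image)
  have "complex_of_real (p t) = of_real (F t)"
    by (rule semitrig_eq[OF p F, of "\<sigma> ` {..n}"]) (use range card p\<sigma> F\<sigma> in auto)
  then show "p t = poly (chebyshev n) (1 / cos (s / 4) * cos ((t - m) / 2))"
    by (simp only: of_real_eq_iff F_def c_def)
  show "\<exists>T. T \<subseteq> {m + s / 2..m + 2 * pi - s / 2} \<and> card T = Suc n \<and> (\<forall>t\<in>T. \<bar>p t\<bar> = 1)"
  proof (intro exI[of _ "\<sigma> ` {..n}"] conjI card ballI)
    show "\<sigma> ` {..n} \<subseteq> {m + s / 2..m + 2 * pi - s / 2}" using \<sigma>_in by blast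
    show "\<bar>p t\<bar> = 1" if "t \<in> \<sigma> ` {..n}" for t using that p\<sigma> by (auto simp: power_abs)
  qed
qed

text \<open>The extremal \<open>q\<close> serves to show that {|P| <= 1} contains an arc of length
  at least 2 pi - s. On that arc the interpolation argument is applied to \<open>P\<close> itself,
  through the real part of a rotated version of it.\<close>

lemma remez_core:
  fixes P :: "complex poly"
  assumes n: "n \<ge> 1" and deg: "degree P \<le> n" and s: "0 < s" "s < 2 * pi"
    and meas: "measure lebesgue {t \<in> {0..2 * pi}. cmod (poly P (cis t)) \<le> 1} \<ge> 2 * pi - s"
    and big: "poly (chebyshev n) (1 / cos (s / 4)) \<le> cmod (poly P 1)"
  shows "\<exists>c0 c1 :: real. \<forall>z :: real. poly P (cis z) = cis (real n * z / 2 + c1) *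
    complex_of_real (poly (chebyshev n) (1 / cos (s / 4) * cos ((z - c0) / 2)))"
proof -
  define M where "M = poly (chebyshev n) (1 / cos (s / 4))"
  have c: "0 < cos (s / 4)" "cos (s / 4) < 1"
    using s cos_gt_zero_pi[of "s / 4"] cos_monotone_0_pi[of 0 "s / 4"] by auto
  have M: "M > 1"
  proof -
    have c1: "1 / cos (s / 4) > 1" using c by simp
    then have "arcosh (1 / cos (s / 4)) > 0"
      using arcosh_real_gt_1_iff[of "1 / cos (s / 4)"] by linarith
    then have "cosh (real n * arcosh (1 / cos (s / 4))) > 1" using n by (intro cosh_real_gt_1) simp
    then show ?thesis
      using chebyshev_cosh[of n "arcosh (1 / cos (s / 4))"] c1 by (simp add: M_def cosh_arcosh_real)
  qed
  \<comment> \<open>The unimodular factor makes \<open>G 0\<close> positive, so that passing to the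
    real part loses nothing at 0.\<close>
  define u where "u = cnj (sgn (poly P 1))"
  have P1: "poly P 1 \<noteq> 0" using big M by (auto simp: M_def)
  then have u: "cmod u = 1" by (simp add: u_def norm_sgn)
  define G where "G t = u * (cis (- (real n * t / 2)) * poly P (cis t))" for t
  have G: "semitrig n G"
    unfolding G_def by (intro semitrig_cmult semitrigI[of P] deg) simp
  have normG: "cmod (G t) = cmod (poly P (cis t))" for t by (simp add: G_def norm_mult u)
  define p where "p t = Re (G t)" for t
  have p: "semitrig n (\<lambda>t. of_real (p t))" unfolding p_def by (rule semitrig_Re[OF G])
  have "cnj (sgn w) * w = of_real (cmod w)" for w
  proof -
    have "cnj (sgn w) * w = (w * cnj w) / of_real (cmod w)" by (simp add: sgn_eq)
    also have "\<dots> = of_real ((cmod w)\<^sup>2 / cmod w)" by (simp only: of_real_divide complex_norm_square)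
    also have "(cmod w)\<^sup>2 / cmod w = cmod w" by (simp add: power2_eq_square)
    finally show ?thesis .
  qed
  then have "G 0 = of_real (cmod (poly P 1))" by (simp add: G_def u_def)
  then have p0: "p 0 = cmod (poly P 1)" by (simp add: p_def)
  define E where "E = {t \<in> {0..2 * pi}. cmod (poly P (cis t)) \<le> 1}"
  have contP: "continuous_on S (\<lambda>t. cmod (poly P (cis t)))" for S
    by (intro continuous_intros)
  have E_eq: "E = {0..2 * pi} \<inter> {t. cmod (poly P (cis t)) \<le> 1}" by (auto simp: E_def)
  have E: "compact E"
    unfolding E_eq by (intro compact_Int_closed compact_Icc closed_Collect_le contP continuous_on_const)
  have Eb: "E \<in> sets borel" using E by (simp add: borel_compact)
  have E_sub: "E \<subseteq> {0<..<2 * pi}"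
  proof
    fix t assume t: "t \<in> E"
    have "cis t \<noteq> 1" using t big M by (auto simp: E_def M_def)
    then have "t \<noteq> 0" "t \<noteq> 2 * pi" by auto
    then show "t \<in> {0<..<2 * pi}" using t by (auto simp: E_def)
  qed
  have mE: "measure lborel E \<ge> 2 * pi - s"
    using meas Eb unfolding E_def[symmetric] by (simp add: measure_completion)
  have inf: "infinite E"
  proof
    assume "finite E"
    then have "measure lborel E = 0"
      using finite_imp_null_set_lborel[of E] by (simp add: measure_eq_0_null_sets)
    then show False using mE s by simp
  qed
  have adm: "admissible n E p"
    unfolding admissible_def
  proof (intro conjI p ballI)
    fix t assume "t \<in> E"
    then show "\<bar>p t\<bar> \<le> 1"
      using abs_Re_le_cmod[of "G t"] by (auto simp: p_def normG E_def)
  qed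
  have E_sub': "E \<subseteq> {0..<2 * pi}" using E_sub by auto
  obtain q where q: "admissible n E q" "\<And>p. admissible n E p \<Longrightarrow> p 0 \<le> q 0"
    using extremal_exists[OF inf E_sub'] by blast
  have ne: "E \<noteq> {}" using inf by auto
  have "\<exists>\<tau>. (\<forall>i<n. \<tau> i < \<tau> (Suc i)) \<and> (\<forall>i\<le>n. \<tau> i \<in> E \<and> q (\<tau> i) = (-1) ^ i)"
    by (rule extremal_alternates[OF E ne E_sub q(1)]) (rule q(2))
  then obtain \<tau> where \<tau>: "\<forall>i<n. \<tau> i < \<tau> (Suc i)" "\<forall>i\<le>n. \<tau> i \<in> E \<and> q (\<tau> i) = (-1) ^ i"
    by blast
  obtain Q where Q: "degree Q \<le> n" "\<And>t. of_real (q t) = cis (- (real n * t / 2)) * poly Q (cis t)"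
    using q(1) unfolding admissible_def semitrig_def by blast
  interpret A: alternating n Q q \<tau>
    by unfold_locales (use n Q \<tau> E_sub in blast)+
  have q0: "M \<le> q 0" using q(2)[OF adm] p0 big by (simp add: M_def)
  have q01: "q 0 > 1" using q0 M by linarith
  obtain \<theta> where "gap_comb n Q q \<tau> \<theta> s"
    using A.ex_gap_comb[OF s q0[unfolded M_def] q01] by blast
  then interpret C: gap_comb n Q q \<tau> \<theta> s .
  define I where "I = {x \<in> {0..2 * pi}. \<bar>q x\<bar> \<le> 1}"
  have I_eq: "I = {0..2 * pi} \<inter> {x. \<bar>q x\<bar> \<le> 1}" by (auto simp: I_def)
  have "compact I"
    unfolding I_eq by (intro compact_Int_closed compact_Icc closed_Collect_le continuous_intros A.q_continuous)
  then have Ib: "I \<in> sets lborel" by (simp add: borel_compact)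
  have fin: "emeasure lborel X \<noteq> \<infinity>" if "X \<subseteq> {0..2 * pi}" for X
  proof -
    have "emeasure lborel X \<le> emeasure lborel {0..2 * pi}" by (rule emeasure_mono[OF that]) simp
    also have "\<dots> < \<infinity>" by simp
    finally show ?thesis by simp
  qed
  have "measure lborel (C.outside \<union> I) = measure lborel C.outside + measure lborel I"
    by (intro measure_Union fin C.outside_sets Ib) (auto simp: I_def)
  moreover have "C.outside \<union> I = {0..2 * pi}" by (auto simp: I_def)
  ultimately have total: "measure lborel C.outside + measure lborel I = 2 * pi" by simp
  have I2: "I \<subseteq> {0..2 * pi}" by (auto simp: I_def)
  have I_fm: "I \<in> fmeasurable lborel"
    using fin[OF I2] by (intro fmeasurableI Ib) (simp add: less_top[symmetric])
  have EI: "E \<subseteq> I" using q(1) by (auto simp: E_def I_def admissible_def)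
  then have "measure lborel E \<le> measure lborel I"
    using Eb by (intro measure_mono_fmeasurable I_fm) simp_all
  then have out: "measure lborel C.outside \<le> s" using total mE by linarith
  obtain a b where ab: "0 \<le> a" "b \<le> 2 * pi" "b - a \<ge> 2 * pi - s" "\<And>t. t \<in> {a..b} \<Longrightarrow> \<bar>q t\<bar> \<le> 1"
    using C.arc_of_equality[OF out] by blast
  have "a < b" using ab s by linarith
  \<comment> \<open>The arc was found for \<open>q\<close>, not for \<open>P\<close>. Since E is
    contained in I and |E| >= 2 pi - s >= |I|, the open set \<open>U\<close> is null, hence
    empty.\<close>
  define U where "U = {t. 1 < cmod (poly P (cis t))} \<inter> {a<..<b}"
  have "open U"
    unfolding U_def by (intro open_Int open_Collect_less contP continuous_on_const open_greaterThanLessThan)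
  have UI: "U \<subseteq> I" using ab by (auto simp: U_def I_def)
  have "U = {}"
  proof (rule ccontr)
    assume "U \<noteq> {}"
    have "measure lborel (E \<union> U) = measure lborel E + measure lborel U"
      using \<open>open U\<close> Eb EI UI I2 by (intro measure_Union fin) (auto simp: E_def U_def)
    moreover have "measure lborel (E \<union> U) \<le> measure lborel I"
      using \<open>open U\<close> Eb EI UI by (intro measure_mono_fmeasurable I_fm) auto
    ultimately have "measure lborel U \<le> 0"
      using C.measure_outside total mE by linarith
    then have "measure lborel U = 0" by (simp add: measure_le_0_iff)
    moreover have "emeasure lborel U \<noteq> \<infinity>" using UI I2 by (intro fin) blast
    ultimately have "emeasure lborel U = 0"
      by (simp add: emeasure_eq_ennreal_measure)
    then have "U \<in> null_sets lborel" using \<open>open U\<close> by (intro null_setsI) auto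
    then have "U \<in> null_sets lebesgue" by (rule null_sets_completionI)
    then have "negligible U" by (simp add: negligible_iff_null_sets)
    then show False using open_not_negligible[OF \<open>open U\<close> \<open>U \<noteq> {}\<close>] by blast
  qed
  then have "{a<..<b} \<subseteq> {t. cmod (poly P (cis t)) \<le> 1}"
    unfolding U_def disjoint_iff by (force simp: not_less)
  moreover have "closed {t. cmod (poly P (cis t)) \<le> 1}"
    by (intro closed_Collect_le contP continuous_on_const)
  ultimately have "{a..b} \<subseteq> {t. cmod (poly P (cis t)) \<le> 1}"
    using closure_minimal[of "{a<..<b}"] \<open>a < b\<close> by simp
  then have abE: "{a..b} \<subseteq> E" using ab by (auto simp: E_def)
  \<comment> \<open>The midpoint of the complementary gap from b - 2 pi to a, which contains
    0.\<close>
  define m where "m = (a + b - 2 * pi) / 2"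
  have arc: "{m + s / 2..m + 2 * pi - s / 2} \<subseteq> {a..b}"
    using ab by (auto simp: m_def field_simps)
  have "m + s / 2 \<in> {m + s / 2..m + 2 * pi - s / 2}" "m + 2 * pi - s / 2 \<in> {m + s / 2..m + 2 * pi - s / 2}"
    using s by auto
  then have "m + s / 2 \<in> {0<..<2 * pi}" "m + 2 * pi - s / 2 \<in> {0<..<2 * pi}"
    using arc abE E_sub by blast+
  then have m: "m + s / 2 > 0" "m - s / 2 < 0" by auto
  have bd: "\<bar>p t\<bar> \<le> 1" if "t \<in> {m + s / 2..m + 2 * pi - s / 2}" for t
    using that arc abE adm unfolding admissible_def by blast
  have p0': "poly (chebyshev n) (1 / cos (s / 4)) \<le> p 0" using p0 big by simp
  note uniq = extremal_unique[OF n p bd s m p0']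
  obtain T where T: "T \<subseteq> {m + s / 2..m + 2 * pi - s / 2}" "card T = Suc n" "\<And>t. t \<in> T \<Longrightarrow> \<bar>p t\<bar> = 1"
    using uniq(2) by blast
  \<comment> \<open>At the n + 1 points of \<open>T\<close> the real part already has modulus 1 and
    |G| <= 1, so the imaginary part vanishes there and hence identically.\<close>
  have Im0: "complex_of_real (Im (G t)) = 0" for t
  proof (rule semitrig_eq_zero[OF semitrig_Im[OF G], of T])
    have TE: "T \<subseteq> E" using T(1) arc abE by blast
    then show "T \<subseteq> {0..<2 * pi}" using E_sub' by blast
    show "card T > n" using T(2) by simp
    fix t assume t: "t \<in> T"
    then have "(cmod (G t))\<^sup>2 \<le> 1" using TE by (auto simp: normG E_def abs_square_le_1)
    moreover have "(Re (G t))\<^sup>2 = 1" using T(3)[OF t] by (simp add: p_def abs_square_eq_1)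
    ultimately have "(Im (G t))\<^sup>2 \<le> 0" by (simp add: cmod_power2)
    then show "complex_of_real (Im (G t)) = 0" by simp
  qed
  have Gp: "G t = of_real (p t)" for t
    using Im0[of t] by (simp add: p_def complex_eq_iff)
  have "u \<noteq> 0" using u by auto
  define r where "r = Arg (cnj u)"
  have r: "cis r = cnj u" using u \<open>u \<noteq> 0\<close> by (simp add: r_def cis_Arg sgn_eq)
  have uu: "cnj u * u = 1" using complex_norm_square[of u] u by (simp add: mult.commute)
  have "poly P (cis z) = cis (real n * z / 2 + r) *
      of_real (poly (chebyshev n) (1 / cos (s / 4) * cos ((z - m) / 2)))" for z
  proof -
    have "cis (real n * z / 2 + r) * G z =
        (cis (real n * z / 2) * cis (- (real n * z / 2))) * (cnj u * u) * poly P (cis z)"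
      by (simp only: G_def r mult_ac flip: cis_mult)
    also have "\<dots> = poly P (cis z)" unfolding uu cis_mult by simp
    finally have "cis (real n * z / 2 + r) * of_real (p z) = poly P (cis z)" unfolding Gp .
    moreover have "p z = poly (chebyshev n) (1 / cos (s / 4) * cos ((z - m) / 2))" by (rule uniq(1))
    ultimately show ?thesis by simp
  qed
  then show ?thesis by blast
qed

section \<open>Rotation invariance of arc length, and the final reduction\<close>

lemma lmeasurable_closed_Int_interval:
  fixes C :: "real set"
  assumes "closed C" shows "C \<inter> {u..<v} \<in> lmeasurable"
proof (rule bounded_set_imp_lmeasurable)
  show "bounded (C \<inter> {u..<v})"
    by (rule bounded_subset[OF bounded_closed_interval[of u v]]) auto
  show "C \<inter> {u..<v} \<in> sets lebesgue"
    using assms by (simp add: borel_closed)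
qed

text \<open>Cut the period at 2 pi - a: the first piece is translated by a, the second by a - 2 pi.
  Closedness provides measurability of the pieces.\<close>

lemma measure_periodic_shift:
  fixes A :: "real set"
  assumes A: "closed A" and per: "\<And>t. t + 2 * pi \<in> A \<longleftrightarrow> t \<in> A" and a: "0 \<le> a" "a \<le> 2 * pi"
  shows "measure lebesgue {t \<in> {0..<2 * pi}. t + a \<in> A} = measure lebesgue (A \<inter> {0..<2 * pi})"
proof -
  define B where "B = {t. t + a \<in> A}"
  have "closed ((\<lambda>t. t + a) -` A)" by (intro continuous_closed_vimage A) (simp add: isCont_def tendsto_intros)
  then have B: "closed B" by (simp add: B_def vimage_def)
  have split: "measure lebesgue (C \<inter> {0..<2 * pi}) =
      measure lebesgue (C \<inter> {0..<b}) + measure lebesgue (C \<inter> {b..<2 * pi})"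
    if C: "closed C" and b: "0 \<le> b" "b \<le> 2 * pi" for C b
  proof -
    note lm = lmeasurable_closed_Int_interval[OF C]
    have "measure lebesgue ((C \<inter> {0..<b}) \<union> (C \<inter> {b..<2 * pi})) =
        measure lebesgue (C \<inter> {0..<b}) + measure lebesgue (C \<inter> {b..<2 * pi})"
      using fmeasurableD2[OF lm] by (intro measure_Union fmeasurableD[OF lm]) auto
    also have "(C \<inter> {0..<b}) \<union> (C \<inter> {b..<2 * pi}) = C \<inter> {0..<2 * pi}" using b by auto
    finally show ?thesis .
  qed
  have 1: "(+) a ` (B \<inter> {0..<2 * pi - a}) = A \<inter> {a..<2 * pi}"
  proof (intro set_eqI iffI)
    fix x assume "x \<in> A \<inter> {a..<2 * pi}"
    then show "x \<in> (+) a ` (B \<inter> {0..<2 * pi - a})"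
      by (intro image_eqI[of _ _ "x - a"]) (auto simp: B_def)
  qed (auto simp: B_def add.commute)
  have 2: "(+) (a - 2 * pi) ` (B \<inter> {2 * pi - a..<2 * pi}) = A \<inter> {0..<a}"
  proof (intro set_eqI iffI)
    fix x assume "x \<in> A \<inter> {0..<a}"
    then show "x \<in> (+) (a - 2 * pi) ` (B \<inter> {2 * pi - a..<2 * pi})"
      using per[of x] by (intro image_eqI[of _ _ "x - a + 2 * pi"]) (auto simp: B_def)
  next
    fix x assume "x \<in> (+) (a - 2 * pi) ` (B \<inter> {2 * pi - a..<2 * pi})"
    then obtain t where t: "x = a - 2 * pi + t" "t + a \<in> A" "2 * pi - a \<le> t" "t < 2 * pi"
      by (auto simp: B_def)
    have xt: "x + 2 * pi = t + a" using t(1) by simp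
    have "x \<in> A" using per[of x] t(2) unfolding xt by simp
    then show "x \<in> A \<inter> {0..<a}" using t by simp
  qed
  have "{t \<in> {0..<2 * pi}. t + a \<in> A} = B \<inter> {0..<2 * pi}" by (auto simp: B_def)
  also have "measure lebesgue \<dots> =
      measure lebesgue (B \<inter> {0..<2 * pi - a}) + measure lebesgue (B \<inter> {2 * pi - a..<2 * pi})"
    using a by (intro split B) auto
  also have "\<dots> = measure lebesgue (A \<inter> {a..<2 * pi}) + measure lebesgue (A \<inter> {0..<a})"
    unfolding 1[symmetric] 2[symmetric] measure_translation ..
  also have "\<dots> = measure lebesgue (A \<inter> {0..<2 * pi})"
    using split[OF A a] by simp
  finally show ?thesis .
qed


theorem theorem1p2:
  fixes n :: nat and s :: real and P :: "complex poly" and E :: "complex set"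
  assumes "0 < s" and "s < 2 * pi"
    and "degree P = n"
    and "circle_measurable E"
    and "\<forall>\<zeta>\<in>E. cmod (poly P \<zeta>) \<le> 1"
    and "arc_measure E \<ge> 2 * pi - s"
  shows "(SUP \<zeta>\<in>sphere 0 1. cmod (poly P \<zeta>)) \<le> poly (chebyshev n) (1 / cos (s / 4)) \<and>
         ((SUP \<zeta>\<in>sphere 0 1. cmod (poly P \<zeta>)) = poly (chebyshev n) (1 / cos (s / 4)) \<longleftrightarrow>
           (\<exists>c0 c1 :: real. \<forall>z :: real.
              poly P (cis z) = cis (real n * z / 2 + c1) *
                complex_of_real (poly (chebyshev n) (1 / cos (s / 4) * cos ((z - c0) / 2)))))"
proof -
  define M where "M = poly (chebyshev n) (1 / cos (s / 4))"
  define S where "S = (SUP \<zeta>\<in>sphere 0 1. cmod (poly P \<zeta>))"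
  let ?form = "\<exists>c0 c1 :: real. \<forall>z :: real. poly P (cis z) = cis (real n * z / 2 + c1) *
      complex_of_real (poly (chebyshev n) (1 / cos (s / 4) * cos ((z - c0) / 2)))"
  have c: "0 < cos (s / 4)" "cos (s / 4) \<le> 1"
    using assms(1,2) by (auto intro: cos_gt_zero_pi)
  have cont: "continuous_on (sphere 0 1) (\<lambda>\<zeta>. cmod (poly P \<zeta>))" by (intro continuous_intros)
  obtain \<zeta>0 where \<zeta>0: "\<zeta>0 \<in> sphere 0 1" "\<And>\<zeta>. \<zeta> \<in> sphere 0 1 \<Longrightarrow> cmod (poly P \<zeta>) \<le> cmod (poly P \<zeta>0)"
    using continuous_attains_sup[OF compact_sphere _ cont] by fastforce
  have S: "S = cmod (poly P \<zeta>0)"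
    unfolding S_def using \<zeta>0 by (intro cSup_eq_maximum) auto
  have form_imp: "S = M" if ?form
  proof -
    obtain c0 c1 :: real where f: "\<And>z. poly P (cis z) = cis (real n * z / 2 + c1) *
        complex_of_real (poly (chebyshev n) (1 / cos (s / 4) * cos ((z - c0) / 2)))"
      using \<open>?form\<close> by blast
    have norm_f: "cmod (poly P (cis z)) = \<bar>poly (chebyshev n) (1 / cos (s / 4) * cos ((z - c0) / 2))\<bar>" for z
      unfolding f by (simp only: norm_mult norm_cis norm_of_real mult_1)
    have "cmod (poly P (cis (Arg \<zeta>0))) \<le> M"
      unfolding norm_f M_def
    proof (rule abs_chebyshev_le)
      have "\<bar>cos ((Arg \<zeta>0 - c0) / 2)\<bar> / cos (s / 4) \<le> 1 / cos (s / 4)"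
        using c by (intro divide_right_mono) auto
      then show "\<bar>1 / cos (s / 4) * cos ((Arg \<zeta>0 - c0) / 2)\<bar> \<le> 1 / cos (s / 4)"
        using c by (simp add: abs_mult)
      show "1 \<le> 1 / cos (s / 4)" using c by simp
    qed
    moreover have "cis (Arg \<zeta>0) = \<zeta>0"
      using \<zeta>0(1) by (subst cis_Arg) (auto simp: sgn_eq)
    moreover have "M \<le> cmod (poly P \<zeta>0)"
    proof -
      have "M \<le> \<bar>poly (chebyshev n) (1 / cos (s / 4) * cos ((c0 - c0) / 2))\<bar>" by (simp add: M_def)
      also have "\<dots> = cmod (poly P (cis c0))" by (simp only: norm_f)
      also have "\<dots> \<le> cmod (poly P \<zeta>0)" by (intro \<zeta>0(2)) simp
      finally show ?thesis .
    qed
    ultimately show ?thesis by (simp add: S)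
  qed
  have big_imp: ?form if "S \<ge> M"
  proof (cases "n = 0")
    case True
    then obtain a where a: "P = [:a:]" using assms(3) degree_eq_zeroE by blast
    \<comment> \<open>For n = 0 there is no alternation to exploit. The set has positive measure, so
      it contains a point, which already gives |a| <= 1.\<close>
    have "circle_angles E \<noteq> {}"
      using assms(2,6) by (auto simp: arc_measure_def)
    then have "cmod a \<le> 1" using assms(5) by (auto simp: circle_angles_def a)
    moreover have "cmod a \<ge> 1" using \<open>S \<ge> M\<close> by (simp add: S M_def True chebyshev_0 a)
    ultimately have "cmod a = 1" by simp
    then have "cis (Arg a) = a" by (subst cis_Arg) (auto simp: sgn_eq)
    then show ?thesis
      by (intro exI[of _ 0] exI[of _ "Arg a"] allI) (simp add: True a chebyshev_0)
  next
    case False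
    define \<phi> where "\<phi> = Arg2pi \<zeta>0"
    have \<phi>: "0 \<le> \<phi>" "\<phi> \<le> 2 * pi" "cis \<phi> = \<zeta>0"
      using Arg2pi_ge_0[of \<zeta>0] Arg2pi_lt_2pi[of \<zeta>0] Arg2pi_eq[of \<zeta>0] \<zeta>0(1)
      by (simp_all add: \<phi>_def cis_conv_exp)
    \<comment> \<open>The rotation that moves the maximum point to 1, as \<open>remez_core\<close>
      expects.\<close>
    define P1 where "P1 = pcompose P [:0, cis \<phi>:]"
    have P1: "poly P1 (cis t) = poly P (cis (t + \<phi>))" for t
    proof -
      have "poly P1 (cis t) = poly P (cis t * cis \<phi>)" by (simp add: P1_def poly_pcompose)
      then show ?thesis by (simp only: cis_mult)
    qed
    define A where "A = {t. cmod (poly P (cis t)) \<le> 1}"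
    have A: "closed A"
      unfolding A_def by (intro closed_Collect_le continuous_intros)
    have per: "t + 2 * pi \<in> A \<longleftrightarrow> t \<in> A" for t
    proof -
      have "cis (t + 2 * pi) = cis t" by (simp flip: cis_mult)
      then show ?thesis by (simp add: A_def)
    qed
    have lm: "A \<inter> {0..<2 * pi} \<in> lmeasurable"
      by (rule lmeasurable_closed_Int_interval[OF A])
    define B where "B = {t \<in> {0..2 * pi}. cmod (poly P1 (cis t)) \<le> 1}"
    have B_eq: "B = {0..2 * pi} \<inter> {t. cmod (poly P1 (cis t)) \<le> 1}" by (auto simp: B_def)
    have "compact B"
      unfolding B_eq by (intro compact_Int_closed compact_Icc closed_Collect_le continuous_intros)
    have "2 * pi - s \<le> measure lebesgue (circle_angles E)"
      using assms(6) by (simp add: arc_measure_def)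
    also have "\<dots> \<le> measure lebesgue (A \<inter> {0..<2 * pi})"
      using assms(4,5)
      by (intro measure_mono_fmeasurable lm) (auto simp: circle_measurable_def circle_angles_def A_def)
    also have "\<dots> = measure lebesgue {t \<in> {0..<2 * pi}. t + \<phi> \<in> A}"
      by (rule measure_periodic_shift[OF A per \<phi>(1,2), symmetric])
    also have "\<dots> \<le> measure lebesgue B"
    proof (intro measure_mono_fmeasurable lmeasurable_compact \<open>compact B\<close>)
      show "{t \<in> {0..<2 * pi}. t + \<phi> \<in> A} \<subseteq> B" by (auto simp: A_def B_def P1)
      have "closed ((\<lambda>t. t + \<phi>) -` A)" by (intro continuous_closed_vimage A) (simp add: isCont_def tendsto_intros)
      moreover have "{t \<in> {0..<2 * pi}. t + \<phi> \<in> A} = {0..<2 * pi} \<inter> (\<lambda>t. t + \<phi>) -` A" by auto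
      ultimately show "{t \<in> {0..<2 * pi}. t + \<phi> \<in> A} \<in> sets lebesgue"
        by (simp add: borel_closed)
    qed
    finally have meas: "2 * pi - s \<le> measure lebesgue B" .
    have deg: "degree P1 \<le> n" by (simp add: P1_def degree_pcompose assms(3))
    have big: "M \<le> cmod (poly P1 1)"
      using \<open>S \<ge> M\<close> P1[of 0] \<phi>(3) by (simp add: S)
    have n: "n \<ge> 1" using False by simp
    obtain c0 c1 :: real where f: "\<And>z. poly P1 (cis z) = cis (real n * z / 2 + c1) *
        complex_of_real (poly (chebyshev n) (1 / cos (s / 4) * cos ((z - c0) / 2)))"
      using remez_core[OF n deg assms(1,2) meas[unfolded B_def] big[unfolded M_def]] by blast
    show ?thesis
    proof (intro exI allI)
      fix z :: real
      have "poly P (cis z) = poly P1 (cis (z - \<phi>))" by (simp add: P1)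
      also have "\<dots> = cis (real n * (z - \<phi>) / 2 + c1) *
          complex_of_real (poly (chebyshev n) (1 / cos (s / 4) * cos ((z - \<phi> - c0) / 2)))"
        by (rule f)
      also have "real n * (z - \<phi>) / 2 + c1 = real n * z / 2 + (c1 - real n * \<phi> / 2)"
        by (simp add: field_simps)
      also have "z - \<phi> - c0 = z - (\<phi> + c0)" by simp
      finally show "poly P (cis z) = cis (real n * z / 2 + (c1 - real n * \<phi> / 2)) *
          complex_of_real (poly (chebyshev n) (1 / cos (s / 4) * cos ((z - (\<phi> + c0)) / 2)))" .
    qed
  qed
  \<comment> \<open>The inequality comes from the equality case: S >= M yields the extremal form,
    and its maximum is exactly M.\<close>
  have "S \<le> M"
  proof (cases "S \<ge> M")
    case True
    show ?thesis using form_imp[OF big_imp[OF True]] by simp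
  qed simp
  moreover have "S = M \<longleftrightarrow> ?form" using form_imp big_imp by blast
  ultimately show ?thesis unfolding S_def M_def by blast
qed

end
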